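(* Let $A=\bigcup_n A_n$ be a family of combinatorial objects and let $\{G_w(x):w\in A\}$ be a family of symmetric polynomials in $x=(x_1,\ldots,x_n)$ such that $G_w=\sum_\alpha c_{w\alpha}F_\alpha$, where $\alpha$ ranges over compositions with at most $n$ positive parts and the function $(w,\alpha)\mapsto c_{w\alpha}$ is in $\mathsf{GapP}$. Define $d_{w\lambda}$ by $G_w=\sum_\lambda d_{w\lambda}s_\lambda$, the sum over partitions $\lambda$ with at most $n$ parts. Then $(w,\lambda)\mapsto d_{w\lambda}$ is in $\mathsf{GapP}$. The same conclusion holds if the fundamental quasisymmetric polynomials $F_\alpha$ in the hypothesis are replaced by the monomial quasisymmetric polynomials $M_\alpha$.
   Context: $M_\alpha=\sum_{1\le i_1<\cdots<i_\ell\le n}x_{i_1}^{\alpha_1}\cdots x_{i_\ell}^{\alpha_\ell}$; $F_\alpha=\sum_{\beta\preccurlyeq\alpha}M_\beta$, where $\beta\preccurlyeq\alpha$ means $\alpha$ is obtained from $\beta$ by adding consecutive parts. $s_\lambda$ are Schur polynomials. Objects in $A_n$ are binary words of size $n$; partitions and compositions are encoded in unary. $\#\mathsf{P}$ = functions counting polynomially bounded witnesses of a polynomial-time decidable relation; $\mathsf{GapP}=\#\mathsf{P}-\#\mathsf{P}$. *)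

theory Defs
  imports
    "HOL-Library.Poly_Mapping"
    "HOL-Combinatorics.Permutations"
    "HOL-Computational_Algebra.Polynomial"
begin

section \<open>Deterministic multi-tape Turing machines and polynomial time\<close>

text \<open>
  States and tape symbols are initial segments of the naturals. State 0 is initial, state 1 accepts,
  state 2 rejects; symbol 0 is the blank, symbols 1 and 2 stand for the two input bits. Tapes are
  infinite in both directions. The transition function sees the scanned symbols of all tapes and
  yields the next state together with, for each tape, the symbol to write and the head movement.
\<close>

datatype move = Move_Left | Stay | Move_Right

record tm =
  tapes :: nat
  symbols :: nat
  states :: nat
  trans :: "nat \<Rightarrow> nat list \<Rightarrow> nat \<times> (nat \<times> move) list"

definition wf_tm :: "tm \<Rightarrow> bool" where
  "wf_tm M \<longleftrightarrow> tapes M \<ge> 1 \<and> symbols M \<ge> 3 \<and> states M \<ge> 3 \<and>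
     (\<forall>q ss. q < states M \<and> length ss = tapes M \<and> set ss \<subseteq> {..<symbols M} \<longrightarrow>
        fst (trans M q ss) < states M \<and>
        length (snd (trans M q ss)) = tapes M \<and>
        fst ` set (snd (trans M q ss)) \<subseteq> {..<symbols M})"

type_synonym tape = "(int \<Rightarrow> nat) \<times> int"
type_synonym config = "nat \<times> tape list"

definition scan :: "tape \<Rightarrow> nat" where
  "scan t = fst t (snd t)"

fun move_head :: "move \<Rightarrow> int \<Rightarrow> int" where
  "move_head Move_Left h = h - 1"
| "move_head Stay h = h"
| "move_head Move_Right h = h + 1"

definition act :: "nat \<times> move \<Rightarrow> tape \<Rightarrow> tape" where
  "act a t = ((fst t)(snd t := fst a), move_head (snd a) (snd t))"

definition step :: "tm \<Rightarrow> config \<Rightarrow> config" where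
  "step M cfg =
     (if fst cfg = 1 \<or> fst cfg = 2 then cfg
      else (let r = trans M (fst cfg) (map scan (snd cfg))
            in (fst r, map2 act (snd r) (snd cfg))))"

definition input_tape :: "bool list \<Rightarrow> tape" where
  "input_tape x =
     (\<lambda>i. if 0 \<le> i \<and> i < int (length x) then (if x ! nat i then 2 else 1) else 0, 0)"

definition blank_tape :: tape where
  "blank_tape = (\<lambda>_. 0, 0)"

definition init_config :: "tm \<Rightarrow> bool list \<Rightarrow> config" where
  "init_config M x = (0, input_tape x # replicate (tapes M - 1) blank_tape)"

definition decides_in_time :: "tm \<Rightarrow> bool list set \<Rightarrow> (nat \<Rightarrow> nat) \<Rightarrow> bool" where
  "decides_in_time M L T \<longleftrightarrow>
     (\<forall>x. \<exists>t \<le> T (length x).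
        fst ((step M ^^ t) (init_config M x)) = (if x \<in> L then 1 else 2))"

definition PTIME :: "bool list set set" where
  "PTIME = {L. \<exists>M (p :: nat poly). wf_tm M \<and> decides_in_time M L (poly p)}"


section \<open>Counting classes\<close>

text \<open>Self-delimiting pairing: the bits of the first word are doubled, and 01 is the separator.\<close>

definition word_pair :: "bool list \<Rightarrow> bool list \<Rightarrow> bool list" where
  "word_pair x y = concat (map (\<lambda>b. [b, b]) x) @ [False, True] @ y"

definition ptime_relation :: "(bool list \<times> bool list) set \<Rightarrow> bool" where
  "ptime_relation R \<longleftrightarrow> {word_pair x y | x y. (x, y) \<in> R} \<in> PTIME"

definition SharpP :: "(bool list \<Rightarrow> nat) set" where
  "SharpP = {f. \<exists>R (p :: nat poly). ptime_relation R \<and>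
     (\<forall>x. f x = card {y. length y \<le> poly p (length x) \<and> (x, y) \<in> R})}"

definition GapP :: "(bool list \<Rightarrow> int) set" where
  "GapP = {h. \<exists>f \<in> SharpP. \<exists>g \<in> SharpP. \<forall>x. h x = int (f x) - int (g x)}"

text \<open>
  A function defined only on some set \<open>D\<close> of objects, given by their encodings, is in GapP if
  it agrees on \<open>D\<close> with a GapP function on words.
\<close>

definition gapP_on :: "'a set \<Rightarrow> ('a \<Rightarrow> bool list) \<Rightarrow> ('a \<Rightarrow> int) \<Rightarrow> bool" where
  "gapP_on D enc f \<longleftrightarrow> (\<exists>h \<in> GapP. \<forall>a \<in> D. f a = h (enc a))"

definition unary :: "nat list \<Rightarrow> bool list" where
  "unary \<alpha> = concat (map (\<lambda>a. replicate a True @ [False]) \<alpha>)"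

definition encode :: "bool list \<times> nat list \<Rightarrow> bool list" where
  "encode p = word_pair (fst p) (unary (snd p))"


section \<open>Symmetric and quasisymmetric polynomials\<close>

text \<open>
  Polynomials with integer coefficients in variables indexed by naturals: finitely supported maps
  from monomials (finitely supported exponent vectors) to coefficients. The variables
  \<open>x\<^sub>1, \<dots>, x\<^sub>n\<close> are those with index in \<open>{1..n}\<close>.
\<close>

type_synonym mpoly = "(nat \<Rightarrow>\<^sub>0 nat) \<Rightarrow>\<^sub>0 int"

definition var :: "nat \<Rightarrow> mpoly" where
  "var i = Poly_Mapping.single (Poly_Mapping.single i 1) 1"

definition symmetric_poly :: "nat \<Rightarrow> mpoly \<Rightarrow> bool" where
  "symmetric_poly n g \<longleftrightarrow>
     (\<forall>m \<in> Poly_Mapping.keys g. Poly_Mapping.keys m \<subseteq> {1..n}) \<and>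
     (\<forall>\<pi>. \<pi> permutes {1..n} \<longrightarrow>
        (\<forall>m. Poly_Mapping.lookup g (Poly_Mapping.map_key \<pi> m) = Poly_Mapping.lookup g m))"

definition compositions :: "nat list set" where
  "compositions = {\<alpha>. \<forall>a \<in> set \<alpha>. a > 0}"

definition partitions :: "nat list set" where
  "partitions = {\<mu> \<in> compositions. sorted_wrt (\<ge>) \<mu>}"

definition comp_refines :: "nat list \<Rightarrow> nat list \<Rightarrow> bool" where
  "comp_refines \<beta> \<alpha> \<longleftrightarrow> (\<exists>bs. [] \<notin> set bs \<and> concat bs = \<beta> \<and> map sum_list bs = \<alpha>)"

definition monomial_qsym :: "nat \<Rightarrow> nat list \<Rightarrow> mpoly" where
  "monomial_qsym n \<alpha> =
     (\<Sum>is | length is = length \<alpha> \<and> sorted_wrt (<) is \<and> set is \<subseteq> {1..n}.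
        \<Prod>j < length \<alpha>. var (is ! j) ^ (\<alpha> ! j))"

definition fundamental_qsym :: "nat \<Rightarrow> nat list \<Rightarrow> mpoly" where
  "fundamental_qsym n \<alpha> = (\<Sum>\<beta> | \<beta> \<in> compositions \<and> comp_refines \<beta> \<alpha>. monomial_qsym n \<beta>)"

text \<open>Semistandard Young tableaux of shape \<open>\<mu>\<close> with entries in \<open>{1..n}\<close>, as lists of rows.\<close>

definition SSYT :: "nat \<Rightarrow> nat list \<Rightarrow> nat list list set" where
  "SSYT n \<mu> = {T. map length T = \<mu> \<and> set (concat T) \<subseteq> {1..n} \<and>
     (\<forall>r \<in> set T. sorted r) \<and>
     (\<forall>i j. Suc i < length T \<and> j < length (T ! Suc i) \<longrightarrow> T ! i ! j < T ! Suc i ! j)}"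

definition schur :: "nat \<Rightarrow> nat list \<Rightarrow> mpoly" where
  "schur n \<mu> = (\<Sum>T \<in> SSYT n \<mu>. prod_list (map var (concat T)))"

text \<open>
  \<open>g\<close> is the linear combination of the polynomials \<open>b i\<close>, \<open>i \<in> I\<close>, with coefficients \<open>c i\<close>,
  only finitely many of which are nonzero.
\<close>

definition expands_in :: "('i \<Rightarrow> mpoly) \<Rightarrow> 'i set \<Rightarrow> mpoly \<Rightarrow> ('i \<Rightarrow> int) \<Rightarrow> bool" where
  "expands_in b I g c \<longleftrightarrow>
     finite {i \<in> I. c i \<noteq> 0} \<and> g = (\<Sum>i | i \<in> I \<and> c i \<noteq> 0. of_int (c i) * b i)"

definition compositions_upto :: "nat \<Rightarrow> nat list set" where
  "compositions_upto n = {\<alpha> \<in> compositions. length \<alpha> \<le> n}"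

definition partitions_upto :: "nat \<Rightarrow> nat list set" where
  "partitions_upto n = {\<mu> \<in> partitions. length \<mu> \<le> n}"

end

theory Submission
  imports Defs "Jordan_Normal_Form.Determinant"
begin

text \<open>
  Multiplying \<open>G\<close> by the Vandermonde product and using the bialternant formula for Schur polynomials,
  the coefficient \<open>d\<close> at a partition \<open>\<mu>\<close> of length \<open>n\<close> is the coefficient of the monomial with exponent
  \<open>\<mu> + \<delta>\<close> in the product of \<open>G\<close> and all \<open>x\<^sub>i - x\<^sub>j\<close> with \<open>i < j \<le> n\<close>. Expanding the product instead
  of writing it as a determinant gives a signed sum over all sets \<open>T\<close> of pairs \<open>i < j\<close> of the coefficient
  of \<open>G\<close> at the exponent vector \<open>\<mu> + \<Sum>\<^bsub>(i, j) \<in> T\<^esub> (e\<^sub>i - e\<^sub>j)\<close>, so that every bit string of the right length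
  encodes a summand and only nonnegativity of the exponents has to be verified. Such a coefficient is
  the monomial quasisymmetric coefficient at the composition of nonzero exponents, or the sum of the
  fundamental coefficients at all of its coarsenings. A witness for \<open>d\<close> thus consists of
  the bits of \<open>T\<close>, the bits of a coarsening, and a witness for \<open>c\<close>; the total size of the unary composition does
  not grow. Membership in polynomial time is shown by writing the verifier as a structured program
  over stacks of bits and compiling such programs to multi-tape Turing machines.
\<close>

section \<open>Stack programs and their simulation by Turing machines\<close>

text \<open>The verifier never uses the number of variables: a partition with fewer than
  \<open>n\<close> parts is treated in \<open>length \<mu>\<close> variables, because coefficients
  of monomials in the first variables survive setting the others to zero. Signs force a branching
  end. As \<open>c\<close> is a difference \<open>f - g\<close> of counting functions, an even set
  of pairs must be completed by an \<open>f\<close>-witness and an odd one by a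
  \<open>g\<close>-witness for the positive part of \<open>d\<close>, and the other way round for
  the negative part. Hence a program ends by starting one of two given deciders, selected by a
  computed bit. Since the witness for \<open>c\<close> is the unread tail of the witness for
  \<open>d\<close>, a length bound on the whole does not cut the tail at the right place; the bounds
  of \<open>f\<close> and \<open>g\<close> are therefore made part of their relations beforehand,
  which takes a machine that evaluates a polynomial in unary. The bialternant formula is obtained
  without division: Vandermonde product times Schur polynomial and the alternant satisfy the same
  recursion on the number of variables, a sum over interlacing shapes.\<close>

text \<open>
  A register is a stack of bits kept on a tape with its top under the head and growing to the left, so
  an input tape is itself a stack, and a push takes two machine steps. \<open>Write\<close> only serves as
  the control point between these two steps and never occurs in programs.
\<close>

type_synonym regs = "nat \<Rightarrow> bool list"

datatype com =
    Skip
  | Fail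
  | Push nat bool
  | Write nat bool
  | Pop nat
  | Seq com com  (infixr \<open>;;\<close> 60)
  | Case nat com com com
  | While nat com

text \<open>
  The number counts the steps of the compiled machine exactly; the outcome \<open>None\<close> is rejection.
\<close>

inductive exec :: "com \<Rightarrow> regs \<Rightarrow> nat \<Rightarrow> regs option \<Rightarrow> bool" where
  Skip: "exec Skip s 1 (Some s)"
| Fail: "exec Fail s 1 None"
| Push: "exec (Push r b) s 2 (Some (s(r := b # s r)))"
| Pop: "exec (Pop r) s 1 (Some (s(r := tl (s r))))"
| Seq_None: "exec a s t None \<Longrightarrow> exec (a ;; b) s (Suc t) None"
| Seq_Some: "exec a s t (Some s') \<Longrightarrow> exec b s' u out \<Longrightarrow> exec (a ;; b) s (Suc (t + u)) out"
| Case: "exec (case s r of [] \<Rightarrow> a | x # _ \<Rightarrow> if x then c else b) s t out \<Longrightarrow>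
    exec (Case r a b c) s (Suc t) out"
| While_End: "s r = [] \<Longrightarrow> exec (While r a) s 1 (Some s)"
| While_None: "s r \<noteq> [] \<Longrightarrow> exec a s t None \<Longrightarrow> exec (While r a) s (Suc t) None"
| While_Some: "s r \<noteq> [] \<Longrightarrow> exec a s t (Some s') \<Longrightarrow> exec (While r a) s' u out \<Longrightarrow>
    exec (While r a) s (Suc (t + u)) out"

fun reg_set :: "com \<Rightarrow> nat set" where
  "reg_set Skip = {}"
| "reg_set Fail = {}"
| "reg_set (Push r b) = {r}"
| "reg_set (Write r b) = {r}"
| "reg_set (Pop r) = {r}"
| "reg_set (a ;; b) = reg_set a \<union> reg_set b"
| "reg_set (Case r a b c) = insert r (reg_set a \<union> reg_set b \<union> reg_set c)"
| "reg_set (While r a) = insert r (reg_set a)"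

lemma exec_unchanged:
  "exec c s t out \<Longrightarrow> out = Some s' \<Longrightarrow> r \<notin> reg_set c \<Longrightarrow> s' r = s r"
  by (induction arbitrary: s' rule: exec.induct) (auto split: list.splits if_splits)

lemma exec_length:
  "exec c s t out \<Longrightarrow> out = Some s' \<Longrightarrow> length (s' r) \<le> length (s r) + t"
proof (induction arbitrary: s' rule: exec.induct)
  case (Seq_Some a s t s1 b u out)
  from Seq_Some.IH(1)[OF refl] Seq_Some.IH(2)[OF Seq_Some.prems] show ?case by simp
next
  case (While_Some s r a t s1 u out)
  from While_Some.IH(1)[OF refl] While_Some.IH(2)[OF While_Some.prems] show ?case by simp
qed auto

text \<open>
  The control states of the compiled machine are the continuations that can arise during execution.
\<close>

fun conts :: "com \<Rightarrow> com list \<Rightarrow> com list set" where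
  "conts Skip k = {Skip # k}"
| "conts Fail k = {Fail # k}"
| "conts (Push r b) k = {Push r b # k, Write r b # k}"
| "conts (Write r b) k = {Write r b # k}"
| "conts (Pop r) k = {Pop r # k}"
| "conts (a ;; b) k = insert ((a ;; b) # k) (conts a (b # k) \<union> conts b k)"
| "conts (Case r a b c) k = insert (Case r a b c # k) (conts a k \<union> conts b k \<union> conts c k)"
| "conts (While r a) k = insert (While r a # k) (conts a (While r a # k))"

lemma finite_conts: "finite (conts c k)"
  by (induction c arbitrary: k) auto

lemma Cons_in_conts: "c # k \<in> conts c k"
  by (cases c) auto

text \<open>Heads drift as stacks grow and shrink, and the embedded decider starts with its head at
  an arbitrary cell; contents as seen from the head are the invariant description.\<close>

definition rel_tape :: "tape \<Rightarrow> int \<Rightarrow> nat" where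
  "rel_tape t = (\<lambda>i. fst t (snd t + i))"

definition stack :: "bool list \<Rightarrow> int \<Rightarrow> nat" where
  "stack xs = fst (input_tape xs)"

lemma stack_altdef:
  "stack xs i = (if 0 \<le> i \<and> i < int (length xs) then (if xs ! nat i then 2 else 1) else 0)"
  by (simp add: stack_def input_tape_def)

lemma rel_tape_input [simp]: "rel_tape (input_tape xs) = stack xs"
  by (simp add: rel_tape_def stack_def input_tape_def)

lemma rel_tape_blank [simp]: "rel_tape blank_tape = stack []"
  by (auto simp: rel_tape_def stack_altdef blank_tape_def)

lemma scan_rel_tape: "scan t = rel_tape t 0"
  by (simp add: scan_def rel_tape_def)

definition rel_act :: "nat \<times> move \<Rightarrow> (int \<Rightarrow> nat) \<Rightarrow> int \<Rightarrow> nat" where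
  "rel_act a f = (\<lambda>i. (f(0 := fst a)) (i + move_head (snd a) 0))"

lemma rel_tape_act: "rel_tape (act a t) = rel_act a (rel_tape t)"
  by (cases a; cases "snd a") (auto simp: rel_tape_def act_def rel_act_def fun_eq_iff algebra_simps)

lemma stack_0: "stack xs 0 = (case xs of [] \<Rightarrow> 0 | x # _ \<Rightarrow> if x then 2 else 1)"
  by (cases xs) (auto simp: stack_altdef)

lemma stack_lt_3: "stack xs i < 3"
  by (auto simp: stack_altdef)

text \<open>The top is blanked before moving on, so that all cells left of the new top are blank
  again. On an empty stack a blank overwrites a blank, which matches
  \<open>tl [] = []\<close>.\<close>

lemma rel_act_pop: "rel_act (0, Move_Right) (stack xs) = stack (tl xs)"
proof
  fix i :: int
  have "nat (i + 1) = Suc (nat i)" if "0 \<le> i" using that by simp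
  then show "rel_act (0, Move_Right) (stack xs) i = stack (tl xs) i"
    by (cases xs) (auto simp: rel_act_def stack_altdef)
qed

text \<open>An action writes before it moves: the old top is rewritten while the head goes left, and
  only a second action can write the new bit.\<close>

lemma rel_act_push:
  "rel_act (if b then 2 else 1, Stay) (rel_act (stack xs 0, Move_Left) (stack xs)) = stack (b # xs)"
proof
  fix i :: int
  have "nat i = Suc (nat (i - 1))" if "0 < i" using that by simp
  then show "rel_act (if b then 2 else 1, Stay) (rel_act (stack xs 0, Move_Left) (stack xs)) i =
      stack (b # xs) i"
    by (auto simp: rel_act_def stack_altdef)
qed

text \<open>All cells are constrained, not only the scanned ones: \<open>wf_tm\<close> says nothing
  about transitions on symbols outside the alphabet, and any cell may be scanned later.\<close>

definition legal_config :: "tm \<Rightarrow> config \<Rightarrow> bool" where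
  "legal_config M cfg \<longleftrightarrow> fst cfg < states M \<and> length (snd cfg) = tapes M \<and>
     (\<forall>t \<in> set (snd cfg). \<forall>i. rel_tape t i < symbols M)"

lemma legal_step:
  assumes "wf_tm M" "legal_config M cfg"
  shows "legal_config M (step M cfg)"
proof (cases "fst cfg = 1 \<or> fst cfg = 2")
  case True
  then show ?thesis using assms by (simp add: step_def)
next
  case False
  define r where "r = trans M (fst cfg) (map scan (snd cfg))"
  have r: "fst r < states M" "length (snd r) = tapes M" "fst ` set (snd r) \<subseteq> {..<symbols M}"
  proof -
    have "set (map scan (snd cfg)) \<subseteq> {..<symbols M}" "length (map scan (snd cfg)) = tapes M"
      "fst cfg < states M"
      using assms(2) by (auto simp: scan_rel_tape legal_config_def)
    then show "fst r < states M" "length (snd r) = tapes M" "fst ` set (snd r) \<subseteq> {..<symbols M}"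
      using assms(1) unfolding wf_tm_def r_def by blast+
  qed
  have "rel_tape (act a t) i < symbols M" if "(a, t) \<in> set (zip (snd r) (snd cfg))" for a t i
  proof -
    have "fst a < symbols M" "t \<in> set (snd cfg)"
      using that r(3) by (auto dest: set_zip_leftD set_zip_rightD)
    then show ?thesis using assms(2) by (auto simp: rel_tape_act rel_act_def legal_config_def)
  qed
  moreover have "step M cfg = (fst r, map2 act (snd r) (snd cfg))"
    using False by (simp add: step_def r_def Let_def)
  ultimately show ?thesis
    using r assms(2) by (auto simp: legal_config_def)
qed

lemma legal_init: "wf_tm M \<Longrightarrow> legal_config M (init_config M x)"
  by (auto simp: wf_tm_def legal_config_def init_config_def less_le_trans[OF stack_lt_3])

lemma legal_steps: "wf_tm M \<Longrightarrow> legal_config M cfg \<Longrightarrow> legal_config M ((step M ^^ t) cfg)"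
  by (induction t) (auto intro: legal_step)

lemma funpow_compose:
  "f x = y \<Longrightarrow> (f ^^ t) y = z \<Longrightarrow> (f ^^ Suc (t + u)) x = (f ^^ u) z"
  by (simp add: funpow_Suc_right funpow_add add.commute[of t u] del: funpow.simps)

text \<open>The distinguished states get the numbers 0, 1, 2 fixed by the machine model, all others
  are numbered from 3 on. Ill-formed transitions are redirected to rejection, so that
  \<open>wf_tm\<close> holds although \<open>\<delta>\<close> may misbehave on arguments that never
  occur.\<close>

lemma ex_tm_of_automaton:
  fixes Q :: "'q set" and \<delta> :: "'q \<Rightarrow> nat list \<Rightarrow> 'q \<times> (nat \<times> move) list"
  assumes fin: "finite Q" and iar: "i \<in> Q" "a \<in> Q" "r \<in> Q" "distinct [i, a, r]"
    and k: "k \<ge> 1" and m: "m \<ge> 3"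
  shows "\<exists>M e. wf_tm M \<and> tapes M = k \<and> symbols M = m \<and> e i = 0 \<and> e a = 1 \<and> e r = 2 \<and> inj_on e Q \<and>
    (\<forall>q \<in> Q. \<forall>ss. fst (\<delta> q ss) \<in> Q \<and> length (snd (\<delta> q ss)) = k \<and>
        fst ` set (snd (\<delta> q ss)) \<subseteq> {..<m} \<longrightarrow>
      trans M (e q) ss = (e (fst (\<delta> q ss)), snd (\<delta> q ss)))"
proof -
  obtain f :: "'q \<Rightarrow> nat" and N where f: "f ` (Q - {i, a, r}) = {j. j < N}" "inj_on f (Q - {i, a, r})"
    using finite_imp_inj_to_nat_seg[of "Q - {i, a, r}"] fin by auto
  define e where "e q = (if q = i then 0 else if q = a then 1 else if q = r then 2 else f q + 3)" for q
  have inj: "inj_on e Q"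
  proof (rule inj_onI)
    fix x y assume "x \<in> Q" "y \<in> Q" "e x = e y"
    then show "x = y" using inj_onD[OF f(2), of x y] by (simp add: e_def split: if_splits)
  qed
  have e_less: "e q < N + 3" if "q \<in> Q" for q
    using f(1) that by (auto simp: e_def)
  define t where "t q ss = (let d = \<delta> (inv_into Q e q) ss in
    if fst d \<in> Q \<and> length (snd d) = k \<and> fst ` set (snd d) \<subseteq> {..<m} then (e (fst d), snd d)
    else (2, replicate k (0, Stay)))" for q ss
  define M where "M = \<lparr>tapes = k, symbols = m, states = N + 3, trans = t\<rparr>"
  have "wf_tm M"
    using k m e_less by (auto simp: wf_tm_def M_def t_def Let_def)
  moreover have "trans M (e q) ss = (e (fst (\<delta> q ss)), snd (\<delta> q ss))"
    if "q \<in> Q" "fst (\<delta> q ss) \<in> Q" "length (snd (\<delta> q ss)) = k" "fst ` set (snd (\<delta> q ss)) \<subseteq> {..<m}"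
    for q ss
    using that inj by (simp add: M_def t_def Let_def)
  moreover have "e i = 0" "e a = 1" "e r = 2" using iar(4) by (auto simp: e_def)
  ultimately show ?thesis using inj
    by (intro exI[of _ M] exI[of _ e]) (auto simp: M_def)
qed

section \<open>The machine compiled from a program followed by one of two deciders\<close>

datatype sim_state = Cont "com list" | Sub bool nat | Accept | Reject

definition put :: "nat \<Rightarrow> nat \<times> move \<Rightarrow> nat list \<Rightarrow> (nat \<times> move) list" where
  "put r a ss = (map (\<lambda>x. (x, Stay)) ss)[r := a]"

text \<open>
  After \<open>P\<close> has terminated, the machine \<open>M b\<close> is started, where \<open>b\<close> is the top of register \<open>V\<close> (blank means
  rejection). Its first tape is the one holding register \<open>Z\<close>, the last register that \<open>P\<close> may use.
\<close>

locale simulator =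
  fixes P :: com and Z V :: nat and M :: "bool \<Rightarrow> tm"
  assumes wf: "wf_tm (M b)" and regs: "reg_set P \<subseteq> {..Z}" and V: "V \<le> Z"
begin

text \<open>A sum bounds both deciders at once: each fits behind the first \<open>Z\<close> tapes,
  and tape \<open>Z\<close> is shared by the last register and the input tape of the
  decider.\<close>

definition k :: nat where "k = Z + tapes (M False) + tapes (M True)"

definition m :: nat where "m = symbols (M False) + symbols (M True)"

text \<open>Halting states of the decider are identified with those of the compiled machine, so that
  halting costs no extra step.\<close>

definition sub_state :: "bool \<Rightarrow> nat \<Rightarrow> sim_state" where
  "sub_state b q = (if q = 1 then Accept else if q = 2 then Reject else Sub b q)"

fun \<delta> :: "sim_state \<Rightarrow> nat list \<Rightarrow> sim_state \<times> (nat \<times> move) list" where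
  "\<delta> (Cont (Skip # l)) ss = (Cont l, map (\<lambda>x. (x, Stay)) ss)"
| "\<delta> (Cont (Fail # l)) ss = (Reject, map (\<lambda>x. (x, Stay)) ss)"
| "\<delta> (Cont (Push r b # l)) ss = (Cont (Write r b # l), put r (ss ! r, Move_Left) ss)"
| "\<delta> (Cont (Write r b # l)) ss = (Cont l, put r (if b then 2 else 1, Stay) ss)"
| "\<delta> (Cont (Pop r # l)) ss = (Cont l, put r (0, Move_Right) ss)"
| "\<delta> (Cont ((c ;; d) # l)) ss = (Cont (c # d # l), map (\<lambda>x. (x, Stay)) ss)"
| "\<delta> (Cont (Case r c0 c1 c2 # l)) ss =
    (Cont ((if ss ! r = 0 then c0 else if ss ! r = 1 then c1 else c2) # l), map (\<lambda>x. (x, Stay)) ss)"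
| "\<delta> (Cont (While r c # l)) ss =
    (Cont (if ss ! r = 0 then l else c # While r c # l), map (\<lambda>x. (x, Stay)) ss)"
| "\<delta> (Cont []) ss =
    (if ss ! V = 0 then Reject else Sub (ss ! V = 2) 0, map (\<lambda>x. (x, Stay)) ss)"
| "\<delta> (Sub b q) ss =
    (let r = trans (M b) q (take (tapes (M b)) (drop Z ss)) in
     (sub_state b (fst r),
      map (\<lambda>x. (x, Stay)) (take Z ss) @ snd r @
        map (\<lambda>x. (x, Stay)) (drop (Z + tapes (M b)) ss)))"
| "\<delta> q ss = (q, map (\<lambda>x. (x, Stay)) ss)"

definition Q :: "sim_state set" where
  "Q = Cont ` insert [] (conts P []) \<union> {Sub b q | b q. q < states (M b)} \<union> {Accept, Reject}"

lemma Accept_in_Q: "Accept \<in> Q" and Reject_in_Q: "Reject \<in> Q" and Nil_in_Q: "Cont [] \<in> Q"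
  by (simp_all add: Q_def)

lemma finite_Q: "finite Q"
proof -
  have "{Sub b q | b q. q < states (M b)} = (\<Union>b. Sub b ` {..<states (M b)})" by auto
  then show ?thesis by (simp add: Q_def finite_conts)
qed

lemma k_ge: "Z + tapes (M b) \<le> k" "Z < k" "1 \<le> k"
  using wf[of True] wf[of False] by (cases b; simp add: k_def wf_tm_def)+

lemma m_ge: "symbols (M b) \<le> m" "3 \<le> m"
  using wf[of True] wf[of False] by (cases b; simp add: m_def wf_tm_def)+

definition machine_spec :: "tm \<Rightarrow> (sim_state \<Rightarrow> nat) \<Rightarrow> bool" where
  "machine_spec S e \<longleftrightarrow> wf_tm S \<and> tapes S = k \<and> symbols S = m \<and> e (Cont [P]) = 0 \<and> e Accept = 1 \<and>
     e Reject = 2 \<and> inj_on e Q \<and>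
     (\<forall>q \<in> Q. \<forall>ss. fst (\<delta> q ss) \<in> Q \<and> length (snd (\<delta> q ss)) = k \<and>
        fst ` set (snd (\<delta> q ss)) \<subseteq> {..<m} \<longrightarrow>
      trans S (e q) ss = (e (fst (\<delta> q ss)), snd (\<delta> q ss)))"

lemma ex_machine: "\<exists>S e. machine_spec S e"
  unfolding machine_spec_def
  by (rule ex_tm_of_automaton) (use finite_Q k_ge m_ge in \<open>auto simp: Q_def Cons_in_conts\<close>)

end

section \<open>Simulation of program execution\<close>

locale simulator_machine = simulator +
  fixes S :: tm and e :: "sim_state \<Rightarrow> nat"
  assumes spec: "machine_spec S e"
begin

lemma step_S:
  assumes "q \<in> Q" "q \<noteq> Accept" "q \<noteq> Reject"
    "fst (\<delta> q (map scan ts)) \<in> Q" "length (snd (\<delta> q (map scan ts))) = k"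
    "fst ` set (snd (\<delta> q (map scan ts))) \<subseteq> {..<m}"
  shows "step S (e q, ts) = (e (fst (\<delta> q (map scan ts))), map2 act (snd (\<delta> q (map scan ts))) ts)"
proof -
  have inj: "inj_on e Q" using spec by (simp add: machine_spec_def)
  have "e q \<noteq> e Accept" "e q \<noteq> e Reject"
    using inj_on_eq_iff[of e Q q Accept] inj_on_eq_iff[of e Q q Reject] inj assms(1-3)
      Accept_in_Q Reject_in_Q by blast+
  then have "e q \<noteq> 1" "e q \<noteq> 2" using spec by (auto simp: machine_spec_def)
  then show ?thesis using spec assms by (simp add: step_def machine_spec_def)
qed

text \<open>All \<open>k\<close> tapes are described, including those above \<open>Z\<close>: the
  program leaves them empty, and they later serve as blank work tapes of the decider.\<close>

definition rep :: "tape list \<Rightarrow> regs \<Rightarrow> bool" where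
  "rep ts s \<longleftrightarrow> length ts = k \<and> (\<forall>r < k. rel_tape (ts ! r) = stack (s r))"

lemma rep_scan: "rep ts s \<Longrightarrow> r < k \<Longrightarrow> scan (ts ! r) = stack (s r) 0"
  by (simp add: rep_def scan_rel_tape)

text \<open>The weaker condition under which a step is well-defined. It also holds halfway through a
  push and while the decider runs, when tapes need not hold stacks.\<close>

definition readable :: "tape list \<Rightarrow> bool" where
  "readable ts \<longleftrightarrow> length ts = k \<and> (\<forall>r < k. scan (ts ! r) < m)"

lemma rep_readable: "rep ts s \<Longrightarrow> readable ts"
  by (auto simp: readable_def rep_scan less_le_trans[OF stack_lt_3 m_ge(2)]) (simp add: rep_def)

lemma scans_lt: "readable ts \<Longrightarrow> fst ` set (map (\<lambda>x. (x, Stay)) (map scan ts)) \<subseteq> {..<m}"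
  by (fastforce simp: in_set_conv_nth readable_def)

lemma put_lt:
  assumes "readable ts" "a < m"
  shows "fst ` set (put r (a, mv) (map scan ts)) \<subseteq> {..<m}"
proof -
  have "set (put r (a, mv) (map scan ts)) \<subseteq> insert (a, mv) (set (map (\<lambda>x. (x, Stay)) (map scan ts)))"
    unfolding put_def by (rule set_update_subset_insert)
  from image_mono[OF this, of fst]
  have "fst ` set (put r (a, mv) (map scan ts)) \<subseteq>
      insert a (fst ` set (map (\<lambda>x. (x, Stay)) (map scan ts)))"
    unfolding image_insert fst_conv .
  then show ?thesis using scans_lt[OF assms(1)] assms(2) by blast
qed

lemma length_put [simp]: "length (put r a ss) = length ss"
  by (simp add: put_def)

lemma act_stay: "act (scan t, Stay) t = t"
  by (cases t) (simp add: act_def scan_def)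

lemma map2_act_stay: "map2 act (map (\<lambda>x. (x, Stay)) (map scan ts)) ts = ts"
  by (auto simp: list_eq_iff_nth_eq act_stay)

lemma map2_act_put: "r < length ts \<Longrightarrow> map2 act (put r a (map scan ts)) ts = ts[r := act a (ts ! r)]"
  by (auto simp: put_def list_eq_iff_nth_eq act_stay nth_list_update)

lemma step_stay:
  assumes "readable ts" "\<delta> q (map scan ts) = (q', map (\<lambda>x. (x, Stay)) (map scan ts))"
    "q \<in> Q" "q' \<in> Q" "q \<noteq> Accept" "q \<noteq> Reject"
  shows "step S (e q, ts) = (e q', ts)"
proof -
  have "length ts = k" using assms(1) by (simp add: readable_def)
  then show ?thesis
    using step_S[of q ts] assms scans_lt[of ts] unfolding assms(2) fst_conv snd_conv map2_act_stay
    by simp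
qed

lemma step_put:
  assumes "readable ts" "\<delta> q (map scan ts) = (q', put r (a, mv) (map scan ts))" "r < k" "a < m"
    "q \<in> Q" "q' \<in> Q" "q \<noteq> Accept" "q \<noteq> Reject"
  shows "step S (e q, ts) = (e q', ts[r := act (a, mv) (ts ! r)])"
proof -
  have "length ts = k" using assms(1) by (simp add: readable_def)
  then show ?thesis
    using step_S[of q ts] assms put_lt[of ts a r mv] map2_act_put[of r ts "(a, mv)"]
    unfolding assms(2) fst_conv snd_conv by simp
qed

lemma sim_push:
  assumes "rep ts s" "r \<le> Z" "Cont (Push r b # l) \<in> Q" "Cont (Write r b # l) \<in> Q" "Cont l \<in> Q"
  shows "\<exists>ts'. rep ts' (s(r := b # s r)) \<and>
    (step S ^^ 2) (e (Cont (Push r b # l)), ts) = (e (Cont l), ts')"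
proof -
  have r: "r < k" using assms(2) k_ge(2) by simp
  have len: "length ts = k" using assms(1) by (simp add: rep_def)
  define ts1 where "ts1 = ts[r := act (scan (ts ! r), Move_Left) (ts ! r)]"
  define ts2 where "ts2 = ts1[r := act (if b then 2 else 1, Stay) (ts1 ! r)]"
  have rd: "readable ts" using assms(1) by (rule rep_readable)
  have 1: "step S (e (Cont (Push r b # l)), ts) = (e (Cont (Write r b # l)), ts1)"
    unfolding ts1_def by (rule step_put) (use rd r len assms in \<open>auto simp: readable_def\<close>)
  \<comment> \<open>The cell left of the top is blank, hence scannable, although \<open>ts1\<close>
    need not represent any registers.\<close>
  have "scan (ts1 ! r) = 0"
    using assms(1) r len
    by (simp add: ts1_def scan_rel_tape rel_tape_act rep_def rel_act_def stack_altdef)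
  then have rd1: "readable ts1"
    unfolding readable_def
  proof (intro conjI allI impI)
    fix r' assume "r' < k"
    with rd m_ge(2) \<open>scan (ts1 ! r) = 0\<close> show "scan (ts1 ! r') < m"
      by (cases "r' = r") (auto simp: ts1_def readable_def)
  qed (simp add: ts1_def len)
  have len1: "length ts1 = k" using len by (simp add: ts1_def)
  have 2: "step S (e (Cont (Write r b # l)), ts1) = (e (Cont l), ts2)"
    unfolding ts2_def by (rule step_put) (use rd1 r len1 m_ge(2) assms in \<open>auto simp: readable_def\<close>)
  have "rel_tape (ts2 ! r) = stack (b # s r)"
    using r len len1 assms(1) rel_act_push[of b "s r"] rep_scan[OF assms(1) r]
    by (simp add: ts2_def ts1_def rel_tape_act rep_def)
  then have "rep ts2 (s(r := b # s r))"
    using assms(1) r by (auto simp: rep_def ts2_def ts1_def nth_list_update)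
  then show ?thesis using 1 2 by (auto simp: numeral_2_eq_2)
qed

lemma sim_pop:
  assumes "rep ts s" "r \<le> Z" "Cont (Pop r # l) \<in> Q" "Cont l \<in> Q"
  shows "\<exists>ts'. rep ts' (s(r := tl (s r))) \<and> step S (e (Cont (Pop r # l)), ts) = (e (Cont l), ts')"
proof -
  have r: "r < k" using assms(2) k_ge(2) by simp
  have rd: "readable ts" using assms(1) by (rule rep_readable)
  have "step S (e (Cont (Pop r # l)), ts) = (e (Cont l), ts[r := act (0, Move_Right) (ts ! r)])"
    by (rule step_put) (use rd r m_ge(2) assms in \<open>auto simp: readable_def\<close>)
  moreover have "rep (ts[r := act (0, Move_Right) (ts ! r)]) (s(r := tl (s r)))"
    using assms(1) r by (auto simp: rep_def nth_list_update rel_tape_act rel_act_pop)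
  ultimately show ?thesis by blast
qed

text \<open>The continuation \<open>l\<close> is arbitrary because the induction hypothesis is
  applied with \<open>b # l\<close> to the first half of a sequence and with
  \<open>While r a # l\<close> to a loop body.\<close>

lemma sim_exec:
  assumes "exec c s t out" "rep ts s" "reg_set c \<subseteq> {..Z}" "Cont ` conts c l \<subseteq> Q" "Cont l \<in> Q"
  shows "\<exists>ts'. case out of
      None \<Rightarrow> (step S ^^ t) (e (Cont (c # l)), ts) = (e Reject, ts')
    | Some s' \<Rightarrow> rep ts' s' \<and> (step S ^^ t) (e (Cont (c # l)), ts) = (e (Cont l), ts')"
  using assms
proof (induction arbitrary: ts l rule: exec.induct)
  case (Skip s)
  have "step S (e (Cont (Skip # l)), ts) = (e (Cont l), ts)"
    by (rule step_stay) (use Skip rep_readable[of ts s] in auto)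
  then show ?case using Skip by auto
next
  case (Fail s)
  have "step S (e (Cont (Fail # l)), ts) = (e Reject, ts)"
    by (rule step_stay) (use Fail rep_readable[of ts s] in \<open>auto simp: Q_def\<close>)
  then show ?case by auto
next
  case (Push r b s)
  then show ?case using sim_push[of ts s r b l] by auto
next
  case (Pop r s)
  then show ?case using sim_pop[of ts s r l] by auto
next
  case (Seq_None a s t b)
  have "step S (e (Cont ((a ;; b) # l)), ts) = (e (Cont (a # b # l)), ts)"
    by (rule step_stay) (use Seq_None.prems rep_readable[of ts s] Cons_in_conts[of a "b # l"] in auto)
  moreover have "Cont (b # l) \<in> Q" using Seq_None.prems(3) Cons_in_conts[of b l] by auto
  then obtain ts' where "(step S ^^ t) (e (Cont (a # b # l)), ts) = (e Reject, ts')"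
    using Seq_None.IH[of ts "b # l"] Seq_None.prems by (auto simp: image_Un)
  ultimately show ?case by (auto simp: funpow_Suc_right simp del: funpow.simps)
next
  case (Seq_Some a s t s' b u out)
  have 1: "step S (e (Cont ((a ;; b) # l)), ts) = (e (Cont (a # b # l)), ts)"
    by (rule step_stay) (use Seq_Some.prems rep_readable[of ts s] Cons_in_conts[of a "b # l"] in auto)
  have "Cont (b # l) \<in> Q" using Seq_Some.prems(3) Cons_in_conts[of b l] by auto
  then obtain ts1 where 2: "rep ts1 s'" "(step S ^^ t) (e (Cont (a # b # l)), ts) = (e (Cont (b # l)), ts1)"
    using Seq_Some.IH(1)[of ts "b # l"] Seq_Some.prems by (auto simp: image_Un)
  have eq: "(step S ^^ Suc (t + u)) (e (Cont ((a ;; b) # l)), ts) = (step S ^^ u) (e (Cont (b # l)), ts1)"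
    using 1 2(2) by (rule funpow_compose)
  show ?case unfolding eq using Seq_Some.IH(2)[of ts1 l] 2(1) Seq_Some.prems by (simp add: image_Un)
next
  case (Case s r a c b t out)
  let ?c = "case s r of [] \<Rightarrow> a | x # _ \<Rightarrow> if x then c else b"
  have r: "r < k" using Case.prems(2) k_ge(2) by simp
  have sub: "conts ?c l \<subseteq> conts (Case r a b c) l" "reg_set ?c \<subseteq> {..Z}"
    using Case.prems by (auto split: list.splits)
  have "scan (ts ! r) = stack (s r) 0" using Case.prems(1) r by (rule rep_scan)
  then have st: "step S (e (Cont (Case r a b c # l)), ts) = (e (Cont (?c # l)), ts)"
    using Case.prems rep_readable[OF Case.prems(1)] sub Cons_in_conts[of ?c l] r
    by (intro step_stay) (auto simp: stack_0 rep_def split: list.splits)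
  show ?case unfolding funpow_Suc_right comp_apply st
    using Case.IH[OF Case.prems(1) sub(2)] Case.prems(3,4) sub(1) by blast
next
  case (While_End s r a)
  have r: "r < k" using While_End.prems(2) k_ge(2) by simp
  have "scan (ts ! r) = 0" using rep_scan[OF While_End.prems(1) r] While_End by (simp add: stack_0)
  then have "step S (e (Cont (While r a # l)), ts) = (e (Cont l), ts)"
    by (intro step_stay) (use While_End.prems rep_readable[of ts s] r in \<open>auto simp: rep_def\<close>)
  then show ?case using While_End by auto
next
  case (While_None s r a t)
  have r: "r < k" using While_None.prems(2) k_ge(2) by simp
  have "scan (ts ! r) \<noteq> 0"
    using rep_scan[OF While_None.prems(1) r] While_None.hyps by (simp add: stack_0 split: list.splits)
  then have "step S (e (Cont (While r a # l)), ts) = (e (Cont (a # While r a # l)), ts)"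
    by (intro step_stay) (use While_None.prems rep_readable[of ts s] r Cons_in_conts[of a "While r a # l"] in
        \<open>auto simp: rep_def\<close>)
  moreover obtain ts' where "(step S ^^ t) (e (Cont (a # While r a # l)), ts) = (e Reject, ts')"
    using While_None.IH[of ts "While r a # l"] While_None.prems by auto
  ultimately show ?case by (auto simp: funpow_Suc_right simp del: funpow.simps)
next
  case (While_Some s r a t s' u out)
  have r: "r < k" using While_Some.prems(2) k_ge(2) by simp
  have "scan (ts ! r) \<noteq> 0"
    using rep_scan[OF While_Some.prems(1) r] While_Some.hyps by (simp add: stack_0 split: list.splits)
  then have 1: "step S (e (Cont (While r a # l)), ts) = (e (Cont (a # While r a # l)), ts)"
    by (intro step_stay) (use While_Some.prems rep_readable[of ts s] r Cons_in_conts[of a "While r a # l"] in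
        \<open>auto simp: rep_def\<close>)
  obtain ts1 where 2: "rep ts1 s'"
      "(step S ^^ t) (e (Cont (a # While r a # l)), ts) = (e (Cont (While r a # l)), ts1)"
    using While_Some.IH(1)[of ts "While r a # l"] While_Some.prems by auto
  have eq: "(step S ^^ Suc (t + u)) (e (Cont (While r a # l)), ts) = (step S ^^ u) (e (Cont (While r a # l)), ts1)"
    using 1 2(2) by (rule funpow_compose)
  show ?case unfolding eq using While_Some.IH(2)[of ts1 l] 2(1) While_Some.prems by simp
qed

section \<open>Running the embedded decider\<close>

definition sub_rep :: "bool \<Rightarrow> tape list \<Rightarrow> tape list \<Rightarrow> bool" where
  "sub_rep b us ts \<longleftrightarrow> length us = tapes (M b) \<and> readable ts \<and>
     (\<forall>r < tapes (M b). rel_tape (ts ! (Z + r)) = rel_tape (us ! r))"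

text \<open>Tape \<open>Z + j\<close> plays tape \<open>j\<close> of the decider, and all other
  tapes stay put. Legality of the decider's configuration bounds the symbols that its heads meet,
  which keeps the tapes readable.\<close>

lemma sim_sub_step:
  assumes sr: "sub_rep b us ts" and legal: "legal_config (M b) (q, us)"
  shows "\<exists>ts'. step S (e (sub_state b q), ts) = (e (sub_state b (fst (step (M b) (q, us)))), ts') \<and>
    sub_rep b (snd (step (M b) (q, us))) ts'"
proof (cases "q = 1 \<or> q = 2")
  case True
  \<comment> \<open>Both machines idle once halted, since \<open>step\<close> fixes configurations
    in states 1 and 2.\<close>
  then have "e (sub_state b q) = 1 \<or> e (sub_state b q) = 2"
    using spec by (auto simp: sub_state_def machine_spec_def)
  then show ?thesis using True sr by (auto simp: step_def)
next
  case False
  let ?n = "tapes (M b)"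
  define r where "r = trans (M b) q (map scan us)"
  have len: "length ts = k" "length us = ?n" and kn: "Z + ?n \<le> k"
    using sr k_ge(1)[of b] by (auto simp: sub_rep_def readable_def)
  have sc: "take ?n (drop Z (map scan ts)) = map scan us"
    using sr len kn by (auto simp: list_eq_iff_nth_eq sub_rep_def scan_rel_tape)
  define as where "as = map (\<lambda>x. (x, Stay)) (take Z (map scan ts)) @ snd r @
        map (\<lambda>x. (x, Stay)) (drop (Z + ?n) (map scan ts))"
  have d: "\<delta> (Sub b q) (map scan ts) = (sub_state b (fst r), as)"
    unfolding as_def \<delta>.simps Let_def sc r_def ..
  have stp: "step (M b) (q, us) = (fst r, map2 act (snd r) us)"
    using False by (simp add: step_def r_def Let_def)
  have lq: "q < states (M b)" using legal by (simp add: legal_config_def)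
  have "set (map scan us) \<subseteq> {..<symbols (M b)}" "length (map scan us) = ?n"
    using legal by (auto simp: scan_rel_tape legal_config_def)
  then have r: "fst r < states (M b)" "length (snd r) = ?n" "fst ` set (snd r) \<subseteq> {..<symbols (M b)}"
    using wf[of b] lq unfolding wf_tm_def r_def by blast+
  have len_as: "length as = k" using len kn r(2) by (simp add: as_def)
  have "fst ` set (map (\<lambda>x. (x, Stay)) (take Z (map scan ts))) \<subseteq> fst ` set (map (\<lambda>x. (x, Stay)) (map scan ts))"
    "fst ` set (map (\<lambda>x. (x, Stay)) (drop (Z + ?n) (map scan ts))) \<subseteq> fst ` set (map (\<lambda>x. (x, Stay)) (map scan ts))"
    by (auto simp del: map_map dest!: in_set_takeD in_set_dropD)
  moreover have rd: "readable ts" using sr by (simp add: sub_rep_def)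
  ultimately have as_lt: "fst ` set as \<subseteq> {..<m}"
    using scans_lt[OF rd] r(3) m_ge(1)[of b] unfolding as_def set_append image_Un by fastforce
  have qQ: "Sub b q \<in> Q" "sub_state b (fst r) \<in> Q"
    using lq r(1) by (auto simp: Q_def sub_state_def)
  have st: "step S (e (Sub b q), ts) = (e (sub_state b (fst r)), map2 act as ts)"
    using step_S[of "Sub b q" ts] qQ len_as as_lt unfolding d by simp
  have nth: "map2 act as ts ! i = (if Z \<le> i \<and> i < Z + ?n then act (snd r ! (i - Z)) (ts ! i) else ts ! i)"
    if "i < k" for i
    using that len len_as r(2) kn by (auto simp: as_def nth_append act_stay)
  have rel: "rel_tape (map2 act as ts ! (Z + j)) = rel_tape (map2 act (snd r) us ! j)" if "j < ?n" for j
  proof -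
    have "Z + j < k" using that kn by simp
    from nth[OF this] have "map2 act as ts ! (Z + j) = act (snd r ! j) (ts ! (Z + j))"
      using that by simp
    then show ?thesis using that sr len r(2) by (simp add: sub_rep_def rel_tape_act)
  qed
  have "scan (map2 act as ts ! i) < m" if "i < k" for i
  proof (cases "Z \<le> i \<and> i < Z + ?n")
    case True
    then have "rel_tape (map2 act as ts ! i) = rel_tape (map2 act (snd r) us ! (i - Z))"
      using rel[of "i - Z"] by auto
    moreover have "legal_config (M b) (fst r, map2 act (snd r) us)"
      using legal_step[OF wf legal] stp by simp
    then have "rel_tape (map2 act (snd r) us ! (i - Z)) 0 < symbols (M b)"
      using True len(2) r(2) nth_mem[of "i - Z" "map2 act (snd r) us"]
      unfolding legal_config_def snd_conv by (metis add_diff_inverse_nat length_map length_zip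
          min.idem nat_add_left_cancel_less not_less)
    ultimately show ?thesis using m_ge(1)[of b] by (simp add: scan_rel_tape)
  next
    case False
    then have "map2 act as ts ! i = ts ! i" unfolding nth[OF that] by (rule if_not_P)
    then show ?thesis using rd that by (simp add: readable_def)
  qed
  then have "sub_rep b (map2 act (snd r) us) (map2 act as ts)"
    using rel len len_as r(2) by (simp add: sub_rep_def readable_def)
  moreover have "sub_state b q = Sub b q" using False by (simp add: sub_state_def)
  ultimately show ?thesis using st stp by auto
qed

lemma sim_sub:
  assumes "sub_rep b us ts" "legal_config (M b) (q, us)"
  shows "\<exists>ts'. (step S ^^ t) (e (sub_state b q), ts) = (e (sub_state b (fst ((step (M b) ^^ t) (q, us)))), ts') \<and>
    sub_rep b (snd ((step (M b) ^^ t) (q, us))) ts'"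
proof (induction t)
  case 0
  then show ?case using assms by auto
next
  case (Suc t)
  obtain q' us' where c: "(step (M b) ^^ t) (q, us) = (q', us')" by (cases "(step (M b) ^^ t) (q, us)")
  have "legal_config (M b) (q', us')" using legal_steps[OF wf assms(2), of t] c by simp
  moreover obtain ts' where "(step S ^^ t) (e (sub_state b q), ts) = (e (sub_state b q'), ts')" "sub_rep b us' ts'"
    using Suc c by auto
  ultimately show ?case using sim_sub_step[of b us' ts' q'] c by auto
qed

lemma rep_init: "rep (snd (init_config S u)) ((\<lambda>_. [])(0 := u))"
  using k_ge(3) spec
  by (auto simp: rep_def init_config_def machine_spec_def nth_Cons split: nat.splits)

lemma conts_in_Q: "Cont ` conts P [] \<subseteq> Q"
  by (auto simp: Q_def)

lemma Reject_code: "e Reject = 2"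
  using spec by (simp add: machine_spec_def)

lemma run_None:
  assumes "exec P ((\<lambda>_. [])(0 := u)) t None"
  shows "fst ((step S ^^ t) (init_config S u)) = 2"
proof -
  have "init_config S u = (e (Cont [P]), snd (init_config S u))"
    using spec by (simp add: machine_spec_def init_config_def)
  then show ?thesis
    using sim_exec[OF assms rep_init regs, of "[]"] Reject_code conts_in_Q Nil_in_Q by auto
qed

lemma run_Some:
  assumes ex: "exec P ((\<lambda>_. [])(0 := u)) t (Some s)"
  shows "\<exists>ts. rep ts s \<and> (step S ^^ t) (init_config S u) = (e (Cont []), ts)"
proof -
  have "init_config S u = (e (Cont [P]), snd (init_config S u))"
    using spec by (simp add: machine_spec_def init_config_def)
  then show ?thesis
    using sim_exec[OF assms rep_init regs, of "[]"] by (auto simp: Q_def)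
qed

lemma V_less_k: "V < k"
  using V k_ge(2) by simp

lemma run_blank:
  assumes ex: "exec P ((\<lambda>_. [])(0 := u)) t (Some s)" and "s V = []"
  shows "fst ((step S ^^ Suc t) (init_config S u)) = 2"
proof -
  obtain ts where ts: "rep ts s" "(step S ^^ t) (init_config S u) = (e (Cont []), ts)"
    using run_Some[OF ex] by blast
  have len: "length ts = k" using ts(1) by (simp add: rep_def)
  have "step S (e (Cont []), ts) = (e Reject, ts)"
    by (rule step_stay[OF rep_readable[OF ts(1)]])
      (use rep_scan[OF ts(1) V_less_k] assms(2) V_less_k len in \<open>auto simp: stack_0 Q_def\<close>)
  then show ?thesis using ts(2) spec by (simp add: machine_spec_def)
qed

lemma run_sub:
  assumes ex: "exec P ((\<lambda>_. [])(0 := u)) t (Some s)" and b: "s V = b # xs"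
    and halt: "fst ((step (M b) ^^ t') (init_config (M b) (s Z))) = (if acc then 1 else 2)"
  shows "fst ((step S ^^ Suc (t + t')) (init_config S u)) = (if acc then 1 else 2)"
proof -
  obtain ts where ts: "rep ts s" "(step S ^^ t) (init_config S u) = (e (Cont []), ts)"
    using run_Some[OF ex] by blast
  have len: "length ts = k" using ts(1) by (simp add: rep_def)
  have "0 < states (M b)" using wf[of b] by (simp add: wf_tm_def)
  then have st: "step S (e (Cont []), ts) = (e (Sub b 0), ts)"
    by (intro step_stay[OF rep_readable[OF ts(1)]])
      (use rep_scan[OF ts(1) V_less_k] b V_less_k len in \<open>auto simp: stack_0 Q_def\<close>)
  \<comment> \<open>Registers above \<open>Z\<close> are empty initially and untouched by the
    program, so the remaining tapes of \<open>M b\<close> are blank, as its initial configuration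
    requires.\<close>
  have blank: "s r = []" if "r > Z" for r
  proof -
    have "r \<notin> reg_set P" "r \<noteq> 0" using that regs by auto
    then show ?thesis using exec_unchanged[OF ex refl, of r] by simp
  qed
  define us where "us = snd (init_config (M b) (s Z))"
  have len_us: "length us = tapes (M b)"
    using wf[of b] by (simp add: us_def init_config_def wf_tm_def)
  have "rel_tape (ts ! (Z + r)) = rel_tape (us ! r)" if "r < tapes (M b)" for r
  proof -
    have "Z + r < k" using that k_ge(1)[of b] by simp
    then have "rel_tape (ts ! (Z + r)) = stack (s (Z + r))" using ts(1) by (simp add: rep_def)
    also have "\<dots> = rel_tape (us ! r)"
      using that blank by (cases r) (auto simp: us_def init_config_def)
    finally show ?thesis .
  qed
  then have sr: "sub_rep b us ts" using rep_readable[OF ts(1)] len_us by (simp add: sub_rep_def)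
  have init: "init_config (M b) (s Z) = (0, us)" by (simp add: us_def init_config_def)
  have "legal_config (M b) (0, us)" using legal_init[OF wf, of b "s Z"] init by simp
  from sim_sub[OF sr this, of t'] obtain ts' where
    "(step S ^^ t') (e (Sub b 0), ts) = (e (sub_state b (if acc then 1 else 2)), ts')"
    using halt init by (auto simp: sub_state_def)
  then have "fst ((step S ^^ t') (step S (e (Cont []), ts))) = (if acc then 1 else 2)"
    using st spec by (simp add: sub_state_def machine_spec_def)
  moreover have "(step S ^^ Suc (t + t')) (init_config S u) = (step S ^^ t') (step S (e (Cont []), ts))"
    using ts(2) by (simp add: funpow_add funpow_Suc_right add.commute[of t t'] del: funpow.simps)
      (metis funpow_swap1)
  ultimately show ?thesis by simp
qed

end

section \<open>Polynomial-time reductions computed by programs\<close>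

definition init_regs :: "bool list \<Rightarrow> regs" where
  "init_regs u = (\<lambda>_. [])(0 := u)"

definition accepting :: "nat \<Rightarrow> nat \<Rightarrow> (bool \<Rightarrow> bool list set) \<Rightarrow> regs option \<Rightarrow> bool" where
  "accepting V Z L out \<longleftrightarrow> (\<exists>s b xs. out = Some s \<and> s V = b # xs \<and> s Z \<in> L b)"

lemma poly_nat_mono: "(x::nat) \<le> y \<Longrightarrow> poly p x \<le> poly p y"
  by (induction p) (auto intro!: add_mono mult_mono)

text \<open>A many-one reduction whose target language is itself chosen by a computed bit. The
  branching lets one program verify against two relations, one for each sign.\<close>

theorem PTIME_reduction:
  fixes p :: "nat poly"
  assumes L: "\<And>b. L b \<in> PTIME" and regs: "reg_set P \<subseteq> {..Z}" and V: "V \<le> Z"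
    and run: "\<And>u. \<exists>t \<le> poly p (length u). \<exists>out. exec P (init_regs u) t out \<and>
        (u \<in> L' \<longleftrightarrow> accepting V Z L out)"
  shows "L' \<in> PTIME"
proof -
  obtain M where M: "\<And>b. wf_tm (M b) \<and> (\<exists>q :: nat poly. decides_in_time (M b) (L b) (poly q))"
    using L unfolding PTIME_def by (auto dest!: choice simp: mem_Collect_eq) metis
  then obtain q :: "bool \<Rightarrow> nat poly" where q: "\<And>b. decides_in_time (M b) (L b) (poly (q b))"
    by metis
  interpret simulator P Z V M
    using M regs V by unfold_locales auto
  obtain S e where "machine_spec S e" using ex_machine by blast
  then interpret simulator_machine P Z V M S e by unfold_locales
  \<comment> \<open>A step lengthens a register by at most one bit, so the decider receives at most
    \<open>length u + poly p (length u)\<close> bits. Both time bounds are added because either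
    decider may be started; starting it takes the one extra step.\<close>
  define T where "T = p + 1 + pcompose (q True) ([:0, 1:] + p) + pcompose (q False) ([:0, 1:] + p)"
  have "\<exists>t \<le> poly T (length u). fst ((step S ^^ t) (init_config S u)) = (if u \<in> L' then 1 else 2)" for u
  proof -
    obtain t out where t: "t \<le> poly p (length u)" "exec P (init_regs u) t out"
      "u \<in> L' \<longleftrightarrow> accepting V Z L out"
      using run[of u] by blast
    have T: "poly T (length u) = poly p (length u) + 1 + poly (q True) (length u + poly p (length u)) +
        poly (q False) (length u + poly p (length u))"
      by (simp add: T_def poly_pcompose)
    show ?thesis
    proof (cases out)
      case None
      then show ?thesis using t run_None[of u t] T
        by (intro exI[of _ t]) (auto simp: init_regs_def accepting_def)
    next
      case (Some s)
      show ?thesis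
      proof (cases "s V")
        case Nil
        then show ?thesis using t run_blank[of u t s] T Some
          by (intro exI[of _ "Suc t"]) (auto simp: init_regs_def accepting_def simp del: funpow.simps)
      next
        case (Cons b xs)
        obtain t' where t': "t' \<le> poly (q b) (length (s Z))"
          "fst ((step (M b) ^^ t') (init_config (M b) (s Z))) = (if s Z \<in> L b then 1 else 2)"
          using q[of b] unfolding decides_in_time_def by blast
        have "length (s Z) \<le> length u + t"
          using exec_length[OF t(2) Some, of Z] by (simp add: init_regs_def split: if_splits)
        then have "t' \<le> poly (q b) (length u + poly p (length u))"
          using t'(1) t(1) poly_nat_mono[of "length (s Z)" "length u + poly p (length u)" "q b"] by simp
        then have "Suc (t + t') \<le> poly T (length u)" using t(1) T by (cases b) auto
        moreover have "u \<in> L' \<longleftrightarrow> s Z \<in> L b" using t(3) Some Cons by (simp add: accepting_def)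
        ultimately show ?thesis
          using run_sub[of u t s b xs t' "s Z \<in> L b"] t(2) t'(2) Some Cons
          by (intro exI[of _ "Suc (t + t')"]) (simp add: init_regs_def del: funpow.simps)
      qed
    qed
  qed
  then have "decides_in_time S L' (poly T)" unfolding decides_in_time_def by blast
  moreover have "wf_tm S" using spec by (simp add: machine_spec_def)
  ultimately show ?thesis unfolding PTIME_def by blast
qed

section \<open>Building blocks of stack programs\<close>

text \<open>Exact times serve the simulation; from here on upper bounds are easier to
  compose.\<close>

definition runs :: "com \<Rightarrow> regs \<Rightarrow> nat \<Rightarrow> regs option \<Rightarrow> bool" where
  "runs c s T out \<longleftrightarrow> (\<exists>t \<le> T. exec c s t out)"

lemma runs_weaken: "runs c s T out \<Longrightarrow> T \<le> T' \<Longrightarrow> out = out' \<Longrightarrow> runs c s T' out'"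
  unfolding runs_def by (meson le_trans)

lemma runs_Seq: "runs a s T (Some s') \<Longrightarrow> runs b s' U out \<Longrightarrow> runs (a ;; b) s (Suc (T + U)) out"
  unfolding runs_def by (meson exec.Seq_Some Suc_le_mono add_mono)

lemma runs_Seq_None: "runs a s T None \<Longrightarrow> runs (a ;; b) s (Suc T) None"
  unfolding runs_def by (meson exec.Seq_None Suc_le_mono)

lemma runs_Case:
  "runs (case s r of [] \<Rightarrow> a | x # _ \<Rightarrow> if x then c else b) s T out \<Longrightarrow> runs (Case r a b c) s (Suc T) out"
  unfolding runs_def by (blast intro: exec.Case Suc_le_mono[THEN iffD2])

lemma runs_While_End: "s r = [] \<Longrightarrow> runs (While r a) s 1 (Some s)"
  unfolding runs_def by (meson exec.While_End order_refl)

lemma runs_While: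
  "s r \<noteq> [] \<Longrightarrow> runs a s T (Some s') \<Longrightarrow> runs (While r a) s' U out \<Longrightarrow>
    runs (While r a) s (Suc (T + U)) out"
  unfolding runs_def by (meson exec.While_Some Suc_le_mono add_mono)

lemma runs_While_None: "s r \<noteq> [] \<Longrightarrow> runs a s T None \<Longrightarrow> runs (While r a) s (Suc T) None"
  unfolding runs_def by (meson exec.While_None Suc_le_mono)

section \<open>Denotation and cost of loop-free programs\<close>

fun loop_free :: "com \<Rightarrow> bool" where
  "loop_free (a ;; b) = (loop_free a \<and> loop_free b)"
| "loop_free (Case r a b c) = (loop_free a \<and> loop_free b \<and> loop_free c)"
| "loop_free (While r a) = False"
| "loop_free (Write r b) = False"
| "loop_free c = True"

text \<open>All branches of a case are charged, which gives a bound independent of the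
  registers.\<close>

fun cost :: "com \<Rightarrow> nat" where
  "cost (a ;; b) = Suc (cost a + cost b)"
| "cost (Case r a b c) = Suc (cost a + cost b + cost c)"
| "cost (Push r b) = 2"
| "cost c = 1"

fun den :: "com \<Rightarrow> regs \<Rightarrow> regs option" where
  "den Fail s = None"
| "den (Push r b) s = Some (s(r := b # s r))"
| "den (Pop r) s = Some (s(r := tl (s r)))"
| "den (a ;; b) s = Option.bind (den a s) (den b)"
| "den (Case r a b c) s = (case s r of [] \<Rightarrow> den a s | x # _ \<Rightarrow> if x then den c s else den b s)"
| "den c s = Some s"

lemma runs_SeqI:
  "runs a s T (Some s') \<Longrightarrow> runs b s' U out' \<Longrightarrow> Suc (T + U) \<le> T' \<Longrightarrow> out' = out \<Longrightarrow>
    runs (a ;; b) s T' out"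
  by (rule runs_weaken[OF runs_Seq])

lemma runs_den: "loop_free c \<Longrightarrow> runs c s (cost c) (den c s)"
proof (induction c arbitrary: s)
  case (Seq a b)
  show ?case
  proof (cases "den a s")
    case None
    then show ?thesis using runs_Seq_None[of a s "cost a" b] Seq(1)[of s] Seq.prems
      by (auto elim: runs_weaken)
  next
    case (Some s')
    then show ?thesis using runs_Seq[of a s "cost a" s' b "cost b"] Seq(1)[of s] Seq(2)[of s'] Seq.prems
      by auto
  qed
next
  case (Case r a b c)
  show ?case
  proof (cases "s r")
    case Nil
    then have "runs (Case r a b c) s (Suc (cost a)) (den a s)"
      using Case by (intro runs_Case) auto
    then show ?thesis using Nil by (auto elim: runs_weaken)
  next
    case (Cons x xs)
    then have "runs (Case r a b c) s (Suc (if x then cost c else cost b)) (if x then den c s else den b s)"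
      using Case by (intro runs_Case) auto
    then show ?thesis using Cons by (auto elim: runs_weaken)
  qed
qed (auto simp: runs_def intro: exec.intros exI[of _ 1])

lemma runs_den_eq: "loop_free c \<Longrightarrow> den c s = out \<Longrightarrow> runs c s (cost c) out"
  using runs_den by blast

lemma runs_WhileI:
  "s r \<noteq> [] \<Longrightarrow> loop_free a \<Longrightarrow> den a s = Some s' \<Longrightarrow> runs (While r a) s' U out' \<Longrightarrow>
    Suc (cost a + U) \<le> T \<Longrightarrow> out' = out \<Longrightarrow> runs (While r a) s T out"
  by (rule runs_weaken[OF runs_While[OF _ runs_den_eq]])

lemma runs_WhileI_None:
  "s r \<noteq> [] \<Longrightarrow> loop_free a \<Longrightarrow> den a s = None \<Longrightarrow> Suc (cost a) \<le> T \<Longrightarrow> runs (While r a) s T None"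
  by (rule runs_weaken[OF runs_While_None[OF _ runs_den_eq]]) auto

lemma runs_SeqD:
  "loop_free a \<Longrightarrow> den a s = Some s' \<Longrightarrow> runs b s' U out' \<Longrightarrow> Suc (cost a + U) \<le> T \<Longrightarrow> out' = out \<Longrightarrow>
    runs (a ;; b) s T out"
  by (rule runs_SeqI[OF runs_den_eq])

definition each :: "nat \<Rightarrow> com \<Rightarrow> com \<Rightarrow> com" where
  "each a c0 c1 = While a (Case a Skip (Pop a ;; c0) (Pop a ;; c1))"

text \<open>Bits are met from the top and each block is pushed above the earlier ones, which is why
  the word arrives reversed. \<open>K\<close> absorbs the cost of test, pop and branch.\<close>

lemma runs_each2:
  assumes "a \<noteq> b" "a \<noteq> c" "b \<noteq> c"
    "\<And>x s. den (if x then c1 else c0) s = Some (s(b := f x @ s b, c := g x @ s c))"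
    "loop_free c0" "loop_free c1" "cost c0 + cost c1 + 10 \<le> K"
  shows "runs (each a c0 c1) s (K * Suc (length (s a)))
    (Some (s(a := [], b := concat (map f (rev (s a))) @ s b, c := concat (map g (rev (s a))) @ s c)))"
proof (induction "s a" arbitrary: s)
  case Nil
  then show ?case unfolding each_def
    by (intro runs_weaken[OF runs_While_End]) (use assms in \<open>auto simp: fun_eq_iff\<close>)
next
  case (Cons x xs)
  define s' where "s' = s(a := xs, b := f x @ s b, c := g x @ s c)"
  have "s' a = xs" using assms(1-3) by (simp add: s'_def)
  then have IH: "runs (each a c0 c1) s' (K * Suc (length xs)) (Some (s'(a := [],
      b := concat (map f (rev xs)) @ s' b, c := concat (map g (rev xs)) @ s' c)))"
    using Cons(1)[of s'] by simp
  have dn: "den (Case a Skip (Pop a ;; c0) (Pop a ;; c1)) s = Some s'"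
    using Cons(2)[symmetric] assms(1-3) assms(4)[of x "s(a := xs)"] by (auto simp: s'_def)
  show ?case
    unfolding each_def
    by (rule runs_WhileI[OF _ _ dn IH[unfolded each_def]])
      (use Cons(2)[symmetric] assms in \<open>auto simp: s'_def fun_eq_iff\<close>)
qed

lemma runs_each:
  assumes "a \<noteq> b" "\<And>x s. den (if x then c1 else c0) s = Some (s(b := f x @ s b))"
    "loop_free c0" "loop_free c1" "cost c0 + cost c1 + 10 \<le> K"
  shows "runs (each a c0 c1) s (K * Suc (length (s a)))
    (Some (s(a := [], b := concat (map f (rev (s a))) @ s b)))"
proof -
  \<comment> \<open>\<open>Suc (a + b)\<close> is a register different from both \<open>a\<close>
    and \<open>b\<close>, to which nothing is pushed.\<close>
  have "den (if x then c1 else c0) s = Some (s(b := f x @ s b, Suc (a + b) := [] @ s (Suc (a + b))))" for x s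
    unfolding assms(2) by (simp add: fun_eq_iff)
  from runs_each2[OF assms(1) _ _ this assms(3-5)] show ?thesis
    by (rule runs_weaken) (auto simp: fun_eq_iff)
qed

lemma concat_singletons: "concat (map (\<lambda>x. [x]) xs) = xs"
  by (induction xs) auto

text \<open>The order of the bits is reversed, so two moves are made where it has to be
  kept.\<close>

definition mv :: "nat \<Rightarrow> nat \<Rightarrow> com" where
  "mv a b = each a (Push b False) (Push b True)"

lemma runs_mv:
  assumes "a \<noteq> b"
  shows "runs (mv a b) s (20 * Suc (length (s a))) (Some (s(a := [], b := rev (s a) @ s b)))"
  using runs_each[of a b "Push b True" "Push b False" "\<lambda>x. [x]" 20 s] assms
  by (simp add: mv_def concat_singletons)

text \<open>
  Register 9 is reserved as a loop guard.
\<close>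

definition ones :: "nat \<Rightarrow> nat \<Rightarrow> com" where
  "ones a b = Push 9 True ;; While 9 (Case a (Pop 9) (Pop 9) (Pop a ;; Push b True))"

text \<open>A loop can only test a register for emptiness, whereas a run of ones ends at a False bit
  or at the bottom; the guard turns both endings into an empty register.\<close>

lemma runs_ones:
  assumes "a \<noteq> b" "a \<noteq> 9" "b \<noteq> 9" "s 9 = []" "s a = replicate n True @ xs" "xs = [] \<or> \<not> hd xs"
  shows "runs (ones a b) s (20 * Suc n) (Some (s(a := xs, b := replicate n True @ s b)))"
proof -
  let ?c = "Case a (Pop 9) (Pop 9) (Pop a ;; Push b True)"
  have *: "runs (While 9 ?c) s (20 * n + 15) (Some (s(a := xs, b := replicate n True @ s b, 9 := [])))"
    if "s 9 = [True]" "s a = replicate n True @ xs" for s n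
    using that
  proof (induction n arbitrary: s)
    case 0
    have fin: "runs (While 9 ?c) (s(9 := [])) 1 (Some (s(9 := [])))"
      by (rule runs_While_End) simp
    have "den ?c s = Some (s(9 := []))" using 0 assms by (auto split: list.splits)
    from runs_WhileI[OF _ _ this fin] show ?case
      using 0 by (auto simp: fun_eq_iff)
  next
    case (Suc n)
    define s' where "s' = s(a := replicate n True @ xs, b := True # s b)"
    have IH: "runs (While 9 ?c) s' (20 * n + 15) (Some (s'(a := xs, b := replicate n True @ s' b, 9 := [])))"
      using Suc assms by (intro Suc.IH) (auto simp: s'_def)
    have "den ?c s = Some s'" using Suc.prems assms by (auto simp: s'_def)
    from runs_WhileI[OF _ _ this IH] show ?case
      using Suc.prems assms by (auto simp: fun_eq_iff s'_def replicate_append_same)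
  qed
  have "den (Push 9 True) s = Some (s(9 := [True]))" using assms by simp
  from runs_SeqD[OF _ this *[of "s(9 := [True])" n]] assms
  show ?thesis unfolding ones_def by (auto simp: fun_eq_iff)
qed

section \<open>Decoding self-delimiting pairs\<close>

fun unpair :: "bool list \<Rightarrow> bool list \<Rightarrow> (bool list \<times> bool list) option" where
  "unpair acc (False # False # xs) = unpair (False # acc) xs"
| "unpair acc (True # True # xs) = unpair (True # acc) xs"
| "unpair acc (False # True # xs) = Some (acc, xs)"
| "unpair acc xs = None"

lemma unpair_word_pair: "unpair acc (word_pair x y) = Some (rev x @ acc, y)"
proof (induction x arbitrary: acc)
  case (Cons b x)
  then show ?case by (cases b) (auto simp: word_pair_def)
qed (auto simp: word_pair_def)

text \<open>Decoding succeeds on nothing but pairs, so malformed words are recognised and the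
  decided language is exact.\<close>

lemma unpair_SomeD: "unpair acc u = Some (a, y) \<Longrightarrow> \<exists>x. a = rev x @ acc \<and> u = word_pair x y"
proof (induction acc u rule: unpair.induct)
  case (1 acc xs)
  then obtain x where "a = rev x @ False # acc" "xs = word_pair x y" by auto
  then show ?case by (intro exI[of _ "False # x"]) (auto simp: word_pair_def)
next
  case (2 acc xs)
  then obtain x where "a = rev x @ True # acc" "xs = word_pair x y" by auto
  then show ?case by (intro exI[of _ "True # x"]) (auto simp: word_pair_def)
qed (auto simp: word_pair_def)

text \<open>The first component is collected on a stack and hence reversed; the second is what
  remains in \<open>a\<close>. The guard is popped exactly when the separator has been read.\<close>

definition parse :: "nat \<Rightarrow> nat \<Rightarrow> com" where
  "parse a b = Push 9 True ;; While 9 (Case a Fail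
     (Pop a ;; Case a Fail (Pop a ;; Push b False) (Pop a ;; Pop 9))
     (Pop a ;; Case a Fail Fail (Pop a ;; Push b True)))"

lemma runs_parse:
  assumes "a \<noteq> b" "a \<noteq> 9" "b \<noteq> 9" "s 9 = []"
  shows "runs (parse a b) s (40 * Suc (length (s a)))
    (map_option (\<lambda>(x, y). s(a := y, b := x)) (unpair (s b) (s a)))"
proof -
  let ?c = "Case a Fail (Pop a ;; Case a Fail (Pop a ;; Push b False) (Pop a ;; Pop 9))
     (Pop a ;; Case a Fail Fail (Pop a ;; Push b True))"
  have *: "runs (While 9 ?c) s (40 * length xs + 35)
     (map_option (\<lambda>(x, y). s(a := y, b := x, 9 := [])) (unpair acc xs))"
    if "s 9 = [True]" "s a = xs" "s b = acc" for s xs acc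
    using that
  proof (induction acc xs arbitrary: s rule: unpair.induct)
    case (1 acc xs)
    define s' where "s' = s(a := xs, b := False # acc)"
    have IH: "runs (While 9 ?c) s' (40 * length xs + 35)
       (map_option (\<lambda>(x, y). s'(a := y, b := x, 9 := [])) (unpair (False # acc) xs))"
      using "1.prems" assms by (intro "1.IH") (auto simp: s'_def)
    have "den ?c s = Some s'" using "1.prems" assms by (auto simp: s'_def)
    from runs_WhileI[OF _ _ this IH] show ?case
      using "1.prems" assms by (cases "unpair (False # acc) xs") (auto simp: s'_def fun_eq_iff)
  next
    case (2 acc xs)
    define s' where "s' = s(a := xs, b := True # acc)"
    have IH: "runs (While 9 ?c) s' (40 * length xs + 35)
       (map_option (\<lambda>(x, y). s'(a := y, b := x, 9 := [])) (unpair (True # acc) xs))"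
      using "2.prems" assms by (intro "2.IH") (auto simp: s'_def)
    have "den ?c s = Some s'" using "2.prems" assms by (auto simp: s'_def)
    from runs_WhileI[OF _ _ this IH] show ?case
      using "2.prems" assms by (cases "unpair (True # acc) xs") (auto simp: s'_def fun_eq_iff)
  next
    case (3 acc xs)
    have fin: "runs (While 9 ?c) (s(a := xs, 9 := [])) 1 (Some (s(a := xs, 9 := [])))"
      by (rule runs_While_End) simp
    have "den ?c s = Some (s(a := xs, 9 := []))" using "3.prems" assms by auto
    show ?case
      by (rule runs_WhileI[OF _ _ \<open>den ?c s = _\<close> fin]) (use "3.prems" assms in \<open>auto simp: fun_eq_iff\<close>)
  qed (use assms in \<open>auto intro!: runs_WhileI_None\<close>)
  have "den (Push 9 True) s = Some (s(9 := [True]))" using assms by simp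
  from runs_SeqD[OF _ this *[of "s(9 := [True])" "s a" "s b"]] assms
  show ?thesis unfolding parse_def
    by (cases "unpair (s b) (s a)") (auto simp: fun_eq_iff)
qed

lemma unary_Nil [simp]: "unary [] = []"
  by (simp add: unary_def)

lemma unary_Cons [simp]: "unary (v # vs) = replicate v True @ False # unary vs"
  by (simp add: unary_def)

text \<open>
  One bit per part is consumed; a set bit is a raising operator moving a unit from this part to \<open>l\<close>, and
  flips the sign \<open>p\<close>.
\<close>

fun passf :: "nat \<Rightarrow> nat list \<Rightarrow> bool list \<Rightarrow> bool \<Rightarrow> (nat \<times> nat list \<times> bool list \<times> bool) option" where
  "passf l [] ys p = Some (l, [], ys, p)"
| "passf l (v # vs) [] p = None"
| "passf l (v # vs) (False # ys) p = map_option (\<lambda>(l', vs', r). (l', v # vs', r)) (passf l vs ys p)"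
| "passf l (v # vs) (True # ys) p = (if v = 0 then None else
     map_option (\<lambda>(l', vs', r). (l', (v - 1) # vs', r)) (passf (Suc l) vs ys (\<not> p)))"

definition flip :: com where
  "flip = Case 7 Skip (Pop 7 ;; Push 7 True) (Pop 7 ;; Push 7 False)"

text \<open>Register 0 holds the unread witness, 5 the unread parts in unary, 6 the finished parts
  reversed, 4 the part being raised and 7 the sign. A unit can be taken only if a True bit is on top
  of register 5; a False bit means that the part is zero.\<close>

definition read_bit :: com where
  "read_bit = Case 0 Fail (Pop 0) (Pop 0 ;; Case 5 Skip Fail (Pop 5 ;; Push 4 True ;; flip))"

definition pass_step :: com where
  "pass_step = read_bit ;; ones 5 6 ;; Pop 5 ;; Push 6 False"

lemma runs_copy_part:
  assumes "s 5 = unary (v # vs)" "s 9 = []"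
  shows "runs (ones 5 6 ;; Pop 5 ;; Push 6 False) s (20 * v + 30)
    (Some (s(5 := unary vs, 6 := False # replicate v True @ s 6)))"
proof -
  have 1: "runs (ones 5 6) s (20 * Suc v) (Some (s(5 := False # unary vs, 6 := replicate v True @ s 6)))"
    by (rule runs_ones) (use assms in auto)
  have 2: "runs (Pop 5 ;; Push 6 False) (s(5 := False # unary vs, 6 := replicate v True @ s 6)) 5
    (Some (s(5 := unary vs, 6 := False # replicate v True @ s 6)))"
    by (rule runs_weaken[OF runs_den]) (auto simp: fun_eq_iff)
  show ?thesis by (rule runs_SeqI[OF 1 2]) auto
qed

text \<open>A part \<open>v\<close> costs about \<open>20 * v\<close> plus a constant and occupies
  \<open>v + 1\<close> bits, so the factor 100 pays for the whole pass.\<close>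

lemma runs_pass:
  assumes "s 5 = unary vs" "s 7 = [p]" "s 9 = []" "s 4 = replicate l True"
  shows "runs (While 5 pass_step) s (100 * length (unary vs) + 1)
    (map_option (\<lambda>(l', vs', ys, p'). s(0 := ys, 4 := replicate l' True, 5 := [],
       6 := rev (unary vs') @ s 6, 7 := [p'])) (passf l vs (s 0) p))"
  using assms
proof (induction l vs "s 0" p arbitrary: s rule: passf.induct)
  case (1 l p)
  then show ?case by (intro runs_weaken[OF runs_While_End]) (auto simp: fun_eq_iff)
next
  case (2 l v vs p)
  have "runs read_bit s (cost read_bit) None"
    by (rule runs_den_eq) (use 2 in \<open>auto simp: read_bit_def flip_def\<close>)
  then have "runs pass_step s (Suc (cost read_bit)) None"
    unfolding pass_step_def by (rule runs_Seq_None)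
  then have "runs (While 5 pass_step) s (Suc (Suc (cost read_bit))) None"
    by (rule runs_While_None[rotated]) (use 2 in auto)
  then show ?case by (rule runs_weaken) (use 2(1)[symmetric] in \<open>auto simp: read_bit_def flip_def\<close>)
next
  case (3 l v vs ys p)
  define s1 where "s1 = s(0 := ys)"
  define s2 where "s2 = s1(5 := unary vs, 6 := False # replicate v True @ s 6)"
  have c: "runs read_bit s 40 (Some s1)"
    by (rule runs_weaken[OF runs_den]) (use 3(2)[symmetric] in \<open>auto simp: read_bit_def flip_def s1_def\<close>)
  have c2: "runs (ones 5 6 ;; Pop 5 ;; Push 6 False) s1 (20 * v + 30) (Some s2)"
    using runs_copy_part[of s1 v vs] 3 by (simp add: s1_def s2_def)
  have b: "runs pass_step s (20 * v + 71) (Some s2)"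
    unfolding pass_step_def by (rule runs_SeqI[OF c c2]) auto
  have s2: "s2 0 = ys" "s2 5 = unary vs" "s2 7 = [p]" "s2 9 = []" "s2 4 = replicate l True"
    using 3(2-) by (auto simp: s2_def s1_def)
  have IH: "runs (While 5 pass_step) s2 (100 * length (unary vs) + 1)
    (map_option (\<lambda>(l', vs', ys, p'). s2(0 := ys, 4 := replicate l' True, 5 := [],
       6 := rev (unary vs') @ s2 6, 7 := [p'])) (passf l vs ys p))"
    using "3.hyps"(1)[OF s2(1)[symmetric] s2(2-5)] s2(1) by simp
  show ?case
    by (rule runs_weaken[OF runs_While[OF _ b IH]])
      (use 3(3) 3(2)[symmetric] in \<open>auto simp: s1_def s2_def fun_eq_iff option.map_comp
        intro!: option.map_cong0\<close>)
next
  case (4 l v vs ys p)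
  show ?case
  proof (cases v)
    case 0
    have "runs read_bit s (cost read_bit) None"
      by (rule runs_den_eq) (use 4(2)[symmetric] 4(3) 0 in \<open>auto simp: read_bit_def flip_def\<close>)
    then have "runs pass_step s (Suc (cost read_bit)) None"
      unfolding pass_step_def by (rule runs_Seq_None)
    then have "runs (While 5 pass_step) s (Suc (Suc (cost read_bit))) None"
      by (rule runs_While_None[rotated]) (use 4 in auto)
    then show ?thesis
      by (rule runs_weaken) (use 4(2)[symmetric] 0 in \<open>auto simp: read_bit_def flip_def\<close>)
  next
    case (Suc v')
    define s1 where "s1 = s(0 := ys, 4 := True # s 4, 5 := unary (v' # vs), 7 := [\<not> p])"
    define s2 where "s2 = s1(5 := unary vs, 6 := False # replicate v' True @ s 6)"
    have c: "runs read_bit s 40 (Some s1)"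
      by (rule runs_weaken[OF runs_den])
        (use 4(2)[symmetric] 4(3-6) Suc in \<open>auto simp: read_bit_def flip_def s1_def fun_eq_iff\<close>)
    have c2: "runs (ones 5 6 ;; Pop 5 ;; Push 6 False) s1 (20 * v' + 30) (Some s2)"
      using runs_copy_part[of s1 v' vs] 4 by (simp add: s1_def s2_def)
    have b: "runs pass_step s (20 * v' + 71) (Some s2)"
      unfolding pass_step_def by (rule runs_SeqI[OF c c2]) auto
    have s2: "s2 0 = ys" "s2 5 = unary vs" "s2 7 = [\<not> p]" "s2 9 = []" "s2 4 = replicate (Suc l) True"
      using 4(2-) by (auto simp: s2_def s1_def)
    have IH: "runs (While 5 pass_step) s2 (100 * length (unary vs) + 1)
      (map_option (\<lambda>(l', vs', ys, p'). s2(0 := ys, 4 := replicate l' True, 5 := [],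
         6 := rev (unary vs') @ s2 6, 7 := [p'])) (passf (Suc l) vs ys (\<not> p)))"
      using "4.hyps"(1)[OF _ s2(1)[symmetric] s2(2-5)] s2(1) Suc by simp
    show ?thesis
      by (rule runs_weaken[OF runs_While[OF _ b IH]])
        (use 4(3) 4(2)[symmetric] Suc in \<open>auto simp: s1_def s2_def fun_eq_iff option.map_comp
          intro!: option.map_cong0\<close>)
  qed
qed

section \<open>The program for raising operators and coarsenings\<close>

text \<open>A raising step moves one unit between parts, so the total unary length is conserved;
  this keeps time polynomial over many passes.\<close>

lemma passf_size: "passf l vs ys p = Some (l', vs', ys', p') \<Longrightarrow>
    l' + length (unary vs') = l + length (unary vs) \<and> length ys' \<le> length ys"
  by (induction l vs ys p arbitrary: l' vs' rule: passf.induct) (fastforce split: if_splits)+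

text \<open>
  Decodes a reversed unary word, but is defined on all words, as the program must halt on all inputs.
\<close>

function blocks :: "bool list \<Rightarrow> nat list" where
  "blocks [] = []"
| "blocks (b # t) = length (takeWhile id t) # blocks (dropWhile id t)"
  by pat_completeness auto
termination
  by (relation "measure length") (auto simp: less_Suc_eq_le length_dropWhile_le)

lemma takeWhile_id: "takeWhile id t = replicate (length (takeWhile id t)) True"
  by (rule replicate_length_same[symmetric]) (auto dest: set_takeWhileD)

text \<open>Each block drops one bit \<open>b\<close>, taken as a terminator whatever its value.
  Sizes therefore agree on malformed words too, and the time bound covers them.\<close>

lemma blocks_size: "length (unary (blocks t)) = length t"
proof (induction t rule: blocks.induct)
  case (2 b t)
  have "length t = length (takeWhile id t) + length (dropWhile id t)"
    by (metis length_append takeWhile_dropWhile_id)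
  with 2 show ?case by simp
qed simp

lemma blocks_rev_unary: "blocks (rev (unary vs)) = rev vs"
proof (induction vs rule: rev_induct)
  case (snoc v vs)
  have "rev (unary (vs @ [v])) = False # replicate v True @ rev (unary vs)"
    by (simp add: unary_def)
  moreover have "takeWhile id (replicate v True @ rev (unary vs)) = replicate v True \<and>
      dropWhile id (replicate v True @ rev (unary vs)) = rev (unary vs)"
    by (cases vs rule: rev_cases) (auto simp: unary_def takeWhile_append dropWhile_append)
  ultimately show ?case using snoc by simp
qed simp

text \<open>
  Parts are processed from the last to the first. Every part then receives all its increments before
  its decrements, so that an underflow occurs exactly if the final exponent is negative.
\<close>

fun stagef :: "nat list \<Rightarrow> nat list \<Rightarrow> bool list \<Rightarrow> bool \<Rightarrow> (nat list \<times> bool list \<times> bool) option" where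
  "stagef [] vs ys p = Some (vs, ys, p)"
| "stagef (l # ls) vs ys p =
     (case passf l vs ys p of None \<Rightarrow> None | Some (l', vs', ys', p') \<Rightarrow> stagef ls (l' # vs') ys' p')"

lemma stagef_size: "stagef ls vs ys p = Some (vs', ys', p') \<Longrightarrow>
    length (unary vs') = length (unary ls) + length (unary vs) \<and> length ys' \<le> length ys"
proof (induction ls arbitrary: vs ys p)
  case (Cons l ls)
  then obtain l1 vs1 ys1 p1 where "passf l vs ys p = Some (l1, vs1, ys1, p1)"
    "stagef ls (l1 # vs1) ys1 p1 = Some (vs', ys', p')"
    by (auto split: option.splits)
  with passf_size[OF this(1)] Cons.IH[OF this(2)] show ?case by auto
qed auto

text \<open>Register 1 holds the unprocessed parts in reversed unary, so the last remaining part
  comes first. Moving the result of the pass back restores its order, and the raised part is put in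
  front, terminator first because stacks grow towards the front.\<close>

definition stage :: com where
  "stage = Pop 1 ;; ones 1 4 ;; While 5 pass_step ;; mv 6 5 ;; Push 5 False ;; mv 4 5"

lemma runs_stage:
  assumes "s 1 = b # replicate n True @ t" "t = [] \<or> \<not> hd t" "s 5 = unary vs" "s 7 = [p]"
    "s 9 = []" "s 4 = []" "s 6 = []"
  shows "runs stage s (200 * (n + length (unary vs)) + 150)
    (map_option (\<lambda>(l', vs', ys, p'). s(0 := ys, 1 := t, 5 := unary (l' # vs'), 7 := [p']))
      (passf n vs (s 0) p))"
proof -
  define s1 where "s1 = s(1 := replicate n True @ t)"
  define s2 where "s2 = s(1 := t, 4 := replicate n True)"
  have 1: "runs (Pop 1) s 1 (Some s1)"
    by (rule runs_weaken[OF runs_den]) (use assms in \<open>auto simp: s1_def\<close>)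
  have 2: "runs (ones 1 4) s1 (20 * Suc n) (Some s2)"
    by (rule runs_weaken[OF runs_ones[where n = n and xs = t]]) (use assms in \<open>auto simp: s1_def s2_def fun_eq_iff\<close>)
  have 3: "runs (While 5 pass_step) s2 (100 * length (unary vs) + 1)
    (map_option (\<lambda>(l', vs', ys, p'). s2(0 := ys, 4 := replicate l' True, 5 := [],
       6 := rev (unary vs') @ s2 6, 7 := [p'])) (passf n vs (s 0) p))"
    using runs_pass[of s2 vs p n] assms by (simp add: s2_def)
  show ?thesis
  proof (cases "passf n vs (s 0) p")
    case None
    then have "runs stage s (Suc (1 + Suc (20 * Suc n + Suc (100 * length (unary vs) + 1)))) None"
      unfolding stage_def using runs_Seq[OF 1 runs_Seq[OF 2 runs_Seq_None[OF 3[unfolded None option.map]]]] by simp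
    then show ?thesis by (rule runs_weaken) (auto simp: None)
  next
    case (Some r)
    then obtain l' vs' ys p' where r: "passf n vs (s 0) p = Some (l', vs', ys, p')" by (cases r) auto
    have sz: "l' + length (unary vs') = n + length (unary vs)" using passf_size[OF r] by simp
    define s3 where "s3 = s2(0 := ys, 4 := replicate l' True, 5 := [], 6 := rev (unary vs'), 7 := [p'])"
    define s4 where "s4 = s3(5 := unary vs', 6 := [])"
    define s5 where "s5 = s4(5 := False # unary vs')"
    have 3: "runs (While 5 pass_step) s2 (100 * length (unary vs) + 1) (Some s3)"
      using 3 r assms by (simp add: s3_def s2_def)
    have 4: "runs (mv 6 5) s3 (20 * Suc (length (unary vs'))) (Some s4)"
      by (rule runs_weaken[OF runs_mv]) (auto simp: s3_def s4_def fun_eq_iff)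
    have 5: "runs (Push 5 False) s4 2 (Some s5)"
      by (rule runs_weaken[OF runs_den]) (auto simp: s4_def s5_def)
    have 6: "runs (mv 4 5) s5 (20 * Suc l') (Some (s(0 := ys, 1 := t, 5 := unary (l' # vs'), 7 := [p'])))"
      by (rule runs_weaken[OF runs_mv])
        (use assms in \<open>auto simp: s2_def s3_def s4_def s5_def fun_eq_iff\<close>)
    show ?thesis unfolding stage_def
      by (rule runs_weaken[OF runs_Seq[OF 1 runs_Seq[OF 2 runs_Seq[OF 3 runs_Seq[OF 4 runs_Seq[OF 5 6]]]]]])
        (use sz r in auto)
  qed
qed

text \<open>\<open>N\<close> is invariant: a stage transfers a part from register 1 to register 5
  and conserves the unary length. Each stage is thus linear in \<open>N\<close>, and each consumes
  at least one bit of \<open>t\<close>.\<close>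

lemma runs_stages:
  assumes "s 1 = t" "s 5 = unary vs" "s 7 = [p]" "s 9 = []" "s 4 = []" "s 6 = []"
    "length t + length (unary vs) = N"
  shows "runs (While 1 stage) s (200 * Suc N * length t + 1)
    (map_option (\<lambda>(vs', ys, p'). s(0 := ys, 1 := [], 5 := unary vs', 7 := [p']))
      (stagef (blocks t) vs (s 0) p))"
  using assms
proof (induction t arbitrary: s vs p rule: blocks.induct)
  case 1
  then show ?case by (intro runs_weaken[OF runs_While_End]) (auto simp: fun_eq_iff)
next
  case (2 b t)
  define n where "n = length (takeWhile id t)"
  define xs where "xs = dropWhile id t"
  have tw: "takeWhile id t = replicate n True"
    unfolding n_def by (rule takeWhile_id)
  have t: "t = replicate n True @ xs"
    by (simp only: tw[symmetric] xs_def takeWhile_dropWhile_id)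
  have hd_xs: "xs = [] \<or> \<not> hd xs"
    using hd_dropWhile[of id t] by (auto simp: xs_def)
  have s1: "s 1 = b # replicate n True @ xs"
    using "2.prems"(1) unfolding t .
  have len: "length t = n + length xs" using t by simp
  have st: "runs stage s (200 * (n + length (unary vs)) + 150)
    (map_option (\<lambda>(l', vs', ys, p'). s(0 := ys, 1 := xs, 5 := unary (l' # vs'), 7 := [p']))
      (passf n vs (s 0) p))"
    by (rule runs_stage[OF s1 hd_xs "2.prems"(2-6)])
  have bl: "blocks (b # t) = n # blocks xs" by (simp add: n_def xs_def)
  have ne: "s 1 \<noteq> []" using 2 by simp
  have T: "200 * (n + length (unary vs)) + 152 + 200 * Suc N * length xs \<le> 200 * Suc N * length (b # t) + 1"
  proof -
    have "200 * (n + length (unary vs)) + 152 \<le> 200 * Suc N" using 2(8) len by simp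
    then show ?thesis using len by (simp add: algebra_simps)
  qed
  show ?case
  proof (cases "passf n vs (s 0) p")
    case None
    with st have "runs stage s (200 * (n + length (unary vs)) + 150) None" by simp
    from runs_While_None[of s 1, OF ne this] show ?thesis
      by (rule runs_weaken) (use T None bl in auto)
  next
    case (Some r)
    then obtain l' vs' ys p' where r: "passf n vs (s 0) p = Some (l', vs', ys, p')" by (cases r) auto
    have sz: "l' + length (unary vs') = n + length (unary vs)" using passf_size[OF r] by simp
    define s' where "s' = s(0 := ys, 1 := xs, 5 := unary (l' # vs'), 7 := [p'])"
    have st: "runs stage s (200 * (n + length (unary vs)) + 150) (Some s')"
      using st r by (simp add: s'_def)
    have s': "s' 1 = xs" "s' 5 = unary (l' # vs')" "s' 7 = [p']" "s' 9 = []" "s' 4 = []" "s' 6 = []"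
      "length xs + length (unary (l' # vs')) = N" "s' 0 = ys"
      using 2(2-) sz len by (auto simp: s'_def)
    have IH: "runs (While 1 stage) s' (200 * Suc N * length xs + 1)
      (map_option (\<lambda>(vs', ys, p'). s'(0 := ys, 1 := [], 5 := unary vs', 7 := [p']))
        (stagef (blocks xs) (l' # vs') (s' 0) p'))"
      by (rule "2.IH"[folded xs_def, OF s'(1-7)])
    show ?thesis
      by (rule runs_weaken[OF runs_While[of s 1, OF ne st IH]])
        (use T bl r s'(8) in \<open>auto simp: s'_def fun_eq_iff intro!: option.map_cong0\<close>)
  qed
qed

text \<open>
  Zero parts are dropped. A set bit closes the current part, a clear bit merges it with the next one,
  which \<open>strict\<close> forbids. The output is a reversed unary word whose last part may still be open.
\<close>

fun coarsenf :: "bool \<Rightarrow> nat list \<Rightarrow> bool list \<Rightarrow> bool list \<Rightarrow> (bool list \<times> bool list) option" where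
  "coarsenf strict [] ys z = Some (z, ys)"
| "coarsenf strict (v # vs) ys z = (if v = 0 then coarsenf strict vs ys z else
     case ys of [] \<Rightarrow> None
     | b # ys' \<Rightarrow> if b then coarsenf strict vs ys' (False # replicate v True @ z)
         else if strict then None else coarsenf strict vs ys' (replicate v True @ z))"

lemma coarsenf_size: "coarsenf strict vs ys z = Some (z', ys') \<Longrightarrow>
    length z' \<le> length (unary vs) + length z \<and> length ys' \<le> length ys"
  by (induction strict vs ys z arbitrary: z' ys' rule: coarsenf.induct)
    (fastforce split: if_splits list.splits)+

text \<open>A False bit on top of register 5 is the terminator of a zero part, which is dropped
  without reading a witness bit.\<close>

definition coarsen_step :: "bool \<Rightarrow> com" where
  "coarsen_step strict = Case 5 Skip (Pop 5)
     (ones 5 8 ;; Pop 5 ;; Case 0 Fail (if strict then Fail else Pop 0) (Pop 0 ;; Push 8 False))"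

lemma runs_coarsen:
  assumes "s 5 = unary vs" "s 9 = []"
  shows "runs (While 5 (coarsen_step strict)) s (100 * length (unary vs) + 1)
    (map_option (\<lambda>(z, ys). s(0 := ys, 5 := [], 8 := z)) (coarsenf strict vs (s 0) (s 8)))"
  using assms
proof (induction vs arbitrary: s)
  case Nil
  then show ?case by (intro runs_weaken[OF runs_While_End]) (auto simp: fun_eq_iff)
next
  case (Cons v vs)
  have ne: "s 5 \<noteq> []" using Cons by simp
  show ?case
  proof (cases v)
    case 0
    define s' where "s' = s(5 := unary vs)"
    have "runs (Pop 5) s 1 (Some s')"
      by (rule runs_weaken[OF runs_den]) (use 0 Cons in \<open>auto simp: s'_def\<close>)
    then have st: "runs (coarsen_step strict) s 2 (Some s')"
      unfolding coarsen_step_def by (intro runs_weaken[OF runs_Case]) (use 0 Cons in auto)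
    have s': "s' 5 = unary vs" "s' 9 = []" "s' 0 = s 0" "s' 8 = s 8"
      using Cons.prems by (auto simp: s'_def)
    have IH: "runs (While 5 (coarsen_step strict)) s' (100 * length (unary vs) + 1)
      (map_option (\<lambda>(z, ys). s'(0 := ys, 5 := [], 8 := z)) (coarsenf strict vs (s 0) (s 8)))"
      using Cons.IH[OF s'(1,2)] unfolding s'(3,4) .
    show ?thesis
      by (rule runs_weaken[OF runs_While[of s 5, OF ne st IH]])
        (use 0 in \<open>auto simp: s'_def fun_eq_iff intro!: option.map_cong0\<close>)
  next
    case (Suc v')
    let ?tail = "Case 0 Fail (if strict then Fail else Pop 0) (Pop 0 ;; Push 8 False)"
    define s1 where "s1 = s(5 := False # unary vs, 8 := replicate v True @ s 8)"
    have 1: "runs (ones 5 8) s (20 * Suc v) (Some s1)"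
      by (rule runs_weaken[OF runs_ones[where n = v and xs = "False # unary vs"]])
        (use Cons in \<open>auto simp: s1_def\<close>)
    have step: "runs (coarsen_step strict) s (20 * v + 50) (den (Pop 5 ;; ?tail) s1)"
    proof -
      have "runs (ones 5 8 ;; Pop 5 ;; ?tail) s (20 * v + 49) (den (Pop 5 ;; ?tail) s1)"
        by (rule runs_weaken[OF runs_Seq[OF 1 runs_den]]) auto
      then show ?thesis
        unfolding coarsen_step_def by (intro runs_weaken[OF runs_Case]) (use Suc Cons in auto)
    qed
    \<comment> \<open>The remaining cases differ only in whether the step fails and in what it
      leaves in registers 0 and 8, so each outcome is treated once.\<close>
    have fail: ?thesis if "den (Pop 5 ;; ?tail) s1 = None" "coarsenf strict (v # vs) (s 0) (s 8) = None"
    proof -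
      have "runs (While 5 (coarsen_step strict)) s (Suc (20 * v + 50)) None"
        by (rule runs_While_None[of s 5, OF ne]) (use step that(1) in simp)
      then show ?thesis by (rule runs_weaken) (use that(2) Suc in auto)
    qed
    have ok: ?thesis if "den (Pop 5 ;; ?tail) s1 = Some (s(0 := ys, 5 := unary vs, 8 := z))"
      "coarsenf strict (v # vs) (s 0) (s 8) = coarsenf strict vs ys z" for ys z
    proof -
      define s' where "s' = s(0 := ys, 5 := unary vs, 8 := z)"
      have s': "s' 5 = unary vs" "s' 9 = []" "s' 0 = ys" "s' 8 = z"
        using Cons.prems by (auto simp: s'_def)
      have IH: "runs (While 5 (coarsen_step strict)) s' (100 * length (unary vs) + 1)
        (map_option (\<lambda>(z, ys). s'(0 := ys, 5 := [], 8 := z)) (coarsenf strict vs ys z))"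
        using Cons.IH[OF s'(1,2)] unfolding s'(3,4) .
      have st: "runs (coarsen_step strict) s (20 * v + 50) (Some s')"
        using step that(1) by (simp add: s'_def)
      show ?thesis
        by (rule runs_weaken[OF runs_While[of s 5, OF ne st IH]])
          (use Suc that(2) in \<open>auto simp: s'_def fun_eq_iff intro!: option.map_cong0\<close>)
    qed
    show ?thesis
    proof (cases "s 0")
      case Nil
      then show ?thesis using Suc by (intro fail) (auto simp: s1_def)
    next
      case (Cons b ys)
      show ?thesis
      proof (cases b)
        case True
        then show ?thesis using Cons Suc
          by (intro ok[of ys "False # replicate v True @ s 8"]) (auto simp: s1_def fun_eq_iff)
      next
        case False
        show ?thesis
        proof (cases strict)
          case True
          then show ?thesis using Cons Suc \<open>\<not> b\<close> by (intro fail) (auto simp: s1_def)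
        next
          case False
          then show ?thesis using Cons Suc \<open>\<not> b\<close>
            by (intro ok[of ys "replicate v True @ s 8"]) (auto simp: s1_def fun_eq_iff)
        qed
      qed
    qed
  qed
qed

section \<open>Reading the input and writing the query to the decider\<close>

definition double_to :: "nat \<Rightarrow> nat \<Rightarrow> com" where
  "double_to a b = each a (Push b False ;; Push b False) (Push b True ;; Push b True)"

lemma runs_double_to:
  assumes "a \<noteq> b"
  shows "runs (double_to a b) s (20 * Suc (length (s a)))
    (Some (s(a := [], b := concat (map (\<lambda>x. [x, x]) (rev (s a))) @ s b)))"
  unfolding double_to_def by (rule runs_each) (use assms in auto)

definition quadruple_to :: "nat \<Rightarrow> nat \<Rightarrow> com" where
  "quadruple_to a b = each a (Push b False ;; Push b False ;; Push b False ;; Push b False)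
     (Push b True ;; Push b True ;; Push b True ;; Push b True)"

lemma runs_quadruple_to:
  assumes "a \<noteq> b"
  shows "runs (quadruple_to a b) s (40 * Suc (length (s a)))
    (Some (s(a := [], b := concat (map (\<lambda>x. [x, x, x, x]) (rev (s a))) @ s b)))"
  unfolding quadruple_to_def by (rule runs_each) (use assms in auto)

text \<open>The partition stays reversed in register 1, so that its last part comes first, as the
  stages require. The object stays reversed in register 3, because \<open>quadruple_to\<close>
  reverses it back.\<close>

definition read_input :: com where
  "read_input = parse 0 1 ;; mv 1 2 ;; parse 2 3 ;; mv 2 1 ;; Push 7 False"

text \<open>The word is built back to front: rest of the witness, separator, composition, separator,
  object. In a nested pair the first word is encoded twice and the inner separator once more, whence
  quadrupled bits and the separator 0011. The initial test rejects an output whose last part was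
  never closed.\<close>

definition write_output :: com where
  "write_output = Case 8 Skip Skip Fail ;; mv 0 1 ;; mv 1 10 ;; (Push 10 True ;; Push 10 False) ;;
     double_to 8 10 ;; (Push 10 True ;; Push 10 True ;; Push 10 False ;; Push 10 False) ;;
     quadruple_to 3 10"

definition main_prog :: "bool \<Rightarrow> com" where
  "main_prog strict = read_input ;; While 1 stage ;; While 5 (coarsen_step strict) ;; write_output"

lemma word_pair_word_pair:
  "word_pair (word_pair w a) y = concat (map (\<lambda>x. [x, x, x, x]) w) @ [False, False, True, True] @
     concat (map (\<lambda>x. [x, x]) a) @ [False, True] @ y"
proof -
  have "concat (map (\<lambda>b. [b, b]) (concat (map (\<lambda>b. [b, b]) w))) = concat (map (\<lambda>x. [x, x, x, x]) w)"
    by (induction w) auto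
  then show ?thesis by (simp add: word_pair_def)
qed

lemma runs_input:
  assumes "unpair [] u = Some (rx, y)" "unpair [] (rev rx) = Some (rw, um)"
  shows "runs read_input (init_regs u) (200 * Suc (length u))
    (Some ((\<lambda>_. [])(0 := y, 1 := rev um, 3 := rw, 7 := [False])))"
proof -
  obtain x where x: "rx = rev x" "u = word_pair x y" using unpair_SomeD[OF assms(1)] by auto
  obtain w where w: "rw = rev w" "x = word_pair w um" using unpair_SomeD[OF assms(2)] x by auto
  have sz: "length x \<le> length u" "length um \<le> length x"
    unfolding x(2) w(2) by (auto simp: word_pair_def length_concat comp_def sum_list_triv)
  let ?e = "(\<lambda>_. []) :: regs"
  have 1: "runs (parse 0 1) (init_regs u) (40 * Suc (length u)) (Some (?e(0 := y, 1 := rx)))"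
    by (rule runs_weaken[OF runs_parse]) (use assms in \<open>auto simp: init_regs_def fun_eq_iff\<close>)
  have 2: "runs (mv 1 2) (?e(0 := y, 1 := rx)) (20 * Suc (length u)) (Some (?e(0 := y, 2 := rev rx)))"
    by (rule runs_weaken[OF runs_mv]) (use x sz in \<open>auto simp: fun_eq_iff\<close>)
  have 3: "runs (parse 2 3) (?e(0 := y, 2 := rev rx)) (40 * Suc (length u))
      (Some (?e(0 := y, 2 := um, 3 := rw)))"
    by (rule runs_weaken[OF runs_parse]) (use assms x sz in \<open>auto simp: fun_eq_iff\<close>)
  have 4: "runs (mv 2 1) (?e(0 := y, 2 := um, 3 := rw)) (20 * Suc (length u))
      (Some (?e(0 := y, 1 := rev um, 3 := rw)))"
    by (rule runs_weaken[OF runs_mv]) (use sz in \<open>auto simp: fun_eq_iff\<close>)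
  have 5: "runs (Push 7 False) (?e(0 := y, 1 := rev um, 3 := rw)) 2
      (Some (?e(0 := y, 1 := rev um, 3 := rw, 7 := [False])))"
    by (rule runs_weaken[OF runs_den]) auto
  show ?thesis unfolding read_input_def
    by (rule runs_weaken[OF runs_Seq[OF 1 runs_Seq[OF 2 runs_Seq[OF 3 runs_Seq[OF 4 5]]]]]) auto
qed

lemma runs_input_None1:
  assumes "unpair [] u = None"
  shows "runs read_input (init_regs u) (200 * Suc (length u)) None"
proof -
  have 1: "runs (parse 0 1) (init_regs u) (40 * Suc (length u)) None"
    by (rule runs_weaken[OF runs_parse]) (use assms in \<open>auto simp: init_regs_def fun_eq_iff\<close>)
  show ?thesis unfolding read_input_def by (rule runs_weaken[OF runs_Seq_None[OF 1]]) auto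
qed

lemma runs_input_None2:
  assumes "unpair [] u = Some (rx, y)" "unpair [] (rev rx) = None"
  shows "runs read_input (init_regs u) (200 * Suc (length u)) None"
proof -
  obtain x where x: "rx = rev x" "u = word_pair x y" using unpair_SomeD[OF assms(1)] by auto
  have sz: "length x \<le> length u"
    unfolding x(2) by (auto simp: word_pair_def length_concat comp_def sum_list_triv)
  let ?e = "(\<lambda>_. []) :: regs"
  have 1: "runs (parse 0 1) (init_regs u) (40 * Suc (length u)) (Some (?e(0 := y, 1 := rx)))"
    by (rule runs_weaken[OF runs_parse]) (use assms in \<open>auto simp: init_regs_def fun_eq_iff\<close>)
  have 2: "runs (mv 1 2) (?e(0 := y, 1 := rx)) (20 * Suc (length u)) (Some (?e(0 := y, 2 := rev rx)))"
    by (rule runs_weaken[OF runs_mv]) (use x sz in \<open>auto simp: fun_eq_iff\<close>)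
  have 3: "runs (parse 2 3) (?e(0 := y, 2 := rev rx)) (40 * Suc (length u)) None"
    by (rule runs_weaken[OF runs_parse]) (use assms x sz in \<open>auto simp: fun_eq_iff\<close>)
  show ?thesis unfolding read_input_def
    by (rule runs_weaken[OF runs_Seq[OF 1 runs_Seq[OF 2 runs_Seq_None[OF 3]]]]) auto
qed

lemma runs_output:
  assumes "z = [] \<or> \<not> hd z" "s 8 = z" "s 0 = y" "s 3 = rev w" "s 1 = []" "s 10 = []"
    "length y \<le> n" "length z \<le> n" "length w \<le> n"
  shows "\<exists>s'. runs write_output s (200 * Suc n) (Some s') \<and> s' 7 = s 7 \<and>
    s' 10 = word_pair (word_pair w (rev z)) y"
proof -
  define s2 where "s2 = s(0 := [], 1 := rev y)"
  define s3 where "s3 = s(0 := [], 1 := [], 10 := y)"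
  define s4 where "s4 = s(0 := [], 1 := [], 10 := [False, True] @ y)"
  define s5 where "s5 = s(0 := [], 1 := [], 8 := [],
     10 := concat (map (\<lambda>x. [x, x]) (rev z)) @ [False, True] @ y)"
  define s6 where "s6 = s5(10 := [False, False, True, True] @ s5 10)"
  define s7 where "s7 = s6(3 := [], 10 := concat (map (\<lambda>x. [x, x, x, x]) w) @ s6 10)"
  have 1: "runs (Case 8 Skip Skip Fail) s 4 (Some s)"
    by (rule runs_weaken[OF runs_den]) (use assms in \<open>auto split: list.splits\<close>)
  have 2: "runs (mv 0 1) s (20 * Suc n) (Some s2)"
    by (rule runs_weaken[OF runs_mv]) (use assms in \<open>auto simp: s2_def fun_eq_iff\<close>)
  have 3: "runs (mv 1 10) s2 (20 * Suc n) (Some s3)"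
    by (rule runs_weaken[OF runs_mv]) (use assms in \<open>auto simp: s2_def s3_def fun_eq_iff\<close>)
  have 4: "runs (Push 10 True ;; Push 10 False) s3 5 (Some s4)"
    by (rule runs_weaken[OF runs_den]) (auto simp: s3_def s4_def fun_eq_iff)
  have 5: "runs (double_to 8 10) s4 (20 * Suc n) (Some s5)"
    by (rule runs_weaken[OF runs_double_to]) (use assms in \<open>auto simp: s4_def s5_def fun_eq_iff\<close>)
  have 6: "runs (Push 10 True ;; Push 10 True ;; Push 10 False ;; Push 10 False) s5 11 (Some s6)"
    by (rule runs_weaken[OF runs_den]) (auto simp: s6_def fun_eq_iff)
  have 7: "runs (quadruple_to 3 10) s6 (40 * Suc n) (Some s7)"
    by (rule runs_weaken[OF runs_quadruple_to]) (use assms in \<open>auto simp: s5_def s6_def s7_def fun_eq_iff\<close>)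
  have "runs write_output s (200 * Suc n) (Some s7)" unfolding write_output_def
    by (rule runs_weaken[OF runs_Seq[OF 1 runs_Seq[OF 2 runs_Seq[OF 3 runs_Seq[OF 4 runs_Seq[OF 5
      runs_Seq[OF 6 7]]]]]]]) auto
  moreover have "s7 10 = word_pair (word_pair w (rev z)) y"
    unfolding word_pair_word_pair by (simp add: s7_def s6_def s5_def)
  moreover have "s7 7 = s 7" by (simp add: s7_def s6_def s5_def)
  ultimately show ?thesis by blast
qed

lemma runs_output_None:
  assumes "\<not> (z = [] \<or> \<not> hd z)" "s 8 = z"
  shows "runs write_output s 5 None"
proof -
  have 1: "runs (Case 8 Skip Skip Fail) s 4 None"
    by (rule runs_weaken[OF runs_den]) (use assms in \<open>auto split: list.splits\<close>)
  show ?thesis unfolding write_output_def by (rule runs_weaken[OF runs_Seq_None[OF 1]]) auto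
qed

text \<open>Specification on arbitrary words, as the decision must be right on malformed inputs as
  well. The Boolean is the sign, the word the query passed on.\<close>

definition mainf :: "bool \<Rightarrow> bool list \<Rightarrow> (bool \<times> bool list) option" where
  "mainf strict u = (case unpair [] u of None \<Rightarrow> None | Some (rx, y) \<Rightarrow>
    (case unpair [] (rev rx) of None \<Rightarrow> None | Some (rw, um) \<Rightarrow>
    (case stagef (blocks (rev um)) [] y False of None \<Rightarrow> None | Some (vs, ys, p) \<Rightarrow>
    (case coarsenf strict vs ys [] of None \<Rightarrow> None | Some (z, y') \<Rightarrow>
      if z = [] \<or> \<not> hd z then Some (p, word_pair (word_pair (rev rw) (rev z)) y') else None))))"

lemma runs_main_prog:
  "\<exists>out. runs (main_prog strict) (init_regs u) (1000 * Suc (length u) * Suc (length u)) out \<and>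
    (case mainf strict u of None \<Rightarrow> out = None
     | Some (p, z) \<Rightarrow> \<exists>s. out = Some s \<and> s 7 = [p] \<and> s 10 = z)"
proof -
  define n where "n = length u"
  have T: "600 * Suc n + 200 * (Suc n * n) + 10 \<le> 1000 * Suc n * Suc n" by (simp add: algebra_simps)
  show ?thesis
  proof (cases "unpair [] u")
    case None
    have "runs (main_prog strict) (init_regs u) (1000 * Suc n * Suc n) None"
      unfolding main_prog_def
      by (rule runs_weaken[OF runs_Seq_None[OF runs_input_None1[OF None]]])
        (use T in \<open>simp_all add: n_def\<close>)
    then show ?thesis using None by (auto simp: mainf_def n_def)
  next
    case (Some a)
    then obtain rx y where 1: "unpair [] u = Some (rx, y)" by (cases a) auto
    show ?thesis
    proof (cases "unpair [] (rev rx)")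
      case None
      have "runs (main_prog strict) (init_regs u) (1000 * Suc n * Suc n) None"
        unfolding main_prog_def
        by (rule runs_weaken[OF runs_Seq_None[OF runs_input_None2[OF 1 None]]])
          (use T in \<open>simp_all add: n_def\<close>)
      then show ?thesis using 1 None by (auto simp: mainf_def n_def)
    next
      case (Some b)
      then obtain rw um where 2: "unpair [] (rev rx) = Some (rw, um)" by (cases b) auto
      obtain x where x: "rx = rev x" "u = word_pair x y" using unpair_SomeD[OF 1] by auto
      obtain w where w: "rw = rev w" "x = word_pair w um" using unpair_SomeD[OF 2] x by auto
      have sz: "length y \<le> n" "length um \<le> n" "length w \<le> n"
        unfolding n_def x(2) w(2) by (auto simp: word_pair_def length_concat comp_def sum_list_triv)
      define s1 :: regs where "s1 = (\<lambda>_. [])(0 := y, 1 := rev um, 3 := rw, 7 := [False])"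
      have fr: "runs read_input (init_regs u) (200 * Suc n) (Some s1)"
        using runs_input[OF 1 2] by (simp add: n_def s1_def)
      have s1: "s1 1 = rev um" "s1 5 = unary []" "s1 7 = [False]" "s1 9 = []" "s1 4 = []" "s1 6 = []"
        "length (rev um) + length (unary []) = length um" "s1 0 = y"
        by (auto simp: s1_def)
      have st: "runs (While 1 stage) s1 (200 * (Suc n * n) + 1)
        (map_option (\<lambda>(vs', ys, p'). s1(0 := ys, 1 := [], 5 := unary vs', 7 := [p']))
          (stagef (blocks (rev um)) [] (s1 0) False))"
      proof (rule runs_weaken[OF runs_stages[OF s1(1-7)]])
        have "Suc (length um) * length um \<le> Suc n * n" using sz(2) by (intro mult_le_mono) auto
        then show "200 * Suc (length um) * length (rev um) + 1 \<le> 200 * (Suc n * n) + 1"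
          by (simp add: algebra_simps)
      qed simp
      show ?thesis
      proof (cases "stagef (blocks (rev um)) [] y False")
        case None
        then have st: "runs (While 1 stage) s1 (200 * (Suc n * n) + 1) None" using st s1(8) by simp
        have "runs (main_prog strict) (init_regs u) (1000 * Suc n * Suc n) None"
          unfolding main_prog_def
          by (rule runs_weaken[OF runs_Seq[OF fr runs_Seq_None[OF st]]]) (use T in simp_all)
        then show ?thesis using 1 2 None by (auto simp: mainf_def n_def)
      next
        case (Some c)
        then obtain vs ys p where 3: "stagef (blocks (rev um)) [] y False = Some (vs, ys, p)"
          by (cases c) auto
        define s2 where "s2 = s1(0 := ys, 1 := [], 5 := unary vs, 7 := [p])"
        have sz3: "length (unary vs) \<le> n" "length ys \<le> n"
          using stagef_size[OF 3] sz by (auto simp: blocks_size)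
        have st: "runs (While 1 stage) s1 (200 * (Suc n * n) + 1) (Some s2)"
          using st 3 s1(8) by (simp add: s2_def)
        have s2: "s2 5 = unary vs" "s2 9 = []" "s2 0 = ys" "s2 8 = []" by (auto simp: s2_def s1_def)
        have co: "runs (While 5 (coarsen_step strict)) s2 (100 * n + 1)
          (map_option (\<lambda>(z, ys). s2(0 := ys, 5 := [], 8 := z)) (coarsenf strict vs (s2 0) (s2 8)))"
          by (rule runs_weaken[OF runs_coarsen[OF s2(1,2)]]) (use sz3 in auto)
        show ?thesis
        proof (cases "coarsenf strict vs ys []")
          case None
          then have co: "runs (While 5 (coarsen_step strict)) s2 (100 * n + 1) None" using co s2 by simp
          have "runs (main_prog strict) (init_regs u) (1000 * Suc n * Suc n) None"
            unfolding main_prog_def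
            by (rule runs_weaken[OF runs_Seq[OF fr runs_Seq[OF st runs_Seq_None[OF co]]]]) (use T in simp_all)
          then show ?thesis using 1 2 3 None by (auto simp: mainf_def n_def)
        next
          case (Some d)
          then obtain z y' where 4: "coarsenf strict vs ys [] = Some (z, y')" by (cases d) auto
          define s3 where "s3 = s2(0 := y', 5 := [], 8 := z)"
          have sz4: "length z \<le> n" "length y' \<le> n" using coarsenf_size[OF 4] sz3 by auto
          have co: "runs (While 5 (coarsen_step strict)) s2 (100 * n + 1) (Some s3)"
            using co 4 s2 by (simp add: s3_def)
          show ?thesis
          proof (cases "z = [] \<or> \<not> hd z")
            case False
            have bk: "runs write_output s3 5 None" by (rule runs_output_None[OF False]) (simp add: s3_def)
            have "runs (main_prog strict) (init_regs u) (1000 * Suc n * Suc n) None"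
              unfolding main_prog_def
              by (rule runs_weaken[OF runs_Seq[OF fr runs_Seq[OF st runs_Seq[OF co bk]]]]) (use T in simp_all)
            then show ?thesis using 1 2 3 4 False by (auto simp: mainf_def n_def)
          next
            case True
            obtain s' where s': "runs write_output s3 (200 * Suc n) (Some s')" "s' 7 = s3 7"
                "s' 10 = word_pair (word_pair w (rev z)) y'"
              using runs_output[OF True, of s3 y' w n] sz sz4 w(1)
              by (auto simp: s3_def s2_def s1_def)
            have "runs (main_prog strict) (init_regs u) (1000 * Suc n * Suc n) (Some s')"
              unfolding main_prog_def
              by (rule runs_weaken[OF runs_Seq[OF fr runs_Seq[OF st runs_Seq[OF co s'(1)]]]]) (use T in simp_all)
            moreover have "s' 7 = [p]" using s'(2) by (simp add: s3_def s2_def)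
            moreover have "mainf strict u = Some (p, word_pair (word_pair w (rev z)) y')"
              using 1 2 3 4 True w(1) by (simp add: mainf_def)
            ultimately show ?thesis using s'(3) by (auto simp: n_def)
          qed
        qed
      qed
    qed
  qed
qed

lemma main_prog_regs: "reg_set (main_prog strict) \<subseteq> {..10}"
  by (auto simp: main_prog_def read_input_def write_output_def parse_def mv_def each_def stage_def ones_def
      pass_step_def read_bit_def flip_def coarsen_step_def double_to_def quadruple_to_def)

theorem PTIME_mainf:
  assumes "\<And>b. L b \<in> PTIME"
  shows "{u. \<exists>p z. mainf strict u = Some (p, z) \<and> z \<in> L p} \<in> PTIME"
proof (rule PTIME_reduction[where V = 7 and Z = 10 and p = "[:1000, 2000, 1000:]", OF assms main_prog_regs])
  fix u
  obtain out where "runs (main_prog strict) (init_regs u) (1000 * Suc (length u) * Suc (length u)) out"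
    and r: "case mainf strict u of None \<Rightarrow> out = None
     | Some (p, z) \<Rightarrow> \<exists>s. out = Some s \<and> s 7 = [p] \<and> s 10 = z"
    using runs_main_prog by blast
  then obtain t where t: "t \<le> 1000 * Suc (length u) * Suc (length u)" "exec (main_prog strict) (init_regs u) t out"
    unfolding runs_def by blast
  \<comment> \<open>The coefficients are those of \<open>1000 * (n + 1)^2\<close>.\<close>
  have "t \<le> poly [:1000, 2000, 1000:] (length u)" using t(1) by (simp add: algebra_simps)
  moreover have "u \<in> {u. \<exists>p z. mainf strict u = Some (p, z) \<and> z \<in> L p} \<longleftrightarrow> accepting 7 10 L out"
    using r by (auto simp: accepting_def split: option.splits)
  ultimately show "\<exists>t\<le>poly [:1000, 2000, 1000:] (length u). \<exists>out. exec (main_prog strict) (init_regs u) t out \<and>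
      (u \<in> {u. \<exists>p z. mainf strict u = Some (p, z) \<and> z \<in> L p}) = accepting 7 10 L out"
    using t(2) by blast
qed simp

section \<open>Imposing the length bound on witnesses\<close>

definition tally :: "nat \<Rightarrow> nat \<Rightarrow> nat \<Rightarrow> com" where
  "tally a b c = each a (Push b False ;; Push c True) (Push b True ;; Push c True)"

definition tally_double :: "nat \<Rightarrow> nat \<Rightarrow> nat \<Rightarrow> com" where
  "tally_double a b c = each a (Push b False ;; Push b False ;; Push c True)
     (Push b True ;; Push b True ;; Push c True)"

lemma runs_tally:
  assumes "a \<noteq> b" "a \<noteq> c" "b \<noteq> c"
  shows "runs (tally a b c) s (30 * Suc (length (s a)))
    (Some (s(a := [], b := rev (s a) @ s b, c := replicate (length (s a)) True @ s c)))"
proof -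
  have "den (if x then Push b True ;; Push c True else Push b False ;; Push c True) s =
      Some (s(b := [x] @ s b, c := [True] @ s c))" for x s using assms by (cases x) simp_all
  from runs_each2[OF assms this, of 30 s] show ?thesis
    by (simp add: tally_def concat_singletons map_replicate_const)
qed

lemma runs_tally_double:
  assumes "a \<noteq> b" "a \<noteq> c" "b \<noteq> c"
  shows "runs (tally_double a b c) s (30 * Suc (length (s a)))
    (Some (s(a := [], b := concat (map (\<lambda>x. [x, x]) (rev (s a))) @ s b,
      c := replicate (length (s a)) True @ s c)))"
proof -
  have "den (if x then Push b True ;; Push b True ;; Push c True
      else Push b False ;; Push b False ;; Push c True) s =
      Some (s(b := [x, x] @ s b, c := [True] @ s c))" for x s using assms by (cases x) simp_all
  from runs_each2[OF assms this, of 30 s] show ?thesis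
    by (simp add: tally_double_def map_replicate_const)
qed

section \<open>Evaluating a polynomial in unary\<close>

definition multiply_step :: com where
  "multiply_step = Pop 5 ;; tally 4 7 6 ;; mv 7 4"

lemma runs_multiply:
  assumes "s 4 = replicate N True" "s 5 = replicate m True" "s 7 = []"
  shows "runs (While 5 multiply_step) s ((60 * Suc N) * m + 1)
    (Some (s(5 := [], 6 := replicate (m * N) True @ s 6)))"
  using assms
proof (induction m arbitrary: s)
  case 0
  then show ?case by (intro runs_weaken[OF runs_While_End]) (auto simp: fun_eq_iff)
next
  case (Suc m)
  define s1 where "s1 = s(5 := replicate m True)"
  define s2 where "s2 = s1(4 := [], 7 := replicate N True, 6 := replicate N True @ s 6)"
  define s3 where "s3 = s(5 := replicate m True, 6 := replicate N True @ s 6)"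
  have 1: "runs (Pop 5) s 1 (Some s1)"
    by (rule runs_weaken[OF runs_den]) (use Suc.prems in \<open>auto simp: s1_def\<close>)
  have 2: "runs (tally 4 7 6) s1 (30 * Suc N) (Some s2)"
    by (rule runs_weaken[OF runs_tally]) (use Suc.prems in \<open>auto simp: s1_def s2_def fun_eq_iff\<close>)
  have 3: "runs (mv 7 4) s2 (20 * Suc N) (Some s3)"
    by (rule runs_weaken[OF runs_mv]) (use Suc.prems in \<open>auto simp: s1_def s2_def s3_def fun_eq_iff\<close>)
  have st: "runs multiply_step s (50 * Suc N + 3) (Some s3)"
    unfolding multiply_step_def by (rule runs_weaken[OF runs_Seq[OF 1 runs_Seq[OF 2 3]]]) auto
  have IH: "runs (While 5 multiply_step) s3 ((60 * Suc N) * m + 1)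
      (Some (s3(5 := [], 6 := replicate (m * N) True @ s3 6)))"
    using Suc.prems by (intro Suc.IH) (auto simp: s3_def)
  have ne: "s 5 \<noteq> []" using Suc.prems by simp
  show ?case
    by (rule runs_weaken[OF runs_While[of s 5, OF ne st IH]])
      (auto simp: s3_def fun_eq_iff replicate_add[symmetric] algebra_simps simp flip: append_assoc)
qed

fun push_ones :: "nat \<Rightarrow> com" where
  "push_ones 0 = Skip"
| "push_ones (Suc n) = Push 5 True ;; push_ones n"

lemma push_ones: "loop_free (push_ones n)" "cost (push_ones n) = 3 * n + 1"
    "den (push_ones n) s = Some (s(5 := replicate n True @ s 5))" "reg_set (push_ones n) \<subseteq> {5}"
proof -
  show "den (push_ones n) s = Some (s(5 := replicate n True @ s 5))"
    by (induction n arbitrary: s) (auto simp: replicate_app_Cons_same)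
qed (induction n; auto)+

text \<open>Horner's scheme: the value of \<open>pCons a p\<close> arises from that of
  \<open>p\<close> by one multiplication with \<open>N\<close> and \<open>a\<close> further ones.
  Register 4 keeps \<open>N\<close> throughout.\<close>

lemma ex_poly_com:
  fixes p :: "nat poly"
  shows "\<exists>c (T :: nat poly). reg_set c \<subseteq> {..7} \<and> (\<forall>s N. s 4 = replicate N True \<longrightarrow>
    s 5 = [] \<longrightarrow> s 6 = [] \<longrightarrow> s 7 = [] \<longrightarrow>
    runs c s (poly T N) (Some (s(5 := replicate (poly p N) True))))"
proof (induction p)
  case 0
  have "runs Skip s (poly 1 N) (Some (s(5 := replicate (poly 0 N) True)))" if "s 5 = []" for s N
    by (rule runs_weaken[OF runs_den]) (use that in \<open>auto simp: fun_eq_iff\<close>)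
  moreover have "reg_set Skip \<subseteq> {..7}" by simp
  ultimately show ?case by blast
next
  case (pCons a p)
  then obtain c and T :: "nat poly" where c: "reg_set c \<subseteq> {..7}"
    and r: "\<And>s N. s 4 = replicate N True \<Longrightarrow> s 5 = [] \<Longrightarrow> s 6 = [] \<Longrightarrow> s 7 = [] \<Longrightarrow>
      runs c s (poly T N) (Some (s(5 := replicate (poly p N) True)))" by blast
  let ?c = "c ;; While 5 multiply_step ;; mv 6 5 ;; push_ones a"
  \<comment> \<open>The summands pay for the recursive call, the multiplication loop, moving the
    product back to register 5, and pushing \<open>a\<close> ones.\<close>
  define U where "U = T + [:60, 60:] * p + [:20:] * (p * [:0, 1:]) + [:3 * a + 30:]"
  have "runs ?c s (poly U N) (Some (s(5 := replicate (poly (pCons a p) N) True)))"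
    if s: "s 4 = replicate N True" "s 5 = []" "s 6 = []" "s 7 = []" for s N
  proof -
    define s1 where "s1 = s(5 := replicate (poly p N) True)"
    define s2 where "s2 = s1(5 := [], 6 := replicate (poly p N * N) True)"
    define s3 where "s3 = s(5 := replicate (poly p N * N) True)"
    have 1: "runs c s (poly T N) (Some s1)" using r[OF s] by (simp add: s1_def)
    have 2: "runs (While 5 multiply_step) s1 ((60 * Suc N) * poly p N + 1) (Some s2)"
      by (rule runs_weaken[OF runs_multiply]) (use s in \<open>auto simp: s1_def s2_def\<close>)
    have 3: "runs (mv 6 5) s2 (20 * Suc (poly p N * N)) (Some s3)"
      by (rule runs_weaken[OF runs_mv]) (use s in \<open>auto simp: s1_def s2_def s3_def fun_eq_iff\<close>)
    have 4: "runs (push_ones a) s3 (3 * a + 1) (Some (s(5 := replicate (poly (pCons a p) N) True)))"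
      by (rule runs_weaken[OF runs_den])
        (auto simp: push_ones s3_def fun_eq_iff replicate_add[symmetric] mult.commute)
    show ?thesis
      by (rule runs_weaken[OF runs_Seq[OF 1 runs_Seq[OF 2 runs_Seq[OF 3 4]]]])
        (simp_all add: U_def algebra_simps)
  qed
  moreover have "reg_set ?c \<subseteq> {..7}"
    using c push_ones(4)[of a] by (auto simp: multiply_step_def tally_def mv_def each_def)
  ultimately show ?case by blast
qed

definition compare_step :: com where
  "compare_step = Pop 3 ;; Case 5 Fail (Pop 5) (Pop 5)"

text \<open>Two unary numbers are cancelled against each other, and the run fails exactly if
  register 5 is exhausted first. The existential stands for what is left over there.\<close>

lemma runs_compare:
  assumes "s 3 = replicate m True" "s 5 = replicate k True"
  shows "\<exists>s'. runs (While 3 compare_step) s (10 * m + 7)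
    (if m \<le> k then Some (s(3 := [], 5 := s')) else None)"
  using assms
proof (induction m arbitrary: s k)
  case 0
  then show ?case
    by (intro exI[of _ "s 5"] runs_weaken[OF runs_While_End]) (auto simp: fun_eq_iff)
next
  case (Suc m)
  show ?case
  proof (cases k)
    case 0
    have "runs (While 3 compare_step) s (10 * Suc m + 7) None"
      by (rule runs_WhileI_None) (use Suc.prems 0 in \<open>auto simp: compare_step_def\<close>)
    then show ?thesis using 0 by auto
  next
    case (Suc k')
    define s1 where "s1 = s(3 := replicate m True, 5 := replicate k' True)"
    have "s1 3 = replicate m True" "s1 5 = replicate k' True" by (simp_all add: s1_def)
    then obtain s' where IH: "runs (While 3 compare_step) s1 (10 * m + 7)
        (if m \<le> k' then Some (s1(3 := [], 5 := s')) else None)"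
      using Suc.IH by blast
    have dn: "den compare_step s = Some s1"
      using Suc.prems Suc by (auto simp: compare_step_def s1_def)
    have "runs (While 3 compare_step) s (10 * Suc m + 7)
        (if Suc m \<le> k then Some (s(3 := [], 5 := s')) else None)"
      by (rule runs_WhileI[OF _ _ dn IH])
        (use Suc.prems Suc in \<open>auto simp: s1_def compare_step_def fun_eq_iff\<close>)
    then show ?thesis by blast
  qed
qed

lemma length_word_pair: "length (word_pair x y) = 2 * length x + 2 + length y"
  by (induction x) (auto simp: word_pair_def)

lemma word_pair_inj: "word_pair x y = word_pair x' y' \<longleftrightarrow> x = x' \<and> y = y'"
  by (metis append_Nil2 option.inject prod.inject rev_rev_ident unpair_word_pair)

theorem ptime_relation_bounded:
  fixes p :: "nat poly"
  assumes "ptime_relation R"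
  shows "ptime_relation {(x, y) \<in> R. length y \<le> poly p (length x)}"
proof -
  obtain c and T :: "nat poly" where c: "reg_set c \<subseteq> {..7}"
    and r: "\<And>s N. s 4 = replicate N True \<Longrightarrow> s 5 = [] \<Longrightarrow> s 6 = [] \<Longrightarrow> s 7 = [] \<Longrightarrow>
      runs c s (poly T N) (Some (s(5 := replicate (poly p N) True)))"
    using ex_poly_com[of p] by blast
  \<comment> \<open>The word is reassembled in register 10 for the decider of \<open>R\<close>,
    while the lengths of \<open>y\<close> and \<open>x\<close> are tallied in registers 3 and 4. The
    final push makes register 8 nonempty, the signal to start the decider; both bits select the same
    language.\<close>
  define P where "P = parse 0 1 ;; mv 0 2 ;; tally 2 10 3 ;; (Push 10 True ;; Push 10 False) ;;
    tally_double 1 10 4 ;; c ;; While 3 compare_step ;; Push 8 False"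
  define L where "L = {word_pair x y | x y. (x, y) \<in> R}"
  define L' where "L' = {word_pair x y | x y. (x, y) \<in> {(x, y) \<in> R. length y \<le> poly p (length x)}}"
  have L: "L \<in> PTIME" using assms by (simp add: ptime_relation_def L_def)
  define U where "U = T + [:300, 300:]"
  have "L' \<in> PTIME"
  proof (rule PTIME_reduction[where L = "\<lambda>_. L" and P = P and V = 8 and Z = 10 and p = U])
    show "reg_set P \<subseteq> {..10}"
    proof -
      have "{..7::nat} \<subseteq> {..10}" by auto
      with c have "reg_set c \<subseteq> {..10}" by (rule subset_trans)
      then show ?thesis
        by (auto simp: P_def parse_def mv_def tally_def tally_double_def each_def compare_step_def)
    qed
  next
    fix u
    let ?e = "(\<lambda>_. []) :: regs"
    have "\<exists>out. runs P (init_regs u) (poly U (length u)) out \<and> (u \<in> L' \<longleftrightarrow> accepting 8 10 (\<lambda>_. L) out)"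
    proof (cases "unpair [] u")
      case None
      have 1: "runs (parse 0 1) (init_regs u) (40 * Suc (length u)) None"
        by (rule runs_weaken[OF runs_parse]) (use None in \<open>auto simp: init_regs_def\<close>)
      have "runs P (init_regs u) (poly U (length u)) None"
        unfolding P_def by (rule runs_weaken[OF runs_Seq_None[OF 1]]) (auto simp: U_def)
      moreover have "u \<notin> L'" using None by (auto simp: L'_def unpair_word_pair)
      ultimately show ?thesis by (auto simp: accepting_def)
    next
      case (Some r')
      then obtain rx y where up: "unpair [] u = Some (rx, y)" by (cases r') auto
      then obtain x where x: "rx = rev x" "u = word_pair x y" using unpair_SomeD by fastforce
      have len: "length u = 2 * length x + 2 + length y" by (simp add: x length_word_pair)
      define s5 where "s5 = ?e(3 := replicate (length y) True, 4 := replicate (length x) True, 10 := u)"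
      have 1: "runs (parse 0 1) (init_regs u) (40 * Suc (length u)) (Some (?e(0 := y, 1 := rev x)))"
        by (rule runs_weaken[OF runs_parse]) (use up x in \<open>auto simp: init_regs_def fun_eq_iff\<close>)
      have 2: "runs (mv 0 2) (?e(0 := y, 1 := rev x)) (20 * Suc (length u))
          (Some (?e(1 := rev x, 2 := rev y)))"
        by (rule runs_weaken[OF runs_mv]) (use len in \<open>auto simp: fun_eq_iff\<close>)
      have 3: "runs (tally 2 10 3) (?e(1 := rev x, 2 := rev y)) (30 * Suc (length u))
          (Some (?e(1 := rev x, 3 := replicate (length y) True, 10 := y)))"
        by (rule runs_weaken[OF runs_tally]) (use len in \<open>auto simp: fun_eq_iff\<close>)
      have 4: "runs (Push 10 True ;; Push 10 False) (?e(1 := rev x, 3 := replicate (length y) True, 10 := y)) 5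
          (Some (?e(1 := rev x, 3 := replicate (length y) True, 10 := [False, True] @ y)))"
        by (rule runs_weaken[OF runs_den]) (auto simp: fun_eq_iff)
      have 5: "runs (tally_double 1 10 4) (?e(1 := rev x, 3 := replicate (length y) True, 10 := [False, True] @ y))
          (30 * Suc (length u)) (Some s5)"
        by (rule runs_weaken[OF runs_tally_double])
          (use len in \<open>auto simp: s5_def fun_eq_iff x(2) word_pair_def\<close>)
      have 6: "runs c s5 (poly T (length u)) (Some (s5(5 := replicate (poly p (length x)) True)))"
        by (rule runs_weaken[OF r]) (use len in \<open>auto simp: s5_def intro!: poly_nat_mono\<close>)
      obtain s' where 7: "runs (While 3 compare_step) (s5(5 := replicate (poly p (length x)) True))
          (10 * length y + 7)
          (if length y \<le> poly p (length x)
           then Some (s5(5 := replicate (poly p (length x)) True, 3 := [], 5 := s')) else None)"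
        using runs_compare[of "s5(5 := replicate (poly p (length x)) True)" "length y" "poly p (length x)"]
        by (auto simp: s5_def)
      have uL: "u \<in> L' \<longleftrightarrow> u \<in> L \<and> length y \<le> poly p (length x)"
        unfolding L'_def L_def x(2) by (auto simp: word_pair_inj)
      have T: "40 * Suc (length u) + 20 * Suc (length u) + 30 * Suc (length u) + 5 + 30 * Suc (length u) +
          (poly T (length u) + (10 * length y + 7)) + 20 \<le> poly U (length u)"
        using len by (simp add: U_def algebra_simps)
      show ?thesis
      proof (cases "length y \<le> poly p (length x)")
        case True
        define s6 where "s6 = s5(5 := replicate (poly p (length x)) True, 3 := [], 5 := s')"
        have 7: "runs (While 3 compare_step) (s5(5 := replicate (poly p (length x)) True))
          (10 * length y + 7) (Some s6)" using 7 True by (simp add: s6_def)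
        have 8: "runs (Push 8 False) s6 2 (Some (s6(8 := [False])))"
          by (rule runs_weaken[OF runs_den]) (auto simp: s6_def s5_def)
        have "runs P (init_regs u) (poly U (length u)) (Some (s6(8 := [False])))"
          unfolding P_def
          by (rule runs_weaken[OF runs_Seq[OF 1 runs_Seq[OF 2 runs_Seq[OF 3 runs_Seq[OF 4 runs_Seq[OF 5
            runs_Seq[OF 6 runs_Seq[OF 7 8]]]]]]]]) (use T in auto)
        moreover have "accepting 8 10 (\<lambda>_. L) (Some (s6(8 := [False]))) \<longleftrightarrow> u \<in> L"
          by (auto simp: accepting_def s6_def s5_def)
        ultimately show ?thesis using uL True by blast
      next
        case False
        have 7: "runs (While 3 compare_step) (s5(5 := replicate (poly p (length x)) True))
          (10 * length y + 7) None" using 7 False by simp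
        have "runs P (init_regs u) (poly U (length u)) None"
          unfolding P_def
          by (rule runs_weaken[OF runs_Seq[OF 1 runs_Seq[OF 2 runs_Seq[OF 3 runs_Seq[OF 4 runs_Seq[OF 5
            runs_Seq[OF 6 runs_Seq_None[OF 7]]]]]]]]) (use T in auto)
        then show ?thesis using uL False by (auto simp: accepting_def)
      qed
    qed
    then show "\<exists>t\<le>poly U (length u). \<exists>out. exec P (init_regs u) t out \<and>
        (u \<in> L') = accepting 8 10 (\<lambda>_. L) out"
      unfolding runs_def by blast
  qed (use L in auto)
  then show ?thesis by (simp add: ptime_relation_def L'_def)
qed

section \<open>Counting accepted witnesses\<close>

text \<open>Signed sum over all bit strings of a pass, in continuation style so that passes can be
  nested. The minus sign is that of \<open>- x_j\<close> in the factor
  \<open>x_i - x_j\<close>.\<close>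

fun pass_sum :: "nat \<Rightarrow> nat list \<Rightarrow> (nat \<Rightarrow> nat list \<Rightarrow> int) \<Rightarrow> int" where
  "pass_sum l [] F = F l []"
| "pass_sum l (v # vs) F = pass_sum l vs (\<lambda>l' vs'. F l' (v # vs')) -
     (if v = 0 then 0 else pass_sum (Suc l) vs (\<lambda>l' vs'. F l' ((v - 1) # vs')))"

fun stage_sum :: "nat list \<Rightarrow> nat list \<Rightarrow> (nat list \<Rightarrow> int) \<Rightarrow> int" where
  "stage_sum [] vs F = F vs"
| "stage_sum (l # ls) vs F = pass_sum l vs (\<lambda>l' vs'. stage_sum ls (l' # vs') F)"

fun coarsen_sum :: "bool \<Rightarrow> nat list \<Rightarrow> bool list \<Rightarrow> (bool list \<Rightarrow> int) \<Rightarrow> int" where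
  "coarsen_sum strict [] z F = F z"
| "coarsen_sum strict (v # vs) z F = (if v = 0 then coarsen_sum strict vs z F else
     coarsen_sum strict vs (False # replicate v True @ z) F +
     (if strict then 0 else coarsen_sum strict vs (replicate v True @ z) F))"

text \<open>\<open>K\<close> tells which remaining witnesses are admissible after the pass, so that
  these sets nest just as the sums do.\<close>

definition pass_set :: "nat \<Rightarrow> nat list \<Rightarrow> bool \<Rightarrow> (nat \<Rightarrow> nat list \<Rightarrow> bool \<Rightarrow> bool list set) \<Rightarrow> bool list set" where
  "pass_set l vs p K = {ys. \<exists>l' vs' ys' p'. passf l vs ys p = Some (l', vs', ys', p') \<and> ys' \<in> K l' vs' p'}"

lemma pass_set_Nil: "pass_set l [] p K = K l [] p"
  by (simp add: pass_set_def)

lemma pass_set_Cons: "pass_set l (v # vs) p K =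
    (#) False ` pass_set l vs p (\<lambda>l' vs'. K l' (v # vs')) \<union>
    (if v = 0 then {} else (#) True ` pass_set (Suc l) vs (\<not> p) (\<lambda>l' vs'. K l' ((v - 1) # vs')))"
    (is "?L = ?R")
proof (rule Set.set_eqI)
  fix ys
  show "ys \<in> ?L \<longleftrightarrow> ys \<in> ?R"
  proof (cases ys)
    case Nil
    then show ?thesis by (auto simp: pass_set_def)
  next
    case (Cons b ys')
    show ?thesis
    proof (cases b)
      case True
      with Cons show ?thesis
        by (cases "passf (Suc l) vs ys' (\<not> p)") (auto simp: pass_set_def image_iff)
    next
      case False
      with Cons show ?thesis by (cases "passf l vs ys' p") (auto simp: pass_set_def image_iff)
    qed
  qed
qed

lemma finite_pass_set: "(\<And>l vs p. finite (K l vs p)) \<Longrightarrow> finite (pass_set l vs p K)"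
  by (induction vs arbitrary: l p K) (auto simp: pass_set_Nil pass_set_Cons)

lemma card_pass_set_Cons:
  assumes "\<And>l vs p. finite (K l vs p)"
  shows "card (pass_set l (v # vs) p K) = card (pass_set l vs p (\<lambda>l' vs'. K l' (v # vs'))) +
    (if v = 0 then 0 else card (pass_set (Suc l) vs (\<not> p) (\<lambda>l' vs'. K l' ((v - 1) # vs'))))"
  unfolding pass_set_Cons
  by (subst card_Un_disjoint) (auto simp: card_image finite_pass_set assms)

text \<open>A set bit exchanges the two signs, so the difference of the counts for the two starting
  signs obeys the recursion of \<open>pass_sum\<close>, including its minus.\<close>

lemma card_pass_set:
  assumes "\<And>l vs p. finite (K l vs p)"
  shows "int (card (pass_set l vs False K)) - int (card (pass_set l vs True K)) =
    pass_sum l vs (\<lambda>l' vs'. int (card (K l' vs' False)) - int (card (K l' vs' True)))"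
  using assms
proof (induction vs arbitrary: l K)
  case Nil
  then show ?case by (simp add: pass_set_Nil)
next
  case (Cons v vs)
  have "int (card (pass_set l vs False (\<lambda>l' vs'. K l' (v # vs')))) -
      int (card (pass_set l vs True (\<lambda>l' vs'. K l' (v # vs')))) =
      pass_sum l vs (\<lambda>l' vs'. int (card (K l' (v # vs') False)) - int (card (K l' (v # vs') True)))"
    by (rule Cons.IH) (rule Cons.prems)
  moreover have "int (card (pass_set (Suc l) vs False (\<lambda>l' vs'. K l' ((v - 1) # vs')))) -
      int (card (pass_set (Suc l) vs True (\<lambda>l' vs'. K l' ((v - 1) # vs')))) =
      pass_sum (Suc l) vs (\<lambda>l' vs'. int (card (K l' ((v - 1) # vs') False)) - int (card (K l' ((v - 1) # vs') True)))"
    by (rule Cons.IH) (rule Cons.prems)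
  ultimately show ?case by (cases "v = 0") (auto simp: card_pass_set_Cons[OF Cons.prems])
qed

text \<open>The sign is only ever flipped, so starting with the opposite one amounts to negating it
  at the end.\<close>

lemma pass_set_Not: "pass_set l vs (\<not> p) K = pass_set l vs p (\<lambda>l vs p. K l vs (\<not> p))"
  by (induction vs arbitrary: l p K) (simp_all add: pass_set_Nil pass_set_Cons)

definition stage_set :: "nat list \<Rightarrow> nat list \<Rightarrow> bool \<Rightarrow> (nat list \<Rightarrow> bool \<Rightarrow> bool list set) \<Rightarrow> bool list set" where
  "stage_set ls vs p K = {ys. \<exists>vs' ys' p'. stagef ls vs ys p = Some (vs', ys', p') \<and> ys' \<in> K vs' p'}"

lemma stage_set_Nil: "stage_set [] vs p K = K vs p"
  by (simp add: stage_set_def)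

lemma stage_set_Cons: "stage_set (l # ls) vs p K = pass_set l vs p (\<lambda>l' vs' p'. stage_set ls (l' # vs') p' K)"
  by (fastforce simp: stage_set_def pass_set_def split: option.splits)

lemma finite_stage_set: "(\<And>vs p. finite (K vs p)) \<Longrightarrow> finite (stage_set ls vs p K)"
  by (induction ls arbitrary: vs p) (simp_all add: stage_set_Nil stage_set_Cons finite_pass_set)

lemma card_stage_set:
  assumes "\<And>vs p. finite (K vs p)"
  shows "int (card (stage_set ls vs False K)) - int (card (stage_set ls vs True K)) =
    stage_sum ls vs (\<lambda>vs'. int (card (K vs' False)) - int (card (K vs' True)))"
  by (induction ls arbitrary: vs)
    (simp_all add: stage_set_Nil stage_set_Cons card_pass_set finite_stage_set assms)

lemma stage_set_Not: "stage_set ls vs (\<not> p) K = stage_set ls vs p (\<lambda>vs p. K vs (\<not> p))"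
proof (induction ls arbitrary: vs p)
  case (Cons l ls)
  then show ?case by (simp only: stage_set_Cons pass_set_Not)
qed (simp add: stage_set_Nil)

definition coarsen_set :: "bool \<Rightarrow> nat list \<Rightarrow> bool list \<Rightarrow> (bool list \<Rightarrow> bool list set) \<Rightarrow> bool list set" where
  "coarsen_set strict vs z K = {ys. \<exists>z' ys'. coarsenf strict vs ys z = Some (z', ys') \<and> ys' \<in> K z'}"

lemma coarsen_set_Nil: "coarsen_set strict [] z K = K z"
  by (simp add: coarsen_set_def)

lemma coarsen_set_Cons: "coarsen_set strict (v # vs) z K = (if v = 0 then coarsen_set strict vs z K else
    (#) True ` coarsen_set strict vs (False # replicate v True @ z) K \<union>
    (if strict then {} else (#) False ` coarsen_set strict vs (replicate v True @ z) K))"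
    (is "?L = ?R")
proof (rule Set.set_eqI)
  fix ys
  show "ys \<in> ?L \<longleftrightarrow> ys \<in> ?R"
  proof (cases ys)
    case Nil
    then show ?thesis by (auto simp: coarsen_set_def)
  next
    case (Cons b ys')
    then show ?thesis by (cases b) (auto simp: coarsen_set_def)
  qed
qed

lemma finite_coarsen_set: "(\<And>z. finite (K z)) \<Longrightarrow> finite (coarsen_set strict vs z K)"
  by (induction vs arbitrary: z) (auto simp: coarsen_set_Nil coarsen_set_Cons)

lemma card_coarsen_set:
  assumes "\<And>z. finite (K z)"
  shows "int (card (coarsen_set strict vs z K)) = coarsen_sum strict vs z (\<lambda>z. int (card (K z)))"
proof (induction vs arbitrary: z)
  case (Cons v vs)
  have "card (coarsen_set strict (v # vs) z K) = (if v = 0 then card (coarsen_set strict vs z K) else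
    card (coarsen_set strict vs (False # replicate v True @ z) K) +
    (if strict then 0 else card (coarsen_set strict vs (replicate v True @ z) K)))"
    unfolding coarsen_set_Cons
    by (auto simp: card_image finite_coarsen_set assms intro!: card_Un_disjoint[THEN trans])
  then show ?case using Cons by (cases strict) simp_all
qed (simp add: coarsen_set_Nil)

lemma coarsen_sum_diff:
  "coarsen_sum strict vs z F - coarsen_sum strict vs z G = coarsen_sum strict vs z (\<lambda>z. F z - G z)"
  by (induction vs arbitrary: z) (auto simp: algebra_simps)

section \<open>Length of the witnesses\<close>

lemma passf_length: "passf l vs ys p = Some (l', vs', ys', p') \<Longrightarrow>
    length ys = length ys' + length vs \<and> length vs' = length vs"
  by (induction l vs ys p arbitrary: l' vs' rule: passf.induct) (fastforce split: if_splits)+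

text \<open>Each pass reads one bit per part already processed, of which there are at most
  \<open>length ls + length vs\<close>; this crude product stands in for a triangular
  number.\<close>

lemma stagef_length: "stagef ls vs ys p = Some (vs', ys', p') \<Longrightarrow>
    length ys \<le> length ys' + length ls * (length ls + length vs) \<and> length vs' = length ls + length vs"
proof (induction ls arbitrary: vs ys p)
  case (Cons l ls)
  then obtain l1 vs1 ys1 p1 where 1: "passf l vs ys p = Some (l1, vs1, ys1, p1)"
    "stagef ls (l1 # vs1) ys1 p1 = Some (vs', ys', p')"
    by (auto split: option.splits)
  from passf_length[OF 1(1)] Cons.IH[OF 1(2)] show ?case by simp
qed auto

lemma coarsenf_length: "coarsenf strict vs ys z = Some (z', ys') \<Longrightarrow> length ys \<le> length ys' + length vs"
  by (induction strict vs ys z arbitrary: z' ys' rule: coarsenf.induct)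
    (fastforce split: if_splits list.splits)+

lemma length_le_unary: "length vs \<le> length (unary vs)"
  by (induction vs) auto

text \<open>\<open>R\<close> depends on the sign, so that even and odd sets of pairs can be
  completed by witnesses of different relations.\<close>

definition lift_rel :: "bool \<Rightarrow> (bool \<Rightarrow> (bool list \<times> bool list) set) \<Rightarrow> (bool list \<times> bool list) set" where
  "lift_rel strict R = {(x, y). \<exists>p x' y'. mainf strict (word_pair x y) = Some (p, word_pair x' y') \<and> (x', y') \<in> R p}"

lemma ptime_lift_rel:
  assumes "\<And>b. ptime_relation (R b)"
  shows "ptime_relation (lift_rel strict R)"
proof -
  have "{word_pair x y | x y. (x, y) \<in> lift_rel strict R} =
    {u. \<exists>p z. mainf strict u = Some (p, z) \<and> z \<in> {word_pair x y | x y. (x, y) \<in> R p}}"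
  proof (rule Set.set_eqI, rule iffI)
    fix u assume "u \<in> {u. \<exists>p z. mainf strict u = Some (p, z) \<and> z \<in> {word_pair x y | x y. (x, y) \<in> R p}}"
    then obtain p x y where 1: "mainf strict u = Some (p, word_pair x y)" "(x, y) \<in> R p" by blast
    then obtain a where "unpair [] u = Some a" by (cases "unpair [] u") (auto simp: mainf_def)
    then obtain x' y' where "u = word_pair x' y'" using unpair_SomeD by (cases a) blast
    then show "u \<in> {word_pair x y | x y. (x, y) \<in> lift_rel strict R}"
      using 1 unfolding lift_rel_def by blast
  qed (auto simp: lift_rel_def)
  then show ?thesis
    using PTIME_mainf[of "\<lambda>p. {word_pair x y | x y. (x, y) \<in> R p}" strict] assms
    by (simp add: ptime_relation_def)
qed

text \<open>A bit string that merges the last nonzero part with a nonexistent successor leaves the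
  output open. Discarding it makes bit strings correspond one to one to coarsenings.\<close>

definition closed_output :: "bool list \<Rightarrow> bool" where
  "closed_output z \<longleftrightarrow> z = [] \<or> \<not> hd z"

lemma mainf_encode: "mainf strict (word_pair (encode (w, \<mu>)) y) =
   (case stagef (rev \<mu>) [] y False of None \<Rightarrow> None | Some (vs, ys, p) \<Rightarrow>
    (case coarsenf strict vs ys [] of None \<Rightarrow> None | Some (z, y') \<Rightarrow>
      if closed_output z then Some (p, word_pair (word_pair w (rev z)) y') else None))"
  by (auto simp: mainf_def encode_def unpair_word_pair blocks_rev_unary closed_output_def
      split: option.split)

lemma lift_rel_encode:
  "{y. (encode (w, \<mu>), y) \<in> lift_rel strict R} = stage_set (rev \<mu>) [] False (\<lambda>vs p.
     coarsen_set strict vs [] (\<lambda>z. {y. closed_output z \<and> (word_pair w (rev z), y) \<in> R p}))"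
proof (rule Set.set_eqI)
  fix y
  show "y \<in> {y. (encode (w, \<mu>), y) \<in> lift_rel strict R} \<longleftrightarrow> y \<in> stage_set (rev \<mu>) [] False (\<lambda>vs p.
     coarsen_set strict vs [] (\<lambda>z. {y. closed_output z \<and> (word_pair w (rev z), y) \<in> R p}))"
  proof (cases "stagef (rev \<mu>) [] y False")
    case None
    then show ?thesis by (simp add: lift_rel_def stage_set_def mainf_encode)
  next
    case (Some r)
    then obtain vs ys p where 1: "stagef (rev \<mu>) [] y False = Some (vs, ys, p)" by (cases r) auto
    show ?thesis
    proof (cases "coarsenf strict vs ys []")
      case None
      then show ?thesis using 1 by (simp add: lift_rel_def stage_set_def coarsen_set_def mainf_encode)
    next
      case (Some r')
      then obtain z y' where "coarsenf strict vs ys [] = Some (z, y')" by (cases r') auto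
      then show ?thesis
        using 1 by (simp add: lift_rel_def stage_set_def coarsen_set_def mainf_encode word_pair_inj)
    qed
  qed
qed

text \<open>The tail is bounded by \<open>q\<close>, the coarsening bits by the number of parts, and
  the bits for the pairs by its square. Monotonicity of \<open>q\<close> applies because the query
  is no longer than the input.\<close>

lemma lift_rel_length:
  fixes q :: "nat poly"
  assumes "(encode (w, \<mu>), y) \<in> lift_rel strict R" "\<And>p x y. (x, y) \<in> R p \<Longrightarrow> length y \<le> poly q (length x)"
  shows "length y \<le> poly (q + [:0, 1, 1:]) (length (encode (w, \<mu>)))"
proof -
  let ?N = "length (encode (w, \<mu>))"
  obtain vs ys p z y' where 1: "stagef (rev \<mu>) [] y False = Some (vs, ys, p)"
    "coarsenf strict vs ys [] = Some (z, y')" "(word_pair w (rev z), y') \<in> R p"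
  proof -
    have "y \<in> {y. (encode (w, \<mu>), y) \<in> lift_rel strict R}" using assms(1) by simp
    then show ?thesis
      using that unfolding lift_rel_encode stage_set_def coarsen_set_def by auto
  qed
  have N: "?N = 2 * length w + 2 + length (unary \<mu>)" by (simp add: encode_def length_word_pair)
  have lu: "length (unary (rev \<mu>)) = length (unary \<mu>)"
    by (simp add: unary_def length_concat rev_map[symmetric] sum_list_rev comp_def)
  have "length z \<le> length (unary \<mu>)"
    using stagef_size[OF 1(1)] coarsenf_size[OF 1(2)] lu by simp
  then have "length (word_pair w (rev z)) \<le> ?N" by (simp add: N length_word_pair)
  then have a: "length y' \<le> poly q ?N"
    by (rule le_trans[OF assms(2)[OF 1(3)] poly_nat_mono])
  have m: "length \<mu> \<le> ?N" using length_le_unary[of \<mu>] N by simp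
  have "length y \<le> length ys + length \<mu> * length \<mu>" "length vs = length \<mu>"
    using stagef_length[OF 1(1)] by auto
  moreover have "length ys \<le> length y' + length vs" using coarsenf_length[OF 1(2)] .
  moreover have "length \<mu> * length \<mu> \<le> ?N * ?N" using m by (intro mult_le_mono)
  ultimately have "length y \<le> poly q ?N + ?N + ?N * ?N" using a m by linarith
  then show ?thesis by (simp add: algebra_simps)
qed

theorem GapP_stage_sum:
  assumes "h \<in> GapP"
  shows "\<exists>h' \<in> GapP. \<forall>w \<mu>. h' (encode (w, \<mu>)) = stage_sum (rev \<mu>) [] (\<lambda>vs. coarsen_sum strict vs []
    (\<lambda>z. if closed_output z then h (word_pair w (rev z)) else 0))"
proof -
  obtain f g where fg: "f \<in> SharpP" "g \<in> SharpP" "\<And>x. h x = int (f x) - int (g x)"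
    using assms unfolding GapP_def by blast
  obtain R0 and p0 :: "nat poly" where R0: "ptime_relation R0"
    "\<forall>x. f x = card {y. length y \<le> poly p0 (length x) \<and> (x, y) \<in> R0}"
    using fg(1) unfolding SharpP_def mem_Collect_eq by (elim exE conjE)
  obtain R1 and p1 :: "nat poly" where R1: "ptime_relation R1"
    "\<forall>x. g x = card {y. length y \<le> poly p1 (length x) \<and> (x, y) \<in> R1}"
    using fg(2) unfolding SharpP_def mem_Collect_eq by (elim exE conjE)
  \<comment> \<open>With the length bounds inside the relations, the witness sets are finite and are
    counted in full.\<close>
  define R where "R b = (if b then {(x, y) \<in> R1. length y \<le> poly p1 (length x)}
    else {(x, y) \<in> R0. length y \<le> poly p0 (length x)})" for b
  have pR: "ptime_relation (R b)" for b
    using ptime_relation_bounded R0(1) R1(1) by (simp add: R_def)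
  have R_len: "length y \<le> poly (p0 + p1) (length x)" if "(x, y) \<in> R p" for p x y
    using that by (auto simp: R_def split: if_splits)
  have fin: "finite {y. (x, y) \<in> R p}" for x p
  proof (rule finite_subset)
    show "{y. (x, y) \<in> R p} \<subseteq> {y. set y \<subseteq> UNIV \<and> length y \<le> poly (p0 + p1) (length x)}"
      using R_len by auto
    show "finite {y :: bool list. set y \<subseteq> UNIV \<and> length y \<le> poly (p0 + p1) (length x)}"
      by (rule finite_lists_length_le) simp
  qed
  have hR: "h x = int (card {y. (x, y) \<in> R False}) - int (card {y. (x, y) \<in> R True})" for x
    unfolding fg(3) R0(2)[rule_format] R1(2)[rule_format] R_def by (simp add: conj_commute)
  define q where "q = p0 + p1 + [:0, 1, 1:]"
  \<comment> \<open>\<open>b\<close> exchanges the roles of the relations. For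
    \<open>b = False\<close> even sets of pairs are completed by witnesses of \<open>f\<close> and
    odd ones by witnesses of \<open>g\<close>; \<open>b = True\<close> yields the terms to be
    subtracted.\<close>
  define R' where "R' b = lift_rel strict (\<lambda>p. R (p \<noteq> b))" for b
  define f' where "f' b x = card {y. length y \<le> poly q (length x) \<and> (x, y) \<in> R' b}" for b x
  have "f' b \<in> SharpP" for b
    unfolding SharpP_def mem_Collect_eq
    by (intro exI[of _ "R' b"] exI[of _ q] conjI allI)
      (simp_all add: R'_def f'_def ptime_lift_rel[OF pR])
  then have "(\<lambda>x. int (f' False x) - int (f' True x)) \<in> GapP"
    unfolding GapP_def by blast
  moreover have "int (f' False (encode (w, \<mu>))) - int (f' True (encode (w, \<mu>))) =
      stage_sum (rev \<mu>) [] (\<lambda>vs. coarsen_sum strict vs []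
        (\<lambda>z. if closed_output z then h (word_pair w (rev z)) else 0))" for w \<mu>
  proof -
    define K where "K p z = {y. closed_output z \<and> (word_pair w (rev z), y) \<in> R p}" for p z
    have finK: "finite (K p z)" for p z using fin by (simp add: K_def)
    define KK where "KK vs p = coarsen_set strict vs [] (K p)" for vs p
    have finKK: "finite (KK vs p)" for vs p by (simp add: KK_def finite_coarsen_set finK)
    have *: "f' b (encode (w, \<mu>)) = card (stage_set (rev \<mu>) [] b KK)" for b
    proof -
      have "{y. length y \<le> poly q (length (encode (w, \<mu>))) \<and> (encode (w, \<mu>), y) \<in> R' b} =
          {y. (encode (w, \<mu>), y) \<in> R' b}"
        using lift_rel_length[of w \<mu> _ strict "\<lambda>p. R (p \<noteq> b)" "p0 + p1"] R_len
        unfolding q_def R'_def by blast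
      also have "\<dots> = stage_set (rev \<mu>) [] False (\<lambda>vs p. KK vs (p \<noteq> b))"
        unfolding R'_def lift_rel_encode KK_def K_def ..
      also have "\<dots> = stage_set (rev \<mu>) [] b KK"
        using stage_set_Not[of "rev \<mu>" "[]" False KK] by (cases b) auto
      finally show ?thesis by (simp add: f'_def)
    qed
    have "int (card (KK vs False)) - int (card (KK vs True)) = coarsen_sum strict vs []
        (\<lambda>z. if closed_output z then h (word_pair w (rev z)) else 0)" for vs
      unfolding KK_def card_coarsen_set[OF finK] coarsen_sum_diff
      by (rule arg_cong[of _ _ "coarsen_sum strict vs []"]) (auto simp: K_def hR)
    then show ?thesis unfolding * card_stage_set[OF finKK] by simp
  qed
  ultimately show ?thesis by (intro bexI[of _ "\<lambda>x. int (f' False x) - int (f' True x)"]) auto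
qed

section \<open>Raising operators and the Vandermonde product\<close>

abbreviation lookup where "lookup \<equiv> Poly_Mapping.lookup"
abbreviation single where "single \<equiv> Poly_Mapping.single"

lemma lookup_single_mult_sum:
  fixes g :: mpoly
  shows "lookup (single t c * g) k = c * (\<Sum>q. lookup g q when k = t + q)"
  unfolding lookup_mult lookup_single by (simp add: when_mult)

lemma lookup_single_mult_add:
  fixes g :: mpoly
  shows "lookup (single t c * g) (t + q) = c * lookup g q"
  unfolding lookup_single_mult_sum by simp

lemma lookup_var_mult_Suc:
  fixes g :: mpoly
  shows "lookup (var a * g) (single a 1 + e) = lookup g e"
  unfolding var_def by (simp add: lookup_single_mult_add)

lemma lookup_var_mult_0:
  fixes g :: mpoly
  assumes "lookup e a = 0"
  shows "lookup (var a * g) e = 0"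
proof -
  have "e \<noteq> single a 1 + q" for q
  proof
    assume "e = single a 1 + q"
    then have "lookup e a = 1 + lookup q a" by (simp add: lookup_add)
    then show False using assms by simp
  qed
  then show ?thesis unfolding var_def lookup_single_mult_sum by simp
qed

fun monom_at :: "nat \<Rightarrow> nat list \<Rightarrow> nat \<Rightarrow>\<^sub>0 nat" where
  "monom_at k [] = 0"
| "monom_at k (v # vs) = single k v + monom_at (Suc k) vs"

lemma lookup_monom_at:
  "lookup (monom_at k vs) i = (if k \<le> i \<and> i < k + length vs then vs ! (i - k) else 0)"
proof (induction vs arbitrary: k)
  case (Cons v vs)
  show ?case
  proof (cases "i = k")
    case True
    then show ?thesis using Cons[of "Suc k"] by (simp add: lookup_add)
  next
    case False
    then have "i - k = Suc (i - Suc k)" if "k \<le> i" using that by simp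
    then show ?thesis using False Cons by (auto simp: lookup_add lookup_single when_def)
  qed
qed simp

text \<open>One factor is expanded at a time: the term \<open>var a\<close> lowers the exponent at
  \<open>a\<close>, the term \<open>- var k\<close> the one at \<open>k\<close>, and the latter
  contributes 0 if that exponent is 0, which is the underflow. The exponent at \<open>a\<close>
  starts above \<open>l\<close> by the number of factors; every factor in which
  \<open>- var k\<close> is chosen leaves one unit of this surplus in place, and that is the raised
  unit.\<close>

lemma pass_sum_lookup:
  fixes g :: mpoly
  assumes "\<And>i. k \<le> i \<Longrightarrow> i < k + length vs \<Longrightarrow> lookup e i = 0" "a < k"
  shows "pass_sum l vs (\<lambda>l' vs'. lookup g (e + single a l' + monom_at k vs')) =
    lookup ((\<Prod>j<length vs. var a - var (k + j)) * g) (e + single a (l + length vs) + monom_at k vs)"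
  using assms
proof (induction vs arbitrary: l e k)
  case Nil
  then show ?case by simp
next
  case (Cons v vs)
  define h where "h = (\<Prod>j<length vs. var a - var (Suc k + j)) * g"
  have prod: "(\<Prod>j<length (v # vs). var a - var (k + j)) * g = var a * h - var k * h"
    unfolding h_def length_Cons prod.lessThan_Suc_shift by (simp add: algebra_simps)
  have IH: "pass_sum l vs (\<lambda>l' vs'. lookup g (e + single a l' + monom_at k (v # vs'))) =
      lookup h (e + single k v + single a (l + length vs) + monom_at (Suc k) vs)" for l v
  proof -
    have "pass_sum l vs (\<lambda>l' vs'. lookup g ((e + single k v) + single a l' + monom_at (Suc k) vs')) =
      lookup h ((e + single k v) + single a (l + length vs) + monom_at (Suc k) vs)"
      unfolding h_def using Cons.prems by (intro Cons.IH) (auto simp: lookup_add lookup_single)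
    then show ?thesis by (simp add: ac_simps)
  qed
  let ?E = "e + single a (l + length (v # vs)) + monom_at k (v # vs)"
  have sing: "single a (Suc n) = single a 1 + single a n" for a n :: nat
    by (simp add: single_add[symmetric])
  have 1: "lookup (var a * h) ?E = lookup h (e + single k v + single a (l + length vs) + monom_at (Suc k) vs)"
  proof -
    have "?E = single a 1 + (e + single k v + single a (l + length vs) + monom_at (Suc k) vs)"
      using sing[of a "l + length vs"] by (simp add: ac_simps)
    then show ?thesis by (simp only: lookup_var_mult_Suc)
  qed
  have 2: "lookup (var k * h) ?E = (if v = 0 then 0 else
      lookup h (e + single k (v - 1) + single a (Suc l + length vs) + monom_at (Suc k) vs))"
  proof (cases v)
    case 0
    then have "lookup ?E k = 0"
      using Cons.prems by (simp add: lookup_add lookup_single lookup_monom_at)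
    then show ?thesis using 0 lookup_var_mult_0[of ?E k h] by simp
  next
    case (Suc v')
    then have "?E = single k 1 + (e + single k v' + single a (Suc l + length vs) + monom_at (Suc k) vs)"
      using sing[of k v'] by (simp add: ac_simps)
    then show ?thesis using Suc by (simp only: lookup_var_mult_Suc) simp
  qed
  have "pass_sum l (v # vs) (\<lambda>l' vs'. lookup g (e + single a l' + monom_at k vs')) =
      lookup (var a * h) ?E - lookup (var k * h) ?E"
    unfolding 1 2 pass_sum.simps IH ..
  then show ?case unfolding prod lookup_minus .
qed

section \<open>The Vandermonde product, stage by stage\<close>

fun delta_shift :: "nat list \<Rightarrow> nat list" where
  "delta_shift [] = []"
| "delta_shift (l # ls) = (l + length ls) # delta_shift ls"

text \<open>Factors are grouped by their smaller index, one group per stage.\<close>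

fun vandermonde :: "nat \<Rightarrow> nat \<Rightarrow> mpoly" where
  "vandermonde k 0 = 1"
| "vandermonde k (Suc n) = (\<Prod>j<n. var k - var (Suc k + j)) * vandermonde (Suc k) n"

lemma pass_sum_cong:
  "(\<And>l' vs'. length vs' = length vs \<Longrightarrow> F l' vs' = G l' vs') \<Longrightarrow> pass_sum l vs F = pass_sum l vs G"
proof (induction vs arbitrary: l F G)
  case (Cons v vs)
  have "pass_sum l vs (\<lambda>l' vs'. F l' (x # vs')) = pass_sum l vs (\<lambda>l' vs'. G l' (x # vs'))" for l x
    by (rule Cons.IH) (simp add: Cons.prems)
  then show ?case by simp
qed simp

lemma stage_sum_cong:
  "(\<And>vs'. length vs' = length ls + length vs \<Longrightarrow> F vs' = G vs') \<Longrightarrow> stage_sum ls vs F = stage_sum ls vs G"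
proof (induction ls arbitrary: vs)
  case (Cons l ls)
  show ?case unfolding stage_sum.simps
    by (rule pass_sum_cong, rule Cons.IH) (simp add: Cons.prems)
qed simp

lemma stage_sum_append: "stage_sum (xs @ ys) vs F = stage_sum xs vs (\<lambda>vs'. stage_sum ys vs' F)"
  by (induction xs arbitrary: vs) simp_all

text \<open>The first part is raised in the final stage, so the factors of its variable are absorbed
  into \<open>g\<close> before the induction hypothesis is applied, and \<open>e\<close> collects
  the exponents already split off. Each part gains one unit per later part, which produces the
  staircase.\<close>

lemma stage_sum_lookup:
  fixes g :: mpoly
  assumes "\<And>i. k \<le> i \<Longrightarrow> lookup e i = 0"
  shows "stage_sum (rev \<mu>) [] (\<lambda>v. lookup g (e + monom_at k v)) =
    lookup (vandermonde k (length \<mu>) * g) (e + monom_at k (delta_shift \<mu>))"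
  using assms
proof (induction \<mu> arbitrary: e k g)
  case (Cons l \<mu>)
  let ?h = "(\<Prod>j<length \<mu>. var k - var (Suc k + j)) * g"
  have "stage_sum (rev (l # \<mu>)) [] (\<lambda>v. lookup g (e + monom_at k v)) =
      stage_sum (rev \<mu>) [] (\<lambda>vs. pass_sum l vs (\<lambda>l' vs'. lookup g (e + single k l' + monom_at (Suc k) vs')))"
    by (simp add: stage_sum_append ac_simps)
  also have "\<dots> = stage_sum (rev \<mu>) [] (\<lambda>vs. lookup ?h ((e + single k (l + length \<mu>)) + monom_at (Suc k) vs))"
  proof (rule stage_sum_cong)
    fix vs' :: "nat list" assume "length vs' = length (rev \<mu>) + length ([] :: nat list)"
    then show "pass_sum l vs' (\<lambda>l' vs'. lookup g (e + single k l' + monom_at (Suc k) vs')) =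
        lookup ?h ((e + single k (l + length \<mu>)) + monom_at (Suc k) vs')"
      using pass_sum_lookup[of "Suc k" vs' e k l g] Cons.prems by simp
  qed
  also have "\<dots> = lookup (vandermonde (Suc k) (length \<mu>) * ?h)
      ((e + single k (l + length \<mu>)) + monom_at (Suc k) (delta_shift \<mu>))"
    by (rule Cons.IH) (use Cons.prems in \<open>auto simp: lookup_add lookup_single\<close>)
  finally show ?case by (simp add: ac_simps)
qed simp

text \<open>Peels off the last variable instead of the first, as the branching rule requires, which
  removes the largest entry of a tableau.\<close>

lemma vandermonde_Suc_back:
  "vandermonde k (Suc n) = vandermonde k n * (\<Prod>i<n. var (k + i) - var (k + n))"
proof (induction n arbitrary: k)
  case (Suc n)
  have "vandermonde k (Suc (Suc n)) = (\<Prod>j<Suc n. var k - var (Suc k + j)) *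
      (vandermonde (Suc k) n * (\<Prod>i<n. var (Suc k + i) - var (Suc k + n)))"
    by (subst vandermonde.simps(2)) (simp only: Suc.IH)
  also have "\<dots> = (\<Prod>j<n. var k - var (Suc k + j)) * vandermonde (Suc k) n *
      ((var k - var (Suc k + n)) * (\<Prod>i<n. var (Suc k + i) - var (Suc k + n)))"
    by (simp add: ac_simps)
  also have "(var k - var (Suc k + n)) * (\<Prod>i<n. var (Suc k + i) - var (Suc k + n)) =
      (\<Prod>i<Suc n. var (k + i) - var (k + Suc n))"
    unfolding prod.lessThan_Suc_shift by simp
  also have "(\<Prod>j<n. var k - var (Suc k + j)) * vandermonde (Suc k) n = vandermonde k (Suc n)"
    by simp
  finally show ?case .
qed simp

section \<open>Alternants\<close>

definition alternant :: "(nat \<Rightarrow> 'a) \<Rightarrow> nat \<Rightarrow> (nat \<Rightarrow> nat) \<Rightarrow> 'a :: comm_ring_1" where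
  "alternant y n e = det (mat n n (\<lambda>(i, j). y i ^ e j))"

text \<open>A geometric sum truncated below at \<open>l\<close> and multiplied by
  \<open>a ^ m\<close>. It turns the difference of powers in a reduced column into a sum over the
  exponents in between.\<close>

lemma telescoping_power_sum:
  fixes a b :: "'a :: comm_ring_1"
  assumes "l \<le> u"
  shows "(a - b) * (\<Sum>k = l..u. a ^ (k + m) * b ^ (u - k)) = a ^ (u + m + 1) - a ^ (l + m) * b ^ (u - l + 1)"
  using assms
proof (induction u rule: dec_induct)
  case base
  then show ?case by (simp add: algebra_simps)
next
  case (step u)
  have "(\<Sum>k = l..Suc u. a ^ (k + m) * b ^ (Suc u - k)) =
      b * (\<Sum>k = l..u. a ^ (k + m) * b ^ (u - k)) + a ^ (Suc u + m)"
  proof -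
    have "(\<Sum>k = l..u. a ^ (k + m) * b ^ (Suc u - k)) = b * (\<Sum>k = l..u. a ^ (k + m) * b ^ (u - k))"
      unfolding sum_distrib_left by (rule sum.cong) (auto simp: Suc_diff_le)
    then show ?thesis using step by simp
  qed
  then have "(a - b) * (\<Sum>k = l..Suc u. a ^ (k + m) * b ^ (Suc u - k)) =
      b * ((a - b) * (\<Sum>k = l..u. a ^ (k + m) * b ^ (u - k))) + (a - b) * a ^ (Suc u + m)"
    by (simp add: algebra_simps)
  also have "\<dots> = a ^ (Suc u + m + 1) - a ^ (l + m) * b ^ (Suc u - l + 1)"
    unfolding step.IH using step(1) by (simp add: algebra_simps Suc_diff_le)
  finally show ?case .
qed

lemma signof_mult_sum_commute:
  "(\<Sum>p \<in> P. signof p * (\<Sum>\<nu> \<in> I. f p \<nu>)) = (\<Sum>\<nu> \<in> I. \<Sum>p \<in> P. signof p * f p \<nu> :: 'a :: comm_ring_1)"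
  unfolding sum_distrib_left by (rule sum.swap)

text \<open>Multilinearity in the columns: choosing a summand in every column is a function
  \<open>\<nu>\<close> on column indices. The row factors come out because a permutation meets each
  row once.\<close>

lemma det_mat_sum_columns:
  fixes y :: "nat \<Rightarrow> 'a :: comm_ring_1"
  assumes "\<And>j. j < n \<Longrightarrow> finite (I j)"
  shows "det (mat n n (\<lambda>(i, j). r i * (\<Sum>k \<in> I j. y i ^ e j k * c j k))) =
    (\<Prod>i<n. r i) * (\<Sum>\<nu> \<in> PiE {..<n} I. (\<Prod>j<n. c j (\<nu> j)) * alternant y n (\<lambda>j. e j (\<nu> j)))"
proof -
  let ?P = "{p. p permutes {0..<n}}"
  have perm: "p j < n" if "p \<in> ?P" "j < n" for p j
    using that permutes_in_image[of p "{0..<n}" j] by auto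
  have "det (mat n n (\<lambda>(i, j). r i * (\<Sum>k \<in> I j. y i ^ e j k * c j k))) =
     (\<Sum>p \<in> ?P. signof p * (\<Prod>j<n. r (p j) * (\<Sum>k \<in> I j. y (p j) ^ e j k * c j k)))"
    by (subst det_col[of _ n]) (auto intro!: sum.cong prod.cong simp: perm)
  also have "\<dots> = (\<Sum>p \<in> ?P. signof p * ((\<Prod>i<n. r i) *
      (\<Sum>\<nu> \<in> PiE {..<n} I. (\<Prod>j<n. c j (\<nu> j)) * (\<Prod>j<n. y (p j) ^ e j (\<nu> j)))))"
  proof (rule sum.cong[OF refl])
    fix p assume p: "p \<in> ?P"
    have bij: "bij_betw p {..<n} {..<n}"
      using p permutes_imp_bij[of p "{0..<n}"] by (simp add: lessThan_atLeast0)
    have "(\<Prod>j<n. r (p j)) = (\<Prod>i<n. r i)"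
      by (rule prod.reindex_bij_betw[OF bij])
    moreover have "(\<Prod>j<n. \<Sum>k \<in> I j. y (p j) ^ e j k * c j k) =
        (\<Sum>\<nu> \<in> PiE {..<n} I. (\<Prod>j<n. c j (\<nu> j)) * (\<Prod>j<n. y (p j) ^ e j (\<nu> j)))"
      by (subst prod_sum_PiE) (use assms in \<open>auto simp: prod.distrib mult.commute\<close>)
    ultimately show "signof p * (\<Prod>j<n. r (p j) * (\<Sum>k \<in> I j. y (p j) ^ e j k * c j k)) =
      signof p * ((\<Prod>i<n. r i) *
      (\<Sum>\<nu> \<in> PiE {..<n} I. (\<Prod>j<n. c j (\<nu> j)) * (\<Prod>j<n. y (p j) ^ e j (\<nu> j))))"
      by (simp only: prod.distrib)
  qed
  also have "\<dots> = (\<Prod>i<n. r i) * (\<Sum>p \<in> ?P. signof p *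
      (\<Sum>\<nu> \<in> PiE {..<n} I. (\<Prod>j<n. c j (\<nu> j)) * (\<Prod>j<n. y (p j) ^ e j (\<nu> j))))"
    by (subst (2) sum_distrib_left, rule sum.cong) (simp_all only: mult.left_commute)
  also have "\<dots> = (\<Prod>i<n. r i) * (\<Sum>\<nu> \<in> PiE {..<n} I. \<Sum>p \<in> ?P. signof p *
      ((\<Prod>j<n. c j (\<nu> j)) * (\<Prod>j<n. y (p j) ^ e j (\<nu> j))))"
    unfolding signof_mult_sum_commute ..
  also have "\<dots> = (\<Prod>i<n. r i) * (\<Sum>\<nu> \<in> PiE {..<n} I. (\<Prod>j<n. c j (\<nu> j)) * alternant y n (\<lambda>j. e j (\<nu> j)))"
  proof -
    have "alternant y n (\<lambda>j. e j (\<nu> j)) = (\<Sum>p \<in> ?P. signof p * (\<Prod>j<n. y (p j) ^ e j (\<nu> j)))" for \<nu>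
      unfolding alternant_def by (subst det_col[of _ n]) (auto intro!: sum.cong prod.cong simp: perm)
    then show ?thesis by (simp add: sum_distrib_left mult.left_commute)
  qed
  finally show ?thesis .
qed

text \<open>The geometric sum in column \<open>j\<close> runs over exponents between
  \<open>f (Suc j)\<close> and \<open>f j\<close>; this is the same interlacing condition that
  governs the removal of the largest entry from a tableau.\<close>

theorem alternant_branching:
  fixes y :: "nat \<Rightarrow> 'a :: comm_ring_1" and f :: "nat \<Rightarrow> nat"
  assumes dec: "\<And>j. j < n \<Longrightarrow> f (Suc j) \<le> f j"
  shows "alternant y (Suc n) (\<lambda>j. f j + (n - j)) = y n ^ f n * ((\<Prod>i<n. y i - y n) *
    (\<Sum>\<nu> \<in> PiE {..<n} (\<lambda>j. {f (Suc j)..f j}). (\<Prod>j<n. y n ^ (f j - \<nu> j)) *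
      alternant y n (\<lambda>j. \<nu> j + (n - 1 - j))))"
proof -
  define A where "A = mat (Suc n) (Suc n) (\<lambda>(i, j). y i ^ (f j + (n - j)))"
  define U where "U = mat (Suc n) (Suc n) (\<lambda>(i, j). if i = j then 1 else
     if i = Suc j then - (y n ^ (f j - f (Suc j) + 1)) else 0)"
  \<comment> \<open>Multiplication by \<open>U\<close> subtracts from each column a multiple of the next, which clears the last row
    up to its last entry.\<close>
  define B where "B = mat n n (\<lambda>(i, j). (y i - y n) *
     (\<Sum>k \<in> {f (Suc j)..f j}. y i ^ (k + (n - 1 - j)) * y n ^ (f j - k)))"
  have cA: "A \<in> carrier_mat (Suc n) (Suc n)" and cU: "U \<in> carrier_mat (Suc n) (Suc n)"
    by (auto simp: A_def U_def)
  have detU: "det U = 1"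
  proof -
    have "det U = prod_list (diag_mat U)"
      by (rule det_lower_triangular[OF _ cU]) (auto simp: U_def)
    also have "\<dots> = (\<Prod>i = 0..<Suc n. U $$ (i, i))"
      using cU by (simp add: prod_list_diag_prod)
    also have "\<dots> = 1" by (rule prod.neutral) (auto simp: U_def)
    finally show ?thesis .
  qed
  have AU: "(A * U) $$ (i, j) = (if j < n then y i ^ (f j + (n - j)) -
      y i ^ (f (Suc j) + (n - Suc j)) * y n ^ (f j - f (Suc j) + 1) else y i ^ f n)"
    if "i < Suc n" "j < Suc n" for i j
  proof -
    have "(A * U) $$ (i, j) = (\<Sum>k = 0..<Suc n. A $$ (i, k) * U $$ (k, j))"
      using that cA cU by (simp add: scalar_prod_def)
    also have "\<dots> = (\<Sum>k \<in> {0..<Suc n}. (if k = j then y i ^ (f j + (n - j)) else 0) +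
        (if k = Suc j then - (y i ^ (f (Suc j) + (n - Suc j)) * y n ^ (f j - f (Suc j) + 1)) else 0))"
    proof (rule sum.cong[OF refl])
      fix k assume "k \<in> {0..<Suc n}"
      then have "A $$ (i, k) * U $$ (k, j) = y i ^ (f k + (n - k)) *
          (if k = j then 1 else if k = Suc j then - (y n ^ (f j - f (Suc j) + 1)) else 0)"
        using that by (simp add: A_def U_def)
      then show "A $$ (i, k) * U $$ (k, j) = (if k = j then y i ^ (f j + (n - j)) else 0) +
        (if k = Suc j then - (y i ^ (f (Suc j) + (n - Suc j)) * y n ^ (f j - f (Suc j) + 1)) else 0)"
        by (cases "k = j"; cases "k = Suc j") simp_all
    qed
    also have "\<dots> = (if j \<in> {0..<Suc n} then y i ^ (f j + (n - j)) else 0) + (if Suc j \<in> {0..<Suc n} then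
        - (y i ^ (f (Suc j) + (n - Suc j)) * y n ^ (f j - f (Suc j) + 1)) else 0)"
      by (simp only: sum.distrib sum.delta finite_atLeastLessThan)
    finally show ?thesis using that by (cases "j = n") simp_all
  qed
  have last: "(A * U) $$ (n, j) = 0" if "j < n" for j
  proof -
    have "f j + (n - j) = f (Suc j) + (n - Suc j) + (f j - f (Suc j) + 1)"
      using dec[OF that] that by simp
    then have "y n ^ (f j + (n - j)) = y n ^ (f (Suc j) + (n - Suc j)) * y n ^ (f j - f (Suc j) + 1)"
      by (simp only: power_add)
    then show ?thesis using AU[of n j] that by (simp only: if_True less_Suc_eq) simp
  qed
  have del: "mat_delete (A * U) n n = B"
  proof (rule eq_matI)
    fix i j assume ij: "i < dim_row B" "j < dim_col B"
    then have lt: "i < n" "j < n" by (auto simp: B_def)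
    have e: "f j + (n - j) = f j + (n - 1 - j) + 1" "n - Suc j = n - 1 - j" using lt by auto
    have "mat_delete (A * U) n n $$ (i, j) = (A * U) $$ (i, j)"
      using lt cA cU by (simp add: mat_delete_def)
    also have "\<dots> = y i ^ (f j + (n - 1 - j) + 1) -
        y i ^ (f (Suc j) + (n - 1 - j)) * y n ^ (f j - f (Suc j) + 1)"
      using AU[of i j] lt unfolding e by simp
    also have "\<dots> = B $$ (i, j)"
      using telescoping_power_sum[OF dec[OF lt(2)], of "y i" "y n" "n - 1 - j"] lt by (simp add: B_def)
    finally show "mat_delete (A * U) n n $$ (i, j) = B $$ (i, j)" .
  qed (use cA cU in \<open>auto simp: B_def\<close>)
  have "det A = det (A * U)" using det_mult[OF cA cU] detU by simp
  \<comment> \<open>The last row vanishes except in its last entry, so the expansion along it has a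
    single term, with positive sign.\<close>
  also have "\<dots> = (\<Sum>j<Suc n. (A * U) $$ (n, j) * cofactor (A * U) n j)"
    by (rule laplace_expansion_row) (use cA cU in auto)
  also have "\<dots> = (A * U) $$ (n, n) * cofactor (A * U) n n"
    using last by simp
  also have "\<dots> = y n ^ f n * det B"
    using AU[of n n] del by (simp add: cofactor_def)
  also have "det B = (\<Prod>i<n. y i - y n) * (\<Sum>\<nu> \<in> PiE {..<n} (\<lambda>j. {f (Suc j)..f j}).
      (\<Prod>j<n. y n ^ (f j - \<nu> j)) * alternant y n (\<lambda>j. \<nu> j + (n - 1 - j)))"
    unfolding B_def by (rule det_mat_sum_columns) simp
  finally show ?thesis by (simp add: alternant_def A_def)
qed

section \<open>Branching of Schur polynomials\<close>

lemma finite_SSYT: "finite (SSYT n \<mu>)"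
proof (rule finite_subset)
  let ?R = "{r. set r \<subseteq> {1..n} \<and> length r \<le> sum_list \<mu>}"
  show "SSYT n \<mu> \<subseteq> {T. set T \<subseteq> ?R \<and> length T = length \<mu>}"
  proof
    fix T assume T: "T \<in> SSYT n \<mu>"
    then have \<mu>: "\<mu> = map length T" by (auto simp: SSYT_def)
    have "length r \<le> sum_list \<mu>" if "r \<in> set T" for r
      unfolding \<mu> using that by (intro member_le_sum_list) auto
    then show "T \<in> {T. set T \<subseteq> ?R \<and> length T = length \<mu>}"
      using T \<mu> by (auto simp: SSYT_def)
  qed
  show "finite {T. set T \<subseteq> ?R \<and> length T = length \<mu>}"
    by (intro finite_lists_length_eq finite_lists_length_le) simp
qed

lemma SSYT_rows: "T \<in> SSYT n \<mu> \<Longrightarrow> length T = length \<mu>"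
  "T \<in> SSYT n \<mu> \<Longrightarrow> i < length \<mu> \<Longrightarrow> length (T ! i) = \<mu> ! i"
  "T \<in> SSYT n \<mu> \<Longrightarrow> i < length \<mu> \<Longrightarrow> sorted (T ! i)"
  "T \<in> SSYT n \<mu> \<Longrightarrow> i < length \<mu> \<Longrightarrow> set (T ! i) \<subseteq> {1..n}"
  "T \<in> SSYT n \<mu> \<Longrightarrow> Suc i < length \<mu> \<Longrightarrow> j < \<mu> ! Suc i \<Longrightarrow> T ! i ! j < T ! Suc i ! j"
proof -
  show len: "length T = length \<mu>" if "T \<in> SSYT n \<mu>" for T
    using that by (auto simp: SSYT_def)
  show row: "length (T ! i) = \<mu> ! i" if "T \<in> SSYT n \<mu>" "i < length \<mu>" for T i
    using that by (auto simp: SSYT_def)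
  show "sorted (T ! i)" if "T \<in> SSYT n \<mu>" "i < length \<mu>" for T i
    using that len[OF that(1)] by (simp add: SSYT_def)
  show "set (T ! i) \<subseteq> {1..n}" if "T \<in> SSYT n \<mu>" "i < length \<mu>" for T i
  proof -
    have "T ! i \<in> set T" using that len[OF that(1)] by (intro nth_mem) simp
    then have "set (T ! i) \<subseteq> set (concat T)" by auto
    then show ?thesis using that(1) unfolding SSYT_def by blast
  qed
  show "T ! i ! j < T ! Suc i ! j" if "T \<in> SSYT n \<mu>" "Suc i < length \<mu>" "j < \<mu> ! Suc i" for T i j
    using that len[OF that(1)] row[OF that(1,2)] by (simp add: SSYT_def)
qed

lemma SSYT_I:
  assumes "length T = length \<mu>" "\<And>i. i < length \<mu> \<Longrightarrow> length (T ! i) = \<mu> ! i"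
    "\<And>i. i < length \<mu> \<Longrightarrow> sorted (T ! i)" "\<And>i. i < length \<mu> \<Longrightarrow> set (T ! i) \<subseteq> {1..n}"
    "\<And>i j. Suc i < length \<mu> \<Longrightarrow> j < \<mu> ! Suc i \<Longrightarrow> T ! i ! j < T ! Suc i ! j"
  shows "T \<in> SSYT n \<mu>"
proof -
  have "map length T = \<mu>" using assms(1,2) by (simp add: list_eq_iff_nth_eq)
  moreover have "set (concat T) \<subseteq> {1..n}"
  proof
    fix x assume "x \<in> set (concat T)"
    then obtain r where "r \<in> set T" "x \<in> set r" by auto
    then obtain i where "i < length \<mu>" "x \<in> set (T ! i)" using assms(1) by (metis in_set_conv_nth)
    then show "x \<in> {1..n}" using assms(4) by blast
  qed
  moreover have "\<forall>r \<in> set T. sorted r" using assms(1,3) by (auto simp: in_set_conv_nth)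
  moreover have "T ! i ! j < T ! Suc i ! j" if "Suc i < length T" "j < length (T ! Suc i)" for i j
    using that assms(1) assms(2)[of "Suc i"] assms(5)[of i j] by simp
  ultimately show ?thesis unfolding SSYT_def by blast
qed

text \<open>Columns increase strictly from an entry of at least 1. This forces the last row of a
  tableau with as many rows as letters to be constant, and excludes tableaux with more nonempty rows
  than letters.\<close>

lemma SSYT_entry_ge:
  assumes "T \<in> SSYT n \<mu>" "\<And>j. Suc j < length \<mu> \<Longrightarrow> \<mu> ! Suc j \<le> \<mu> ! j" "i < length \<mu>" "c < \<mu> ! i"
  shows "Suc i \<le> T ! i ! c"
  using assms(3,4)
proof (induction i)
  case 0
  then have "T ! 0 ! c \<in> set (T ! 0)" using SSYT_rows(2)[OF assms(1), of 0] by (intro nth_mem) auto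
  then show ?case using SSYT_rows(4)[OF assms(1), of 0] 0 by auto
next
  case (Suc i)
  have "c < \<mu> ! i" using Suc.prems assms(2)[of i] by simp
  then have "Suc i \<le> T ! i ! c" using Suc by simp
  also have "\<dots> < T ! Suc i ! c" by (rule SSYT_rows(5)[OF assms(1)]) (use Suc.prems in auto)
  finally show ?case by simp
qed

lemma sorted_filter_split:
  assumes "sorted r" "set r \<subseteq> {1..Suc n}"
  shows "r = filter (\<lambda>x. x \<le> n) r @ replicate (length r - length (filter (\<lambda>x. x \<le> n) r)) (Suc n)"
  using assms
proof (induction r)
  case (Cons x r)
  show ?case
  proof (cases "x \<le> n")
    case True
    then show ?thesis using Cons by simp
  next
    case False
    then have x: "x = Suc n" using Cons.prems by auto
    have "\<forall>z \<in> set r. z = Suc n" using Cons.prems x by force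
    then have "filter (\<lambda>x. x \<le> n) r = []" "r = replicate (length r) (Suc n)"
      by (auto simp: filter_empty_conv intro!: replicate_eqI)
    then show ?thesis using x by simp
  qed
qed simp

lemma nth_filter_le:
  assumes "sorted r" "set r \<subseteq> {1..Suc n}" "c < length r"
  shows "c < length (filter (\<lambda>x. x \<le> n) r) \<longleftrightarrow> r ! c \<le> n"
    "c < length (filter (\<lambda>x. x \<le> n) r) \<Longrightarrow> filter (\<lambda>x. x \<le> n) r ! c = r ! c"
proof -
  let ?f = "filter (\<lambda>x. x \<le> n) r"
  have r: "r = ?f @ replicate (length r - length ?f) (Suc n)"
    using sorted_filter_split[OF assms(1,2)] .
  have nth: "r ! c = (if c < length ?f then ?f ! c else Suc n)"
    using assms(3) by (subst r) (auto simp: nth_append)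
  then show "c < length ?f \<Longrightarrow> ?f ! c = r ! c" by simp
  show "c < length ?f \<longleftrightarrow> r ! c \<le> n"
  proof
    assume c: "c < length ?f"
    then have "?f ! c \<in> set ?f" by (rule nth_mem)
    then show "r ! c \<le> n" using nth c by simp
  qed (use nth in \<open>auto split: if_splits\<close>)
qed

section \<open>Removing the largest entry from a tableau\<close>

locale ssyt_branching =
  fixes n :: nat and \<mu> :: "nat list"
  assumes len: "length \<mu> = Suc n" and dec: "\<And>j. j < n \<Longrightarrow> \<mu> ! Suc j \<le> \<mu> ! j"
begin

text \<open>Removing the entries \<open>Suc n\<close> empties row \<open>n\<close>, all of whose
  entries exceed \<open>n\<close>. The shape is therefore recorded for rows below \<open>n\<close>
  only, as an extensional function in order to lie in a \<open>PiE\<close>.\<close>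

definition restrict_tab :: "nat list list \<Rightarrow> (nat \<Rightarrow> nat) \<times> nat list list" where
  "restrict_tab T = (restrict (\<lambda>j. length (filter (\<lambda>x. x \<le> n) (T ! j))) {..<n},
     map (\<lambda>j. filter (\<lambda>x. x \<le> n) (T ! j)) [0..<n])"

definition extend_tab :: "(nat \<Rightarrow> nat) \<times> nat list list \<Rightarrow> nat list list" where
  "extend_tab p = map (\<lambda>j. snd p ! j @ replicate (\<mu> ! j - fst p j) (Suc n)) [0..<n] @
     [replicate (\<mu> ! n) (Suc n)]"

abbreviation shapes :: "(nat \<Rightarrow> nat) set" where
  "shapes \<equiv> PiE {..<n} (\<lambda>j. {\<mu> ! Suc j..\<mu> ! j})"

abbreviation pairs :: "((nat \<Rightarrow> nat) \<times> nat list list) set" where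
  "pairs \<equiv> (SIGMA \<nu> : shapes. SSYT n (map \<nu> [0..<n]))"

text \<open>The lower interlacing bound holds because an entry with another one below it is smaller
  than \<open>Suc n\<close> and survives.\<close>

lemma restrict_in_pairs:
  assumes T: "T \<in> SSYT (Suc n) \<mu>"
  shows "restrict_tab T \<in> pairs"
proof -
  let ?f = "\<lambda>j. filter (\<lambda>x. x \<le> n) (T ! j)"
  have row: "sorted (T ! j)" "set (T ! j) \<subseteq> {1..Suc n}" "length (T ! j) = \<mu> ! j" if "j \<le> n" for j
    using SSYT_rows(2-4)[OF T, of j] that len by auto
  have lower: "c < length (?f j)" if "j < n" "c < \<mu> ! Suc j" for j c
  proof -
    have "T ! j ! c < T ! Suc j ! c" by (rule SSYT_rows(5)[OF T]) (use that len in auto)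
    moreover have "T ! Suc j ! c \<in> set (T ! Suc j)" using that row(3)[of "Suc j"] by (intro nth_mem) auto
    then have "T ! Suc j ! c \<le> Suc n" using row(2)[of "Suc j"] that by auto
    ultimately have "T ! j ! c \<le> n" by simp
    moreover have "c < length (T ! j)" using that dec[of j] row(3)[of j] by simp
    ultimately show ?thesis using nth_filter_le(1)[OF row(1,2), of j c] that by simp
  qed
  have shape: "length (?f j) \<in> {\<mu> ! Suc j..\<mu> ! j}" if "j < n" for j
  proof -
    have "\<mu> ! Suc j \<le> length (?f j)"
      using lower[OF that] by (meson not_le_imp_less order_less_irrefl)
    moreover have "length (?f j) \<le> \<mu> ! j" using length_filter_le[of _ "T ! j"] row(3)[of j] that by simp
    ultimately show ?thesis by simp
  qed
  have "map ?f [0..<n] \<in> SSYT n (map (restrict (\<lambda>j. length (?f j)) {..<n}) [0..<n])"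
  proof (rule SSYT_I)
    fix i j assume ij: "Suc i < length (map (restrict (\<lambda>j. length (?f j)) {..<n}) [0..<n])"
      "j < map (restrict (\<lambda>j. length (?f j)) {..<n}) [0..<n] ! Suc i"
    then have i: "Suc i < n" and j: "j < length (?f (Suc i))" by auto
    have j2: "j < \<mu> ! Suc i" using j shape[of "Suc i"] i by auto
    have a: "?f (Suc i) ! j = T ! Suc i ! j"
      using nth_filter_le(2)[OF row(1,2), of "Suc i" j] j i j2 row(3)[of "Suc i"] by simp
    have "j < length (T ! i)" using j2 dec[of i] row(3)[of i] i by simp
    then have b: "?f i ! j = T ! i ! j"
      using nth_filter_le(2)[OF row(1,2), of i j] lower[of i j] i j2 by simp
    have "T ! i ! j < T ! Suc i ! j" by (rule SSYT_rows(5)[OF T]) (use i j2 len in auto)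
    then show "map ?f [0..<n] ! i ! j < map ?f [0..<n] ! Suc i ! j" using a b i by simp
  next
    fix i assume "i < length (map (restrict (\<lambda>j. length (?f j)) {..<n}) [0..<n])"
    then have i: "i < n" by simp
    show "set (map ?f [0..<n] ! i) \<subseteq> {1..n}" using i row(2)[of i] by auto
    show "sorted (map ?f [0..<n] ! i)" using i row(1)[of i] by (simp add: sorted_wrt_filter)
    show "length (map ?f [0..<n] ! i) = map (restrict (\<lambda>j. length (?f j)) {..<n}) [0..<n] ! i"
      using i by simp
  qed simp
  then show ?thesis using shape by (simp add: restrict_tab_def)
qed

lemma extend_restrict:
  assumes T: "T \<in> SSYT (Suc n) \<mu>"
  shows "extend_tab (restrict_tab T) = T"
proof (rule nth_equalityI)
  show "length (extend_tab (restrict_tab T)) = length T"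
    using SSYT_rows(1)[OF T] len by (simp add: extend_tab_def)
  fix i assume "i < length (extend_tab (restrict_tab T))"
  then have i: "i < Suc n" by (simp add: extend_tab_def)
  have row: "sorted (T ! i)" "set (T ! i) \<subseteq> {1..Suc n}" "length (T ! i) = \<mu> ! i"
    using SSYT_rows(2-4)[OF T, of i] i len by auto
  show "extend_tab (restrict_tab T) ! i = T ! i"
  proof (cases "i < n")
    case True
    then have "extend_tab (restrict_tab T) ! i = filter (\<lambda>x. x \<le> n) (T ! i) @
        replicate (length (T ! i) - length (filter (\<lambda>x. x \<le> n) (T ! i))) (Suc n)"
      by (simp add: extend_tab_def restrict_tab_def nth_append row(3))
    then show ?thesis using sorted_filter_split[OF row(1,2)] by simp
  next
    case False
    then have i: "i = n" using i by simp
    have "x = Suc n" if "x \<in> set (T ! n)" for x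
    proof -
      obtain c where c: "c < length (T ! n)" "x = T ! n ! c" using \<open>x \<in> set (T ! n)\<close>
        by (metis in_set_conv_nth)
      have "Suc n \<le> T ! n ! c"
        by (rule SSYT_entry_ge[OF T]) (use c row(3) dec len i in auto)
      moreover have "x \<in> {1..Suc n}" using that row(2) i by blast
      ultimately show ?thesis using c by simp
    qed
    then have "T ! n = replicate (\<mu> ! n) (Suc n)"
      using row(3) i by (intro replicate_eqI) auto
    then show ?thesis using i by (simp add: extend_tab_def nth_append)
  qed
qed

text \<open>No two entries \<open>Suc n\<close> stand above each other, since row
  \<open>Suc i\<close> of \<open>\<mu>\<close> is no longer than the kept segment of row
  \<open>i\<close>.\<close>

lemma extend_in_SSYT:
  assumes \<nu>: "\<nu> \<in> shapes" and T: "T \<in> SSYT n (map \<nu> [0..<n])"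
  shows "extend_tab (\<nu>, T) \<in> SSYT (Suc n) \<mu>"
proof -
  have nu: "\<mu> ! Suc j \<le> \<nu> j" "\<nu> j \<le> \<mu> ! j" if "j < n" for j
    using \<nu> that by (auto simp: PiE_iff)
  have row: "sorted (T ! j)" "set (T ! j) \<subseteq> {1..n}" "length (T ! j) = \<nu> j" if "j < n" for j
    using SSYT_rows(2-4)[OF T, of j] that by auto
  have ext: "extend_tab (\<nu>, T) ! i = (if i < n then T ! i @ replicate (\<mu> ! i - \<nu> i) (Suc n)
      else replicate (\<mu> ! n) (Suc n))" if "i < Suc n" for i
    using that by (auto simp: extend_tab_def nth_append less_Suc_eq)
  show ?thesis
  proof (rule SSYT_I)
    show "length (extend_tab (\<nu>, T)) = length \<mu>" by (simp add: extend_tab_def len)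
  next
    fix i assume "i < length \<mu>"
    then have i: "i < Suc n" by (simp add: len)
    show "length (extend_tab (\<nu>, T) ! i) = \<mu> ! i"
      using i nu[of i] row(3)[of i] by (cases "i = n") (auto simp: ext)
    show "sorted (extend_tab (\<nu>, T) ! i)"
    proof (cases "i < n")
      case True
      have "\<forall>x \<in> set (T ! i). x \<le> Suc n" using row(2)[OF True] by auto
      then show ?thesis using i True row(1)[of i] by (simp add: ext sorted_append)
    qed (simp add: ext i)
    show "set (extend_tab (\<nu>, T) ! i) \<subseteq> {1..Suc n}"
      using i row(2)[of i] by (cases "i < n") (auto simp: ext)
  next
    fix i j assume "Suc i < length \<mu>" and j: "j < \<mu> ! Suc i"
    then have i: "i < n" by (simp add: len)
    have jn: "j < length (T ! i)" using j nu(1)[OF i] row(3)[OF i] by simp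
    then have a: "extend_tab (\<nu>, T) ! i ! j = T ! i ! j" using i by (simp add: ext nth_append)
    have le: "T ! i ! j \<le> n" using nth_mem[OF jn] row(2)[OF i] by auto
    show "extend_tab (\<nu>, T) ! i ! j < extend_tab (\<nu>, T) ! Suc i ! j"
    proof (cases "Suc i < n \<and> j < length (T ! Suc i)")
      case True
      then have "T ! i ! j < T ! Suc i ! j"
        using SSYT_rows(5)[OF T, of i j] row(3)[of "Suc i"] by simp
      then show ?thesis using True a by (simp add: ext nth_append)
    next
      case False
      then have "extend_tab (\<nu>, T) ! Suc i ! j = Suc n"
        using i j row(3)[of "Suc i"] nu(2)[of "Suc i"]
        by (cases "Suc i = n") (auto simp: ext nth_append)
      then show ?thesis using a le by simp
    qed
  qed
qed

lemma restrict_extend: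
  assumes \<nu>: "\<nu> \<in> shapes" and T: "T \<in> SSYT n (map \<nu> [0..<n])"
  shows "restrict_tab (extend_tab (\<nu>, T)) = (\<nu>, T)"
proof -
  have row: "set (T ! j) \<subseteq> {1..n}" "length (T ! j) = \<nu> j" if "j < n" for j
    using SSYT_rows(2,4)[OF T, of j] that by auto
  have f: "filter (\<lambda>x. x \<le> n) (extend_tab (\<nu>, T) ! j) = T ! j" if "j < n" for j
  proof -
    have "filter (\<lambda>x. x \<le> n) (T ! j) = T ! j" using row(1)[OF that] by (intro filter_True) auto
    then show ?thesis using that by (simp add: extend_tab_def nth_append)
  qed
  have "map (\<lambda>j. filter (\<lambda>x. x \<le> n) (extend_tab (\<nu>, T) ! j)) [0..<n] = T"
    using SSYT_rows(1)[OF T] f by (simp add: list_eq_iff_nth_eq)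
  moreover have "restrict (\<lambda>j. length (filter (\<lambda>x. x \<le> n) (extend_tab (\<nu>, T) ! j))) {..<n} = \<nu>"
  proof
    fix j
    show "restrict (\<lambda>j. length (filter (\<lambda>x. x \<le> n) (extend_tab (\<nu>, T) ! j))) {..<n} j = \<nu> j"
      using f row(2) \<nu> by (cases "j < n") (auto simp: PiE_iff extensional_def)
  qed
  ultimately show ?thesis by (simp add: restrict_tab_def)
qed

lemma weight_concat: "prod_list (map var (concat T)) = (\<Prod>j<length T. prod_list (map var (T ! j)))"
proof -
  have "prod_list (map var (concat T)) = prod_list (map (\<lambda>r. prod_list (map var r)) T)"
    by (induction T) auto
  then show ?thesis by (simp add: prod.list_conv_set_nth atLeast0LessThan)
qed

lemma weight_extend:
  assumes T: "T \<in> SSYT n (map \<nu> [0..<n])"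
  shows "prod_list (map var (concat (extend_tab (\<nu>, T)))) = prod_list (map var (concat T)) *
    ((\<Prod>j<n. var (Suc n) ^ (\<mu> ! j - \<nu> j)) * var (Suc n) ^ (\<mu> ! n))"
proof -
  have lenT: "length T = n" using SSYT_rows(1)[OF T] by simp
  have rep: "prod_list (map var (replicate k (Suc n))) = var (Suc n) ^ k" for k
    by (induction k) auto
  have "prod_list (map var (concat (extend_tab (\<nu>, T)))) =
      (\<Prod>j<Suc n. prod_list (map var (extend_tab (\<nu>, T) ! j)))"
    unfolding weight_concat by (simp add: extend_tab_def)
  also have "\<dots> = (\<Prod>j<n. prod_list (map var (T ! j)) * var (Suc n) ^ (\<mu> ! j - \<nu> j)) * var (Suc n) ^ (\<mu> ! n)"
    by (simp add: extend_tab_def nth_append rep)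
  also have "\<dots> = prod_list (map var (concat T)) *
    ((\<Prod>j<n. var (Suc n) ^ (\<mu> ! j - \<nu> j)) * var (Suc n) ^ (\<mu> ! n))"
    unfolding weight_concat lenT by (simp add: prod.distrib mult.assoc)
  finally show ?thesis .
qed

theorem schur_branching:
  "schur (Suc n) \<mu> = (\<Sum>\<nu> \<in> shapes. schur n (map \<nu> [0..<n]) *
    ((\<Prod>j<n. var (Suc n) ^ (\<mu> ! j - \<nu> j)) * var (Suc n) ^ (\<mu> ! n)))"
proof -
  have fin: "finite shapes" by (rule finite_PiE) auto
  have "schur (Suc n) \<mu> = (\<Sum>p \<in> pairs. prod_list (map var (concat (snd p))) *
    ((\<Prod>j<n. var (Suc n) ^ (\<mu> ! j - fst p j)) * var (Suc n) ^ (\<mu> ! n)))"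
    unfolding schur_def
  proof (rule sum.reindex_bij_witness[where i = extend_tab and j = restrict_tab])
    fix T assume T: "T \<in> SSYT (Suc n) \<mu>"
    show "extend_tab (restrict_tab T) = T" using T by (rule extend_restrict)
    show "restrict_tab T \<in> pairs" using T by (rule restrict_in_pairs)
    obtain \<nu> T' where p: "restrict_tab T = (\<nu>, T')" by (cases "restrict_tab T")
    then have "T' \<in> SSYT n (map \<nu> [0..<n])" using restrict_in_pairs[OF T] by simp
    from weight_extend[OF this] show "prod_list (map var (concat (snd (restrict_tab T)))) *
      ((\<Prod>j<n. var (Suc n) ^ (\<mu> ! j - fst (restrict_tab T) j)) * var (Suc n) ^ (\<mu> ! n)) =
      prod_list (map var (concat T))"
      using extend_restrict[OF T] by (simp add: p)
  next
    fix p assume p: "p \<in> pairs"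
    then obtain \<nu> T where "p = (\<nu>, T)" "\<nu> \<in> shapes" "T \<in> SSYT n (map \<nu> [0..<n])" by blast
    then show "restrict_tab (extend_tab p) = p" "extend_tab p \<in> SSYT (Suc n) \<mu>"
      using restrict_extend extend_in_SSYT by simp_all
  qed
  also have "\<dots> = (\<Sum>\<nu> \<in> shapes. \<Sum>T \<in> SSYT n (map \<nu> [0..<n]). prod_list (map var (concat T)) *
    ((\<Prod>j<n. var (Suc n) ^ (\<mu> ! j - \<nu> j)) * var (Suc n) ^ (\<mu> ! n)))"
    using fin finite_SSYT by (subst sum.Sigma) (auto simp: case_prod_beta)
  finally show ?thesis by (simp add: schur_def sum_distrib_right)
qed

end

lemma alternant_cong: "(\<And>j. j < n \<Longrightarrow> e j = e' j) \<Longrightarrow> alternant y n e = alternant y n e'"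
  unfolding alternant_def by (rule arg_cong[of _ _ det]) (auto intro!: eq_matI)

text \<open>The bialternant formula with denominators cleared. Both branching rules sum over the
  same shapes with the same powers of the last variable, and \<open>vandermonde_Suc_back\<close>
  supplies the missing factors. Zero parts are allowed, since removing the largest entry may create
  them.\<close>

theorem vandermonde_schur:
  assumes "length \<mu> = n" "\<And>j. Suc j < n \<Longrightarrow> \<mu> ! Suc j \<le> \<mu> ! j"
  shows "vandermonde 1 n * schur n \<mu> = alternant (\<lambda>i. var (Suc i)) n (\<lambda>j. \<mu> ! j + (n - 1 - j))"
  using assms
proof (induction n arbitrary: \<mu>)
  case 0
  have "SSYT 0 [] = {[]}" by (auto simp: SSYT_def)
  then show ?case using 0 by (simp add: schur_def alternant_def)
next
  case (Suc n)
  interpret ssyt_branching n \<mu> using Suc.prems by unfold_locales auto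
  let ?x = "var (Suc n)" and ?y = "\<lambda>i. var (Suc i)"
  let ?D = "\<Prod>i<n. ?y i - ?x"
  have IH: "vandermonde 1 n * schur n (map \<nu> [0..<n]) = alternant ?y n (\<lambda>j. \<nu> j + (n - 1 - j))"
    if "\<nu> \<in> shapes" for \<nu>
  proof -
    have nu: "\<mu> ! Suc j \<le> \<nu> j" "\<nu> j \<le> \<mu> ! j" if "j < n" for j
      using \<open>\<nu> \<in> shapes\<close> that by (auto simp: PiE_iff)
    have "vandermonde 1 n * schur n (map \<nu> [0..<n]) =
        alternant ?y n (\<lambda>j. map \<nu> [0..<n] ! j + (n - 1 - j))"
    proof (rule Suc.IH)
      fix j assume j: "Suc j < n"
      then have "\<nu> (Suc j) \<le> \<nu> j" using nu(1)[of j] nu(2)[of "Suc j"] by simp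
      then show "map \<nu> [0..<n] ! Suc j \<le> map \<nu> [0..<n] ! j" using j by simp
    qed simp
    also have "\<dots> = alternant ?y n (\<lambda>j. \<nu> j + (n - 1 - j))" by (rule alternant_cong) simp
    finally show ?thesis .
  qed
  have "vandermonde 1 (Suc n) * schur (Suc n) \<mu> = ?D * (\<Sum>\<nu> \<in> shapes.
      (vandermonde 1 n * schur n (map \<nu> [0..<n])) * ((\<Prod>j<n. ?x ^ (\<mu> ! j - \<nu> j)) * ?x ^ (\<mu> ! n)))"
    unfolding vandermonde_Suc_back schur_branching sum_distrib_left
    by (rule sum.cong[OF refl]) (simp add: ac_simps)
  also have "\<dots> = ?D * (\<Sum>\<nu> \<in> shapes.
      alternant ?y n (\<lambda>j. \<nu> j + (n - 1 - j)) * ((\<Prod>j<n. ?x ^ (\<mu> ! j - \<nu> j)) * ?x ^ (\<mu> ! n)))"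
    by (intro arg_cong[of _ _ "(*) ?D"] sum.cong[OF refl]) (simp only: IH)
  also have "\<dots> = ?x ^ (\<mu> ! n) * (?D * (\<Sum>\<nu> \<in> shapes. (\<Prod>j<n. ?x ^ (\<mu> ! j - \<nu> j)) *
      alternant ?y n (\<lambda>j. \<nu> j + (n - 1 - j))))"
    unfolding sum_distrib_left by (rule sum.cong[OF refl]) (simp add: ac_simps)
  also have "\<dots> = alternant ?y (Suc n) (\<lambda>j. \<mu> ! j + (n - j))"
    using alternant_branching[of n "\<lambda>j. \<mu> ! j" ?y] dec by simp
  finally show ?case by simp
qed

section \<open>Coefficient extraction\<close>

lemma lookup_of_int_mult: "lookup (of_int c * (f :: mpoly)) k = c * lookup f k"
proof -
  have "(of_int c :: mpoly) = single 0 c" by (metis of_int_eq_id id_apply single_of_int)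
  then show ?thesis using lookup_single_mult_add[of 0 c f k] by simp
qed

lemma var_power: "var a ^ m = single (single a m) 1"
  by (induction m) (auto simp: var_def mult_single single_add[symmetric])

lemma prod_var_power: "(\<Prod>i<length vs. var (k + i) ^ (vs ! i)) = single (monom_at k vs) 1"
proof (induction vs arbitrary: k)
  case (Cons v vs)
  then have "(\<Prod>i<length vs. var (Suc k + i) ^ (vs ! i)) = single (monom_at (Suc k) vs) 1" .
  then show ?case unfolding length_Cons prod.lessThan_Suc_shift
    by (simp add: var_power mult_single)
qed simp

lemma monom_at_inj: "length vs = length ws \<Longrightarrow> monom_at k vs = monom_at k ws \<longleftrightarrow> vs = ws"
proof
  assume len: "length vs = length ws" and eq: "monom_at k vs = monom_at k ws"
  show "vs = ws"
  proof (rule nth_equalityI[OF len])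
    fix i assume "i < length vs"
    then show "vs ! i = ws ! i"
      using arg_cong[OF eq, of "\<lambda>m. lookup m (k + i)"] len by (simp add: lookup_monom_at)
  qed
qed simp

lemma length_delta_shift [simp]: "length (delta_shift \<mu>) = length \<mu>"
  by (induction \<mu>) auto

lemma nth_delta_shift: "i < length \<mu> \<Longrightarrow> delta_shift \<mu> ! i = \<mu> ! i + (length \<mu> - 1 - i)"
  by (induction \<mu> arbitrary: i) (auto simp: nth_Cons split: nat.splits)

text \<open>Counting from below gives \<open>i \<le> p i\<close>, counting down from
  \<open>n - 1\<close> gives the reverse.\<close>

lemma strict_mono_permutes_id:
  assumes "p permutes {0..<n}" "\<And>i j. i < j \<Longrightarrow> j < n \<Longrightarrow> p i < (p j :: nat)"
  shows "p = id"
proof -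
  have less: "p i < n" if "i < n" for i using permutes_in_image[OF assms(1), of i] that by simp
  have ge: "i \<le> p i" if "i < n" for i
    using that
  proof (induction i)
    case (Suc i)
    then show ?case using assms(2)[of i "Suc i"] by simp
  qed simp
  have le: "p (n - 1 - k) \<le> n - 1 - k" if "k < n" for k
    using that
  proof (induction k)
    case 0
    then show ?case using less[of "n - 1"] by simp
  next
    case (Suc k)
    then have "n - 1 - Suc k < n - 1 - k" "n - 1 - k < n" by auto
    then have "p (n - 1 - Suc k) < p (n - 1 - k)" by (rule assms(2))
    then show ?case using Suc by simp
  qed
  have "p i = i" for i
  proof (cases "i < n")
    case True
    then have "p i \<le> i" using le[of "n - 1 - i"] by simp
    then show ?thesis using ge[OF True] by simp
  qed (use assms(1) in \<open>auto simp: permutes_def\<close>)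
  then show ?thesis by auto
qed

lemma shifted_strict:
  assumes "length \<mu> = n" "\<And>j. Suc j < n \<Longrightarrow> \<mu> ! Suc j \<le> \<mu> ! j" "i < j" "j < n"
  shows "\<mu> ! j + (n - 1 - j) < \<mu> ! i + (n - 1 - i)"
proof -
  have "\<mu> ! j \<le> \<mu> ! i" using assms(3,4)
  proof (induction j)
    case (Suc j)
    then show ?case using assms(2)[of j] by (cases "i = j") (auto simp: less_Suc_eq)
  qed simp
  then show ?thesis using assms(3,4) by simp
qed

text \<open>Both shifted exponent sequences decrease strictly, so a permutation that matches one to
  the other must be the identity, and then \<open>\<kappa> = \<mu>\<close>.\<close>

lemma lookup_alternant:
  assumes l: "length \<kappa> = n" "\<And>j. Suc j < n \<Longrightarrow> \<kappa> ! Suc j \<le> \<kappa> ! j"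
    and m: "length \<mu> = n" "\<And>j. Suc j < n \<Longrightarrow> \<mu> ! Suc j \<le> \<mu> ! j"
  shows "lookup (alternant (\<lambda>i. var (Suc i)) n (\<lambda>j. \<kappa> ! j + (n - 1 - j))) (monom_at 1 (delta_shift \<mu>)) =
    (if \<kappa> = \<mu> then 1 else 0)"
proof -
  let ?P = "{p. p permutes {0..<n}}"
  define e where "e j = \<kappa> ! j + (n - 1 - j)" for j
  have fin: "finite ?P" by (rule finite_permutations) simp
  have lt: "p i < n" if "p \<in> ?P" "i < n" for p i
    using that permutes_in_image[of p "{0..<n}" i] by auto
  have "alternant (\<lambda>i. var (Suc i)) n e = (\<Sum>p \<in> ?P. signof p * (\<Prod>i = 0..<n. var (Suc i) ^ e (p i)))"
    unfolding alternant_def by (subst det_def'[of _ n]) (auto intro!: sum.cong prod.cong simp: lt)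
  also have "\<dots> = (\<Sum>p \<in> ?P. of_int (sign p) * single (monom_at 1 (map (\<lambda>i. e (p i)) [0..<n])) 1)"
  proof (rule sum.cong[OF refl])
    fix p assume "p \<in> ?P"
    have "(\<Prod>i = 0..<n. var (Suc i) ^ e (p i)) = single (monom_at 1 (map (\<lambda>i. e (p i)) [0..<n])) 1"
      using prod_var_power[of 1 "map (\<lambda>i. e (p i)) [0..<n]"] by (simp add: lessThan_atLeast0)
    then show "signof p * (\<Prod>i = 0..<n. var (Suc i) ^ e (p i)) =
        of_int (sign p) * single (monom_at 1 (map (\<lambda>i. e (p i)) [0..<n])) 1" by simp
  qed
  finally have alt: "lookup (alternant (\<lambda>i. var (Suc i)) n e) (monom_at 1 (delta_shift \<mu>)) =
      (\<Sum>p \<in> ?P. sign p * (if map (\<lambda>i. e (p i)) [0..<n] = delta_shift \<mu> then 1 else 0))"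
    using m(1) by (simp add: lookup_sum lookup_of_int_mult lookup_single when_def monom_at_inj
        eq_commute[of "delta_shift \<mu>"])
  have key: "p = id \<and> \<kappa> = \<mu>" if p: "p \<in> ?P" and eq: "map (\<lambda>i. e (p i)) [0..<n] = delta_shift \<mu>" for p
  proof -
    have eqi: "e (p i) = \<mu> ! i + (n - 1 - i)" if "i < n" for i
      using arg_cong[OF eq, of "\<lambda>xs. xs ! i"] that m(1) by (simp add: nth_delta_shift)
    have "p i < p j" if "i < j" "j < n" for i j
    proof (rule ccontr)
      assume "\<not> p i < p j"
      then consider "p i = p j" | "p j < p i" by linarith
      then show False
      proof cases
        case 1
        then show False using eqi[of i] eqi[of j] shifted_strict[OF m that] that by simp
      next
        case 2
        then have "e (p i) < e (p j)"
          unfolding e_def using lt[OF p, of i] that by (intro shifted_strict[OF l]) auto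
        then show False using eqi[of i] eqi[of j] shifted_strict[OF m that] that by simp
      qed
    qed
    then have id: "p = id" using p strict_mono_permutes_id[of p n] by blast
    then have "\<kappa> ! i = \<mu> ! i" if "i < n" for i using eqi[OF that] by (simp add: e_def)
    then show ?thesis using id l(1) m(1) by (simp add: list_eq_iff_nth_eq)
  qed
  have id_ok: "map (\<lambda>i. e (id i)) [0..<n] = delta_shift \<kappa>"
    using l(1) by (simp add: list_eq_iff_nth_eq nth_delta_shift e_def)
  have "(\<Sum>p \<in> ?P. sign p * (if map (\<lambda>i. e (p i)) [0..<n] = delta_shift \<mu> then 1 else 0)) =
      (\<Sum>p \<in> ?P. if p = id then (if \<kappa> = \<mu> then 1 else 0) else 0)"
    by (rule sum.cong[OF refl]) (use key id_ok in auto)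
  also have "\<dots> = (if \<kappa> = \<mu> then 1 else 0)"
    using fin by (simp add: permutes_id)
  finally show ?thesis using alt unfolding e_def by simp
qed

section \<open>Contents of tableaux and Schur polynomials in fewer variables\<close>

definition tab_content :: "nat list \<Rightarrow> nat \<Rightarrow>\<^sub>0 nat" where
  "tab_content xs = sum_list (map (\<lambda>x. single x 1) xs)"

lemma prod_list_var: "prod_list (map var xs) = single (tab_content xs) 1"
  by (induction xs) (auto simp: tab_content_def var_def mult_single)

lemma lookup_content_pos: "x \<in> set xs \<Longrightarrow> lookup (tab_content xs) x > 0"
  by (induction xs) (auto simp: tab_content_def lookup_add lookup_single when_def)

lemma lookup_schur: "lookup (schur n \<mu>) m = (\<Sum>T \<in> SSYT n \<mu>. if tab_content (concat T) = m then 1 else 0)"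
  by (auto simp: schur_def prod_list_var lookup_sum lookup_single when_def intro!: sum.cong)

lemma SSYT_mono: "n \<le> N \<Longrightarrow> SSYT n \<mu> \<subseteq> SSYT N \<mu>"
proof
  fix T assume "n \<le> N" and T: "T \<in> SSYT n \<mu>"
  then have "{1..n} \<subseteq> {1..N}" by simp
  then show "T \<in> SSYT N \<mu>"
    using T unfolding SSYT_def by blast
qed

text \<open>A tableau whose content involves only the first \<open>n\<close> variables has no entry
  above \<open>n\<close>. This is the passage to \<open>length \<mu>\<close> variables for short
  partitions.\<close>

lemma lookup_schur_restrict:
  assumes "length v = n" "n \<le> N"
  shows "lookup (schur N \<mu>) (monom_at 1 v) = lookup (schur n \<mu>) (monom_at 1 v)"
  unfolding lookup_schur
proof (rule sum.mono_neutral_right[OF finite_SSYT SSYT_mono[OF assms(2)]], rule ballI)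
  fix T assume T: "T \<in> SSYT N \<mu> - SSYT n \<mu>"
  have "tab_content (concat T) \<noteq> monom_at 1 v"
  proof
    assume eq: "tab_content (concat T) = monom_at 1 v"
    have "set (concat T) \<subseteq> {1..n}"
    proof
      fix x assume "x \<in> set (concat T)"
      then have "lookup (monom_at 1 v) x > 0" using lookup_content_pos eq by metis
      then show "x \<in> {1..n}" using assms(1) by (auto simp: lookup_monom_at split: if_splits)
    qed
    then have "T \<in> SSYT n \<mu>" using T by (simp add: SSYT_def)
    then show False using T by simp
  qed
  then show "(if tab_content (concat T) = monom_at 1 v then 1 else 0) = 0" by simp
qed

lemma schur_append_zero: "schur n (\<mu> @ [0]) = schur n \<mu>"
  unfolding schur_def
proof (rule sum.reindex_bij_witness[where i = "\<lambda>T. T @ [[]]" and j = butlast])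
  fix T assume T: "T \<in> SSYT n (\<mu> @ [0])"
  then have "map length T = \<mu> @ [0]" by (simp add: SSYT_def)
  then obtain T' where T': "T = T' @ [[]]" "map length T' = \<mu>"
    by (auto simp: map_eq_append_conv)
  have len: "length T' = length \<mu>" using T'(2) by auto
  have row: "T ! i = T' ! i" if "i < length \<mu>" for i using that len by (simp add: T'(1) nth_append)
  have "T' \<in> SSYT n \<mu>"
  proof (rule SSYT_I[OF len])
    fix i assume i: "i < length \<mu>"
    show "length (T' ! i) = \<mu> ! i" using i T'(2) by auto
    show "sorted (T' ! i)" "set (T' ! i) \<subseteq> {1..n}"
      using SSYT_rows(3,4)[OF T, of i] i row[OF i] by simp_all
  next
    fix i j assume "Suc i < length \<mu>" "j < \<mu> ! Suc i"
    then show "T' ! i ! j < T' ! Suc i ! j"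
      using SSYT_rows(5)[OF T, of i j] row[of i] row[of "Suc i"] by (simp add: nth_append)
  qed
  then show "butlast T @ [[]] = T" "butlast T \<in> SSYT n \<mu>"
    "prod_list (map var (concat (butlast T))) = prod_list (map var (concat T))"
    using T' by simp_all
next
  fix T assume T: "T \<in> SSYT n \<mu>"
  show "butlast (T @ [[]]) = T" by simp
  have len: "length T = length \<mu>" using SSYT_rows(1)[OF T] .
  have row: "(T @ [[]]) ! i = (if i < length \<mu> then T ! i else [])" if "i < Suc (length \<mu>)" for i
    using that len by (auto simp: nth_append less_Suc_eq)
  show "T @ [[]] \<in> SSYT n (\<mu> @ [0])"
  proof (rule SSYT_I)
    fix i assume "i < length (\<mu> @ [0])"
    then have i: "i < Suc (length \<mu>)" by simp
    show "length ((T @ [[]]) ! i) = (\<mu> @ [0]) ! i" "sorted ((T @ [[]]) ! i)"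
      "set ((T @ [[]]) ! i) \<subseteq> {1..n}"
      using SSYT_rows(2-4)[OF T, of i] row[OF i] i by (auto simp: nth_append less_Suc_eq)
  next
    fix i j assume i: "Suc i < length (\<mu> @ [0])" and j: "j < (\<mu> @ [0]) ! Suc i"
    then have "Suc i < length \<mu>" by (cases "Suc i = length \<mu>") (simp_all add: nth_append)
    then show "(T @ [[]]) ! i ! j < (T @ [[]]) ! Suc i ! j"
      using SSYT_rows(5)[OF T, of i j] row[of i] row[of "Suc i"] j by (simp add: nth_append)
  qed (simp add: len)
qed

lemma schur_append_zeros: "schur n (\<mu> @ replicate k 0) = schur n \<mu>"
proof (induction k arbitrary: \<mu>)
  case (Suc k)
  have "schur n (\<mu> @ replicate (Suc k) 0) = schur n ((\<mu> @ [0]) @ replicate k 0)" by simp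
  also have "\<dots> = schur n \<mu>" unfolding Suc schur_append_zero ..
  finally show ?case .
qed simp

lemma partition_nth:
  assumes "\<mu> \<in> partitions"
  shows "Suc j < length \<mu> \<Longrightarrow> \<mu> ! Suc j \<le> \<mu> ! j" "j < length \<mu> \<Longrightarrow> 0 < \<mu> ! j"
  using assms by (auto simp: partitions_def compositions_def sorted_wrt_iff_nth_less)

lemma schur_eq_0:
  assumes "\<mu> \<in> partitions" "n < length \<mu>"
  shows "schur n \<mu> = 0"
proof -
  have "False" if T: "T \<in> SSYT n \<mu>" for T
  proof -
    have "Suc n \<le> T ! n ! 0"
      by (rule SSYT_entry_ge[OF T]) (use assms partition_nth[OF assms(1)] in auto)
    moreover have "T ! n ! 0 \<in> set (T ! n)"
      using SSYT_rows(2)[OF T, of n] assms(2) partition_nth(2)[OF assms(1), of n] by (intro nth_mem) simp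
    then have "T ! n ! 0 \<le> n" using SSYT_rows(4)[OF T, of n] assms(2) by auto
    ultimately show False by simp
  qed
  then have "SSYT n \<mu> = {}" by blast
  then show ?thesis by (simp add: schur_def)
qed

text \<open>Padding a short \<open>\<kappa>\<close> with zeros brings it into the range of the
  bialternant formula, while for a longer \<open>\<kappa>\<close> the Schur polynomial vanishes. The
  padded list equals \<open>\<mu>\<close> only if no zero was added, because the parts of
  \<open>\<mu>\<close> are positive.\<close>

theorem lookup_vandermonde_schur:
  assumes "\<kappa> \<in> partitions" "\<mu> \<in> partitions"
  shows "lookup (vandermonde 1 (length \<mu>) * schur (length \<mu>) \<kappa>) (monom_at 1 (delta_shift \<mu>)) =
    (if \<kappa> = \<mu> then 1 else 0)"
proof (cases "length \<kappa> \<le> length \<mu>")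
  case False
  then show ?thesis using schur_eq_0[OF assms(1), of "length \<mu>"] by auto
next
  case True
  let ?n = "length \<mu>"
  define l where "l = \<kappa> @ replicate (?n - length \<kappa>) 0"
  have len: "length l = ?n" using True by (simp add: l_def)
  have dec: "l ! Suc j \<le> l ! j" if "Suc j < ?n" for j
    using partition_nth(1)[OF assms(1), of j] that True by (auto simp: l_def nth_append)
  have eq: "l = \<mu> \<longleftrightarrow> \<kappa> = \<mu>"
  proof
    assume lm: "l = \<mu>"
    have "length \<kappa> = ?n"
    proof (rule ccontr)
      assume "length \<kappa> \<noteq> ?n"
      then have lt: "length \<kappa> < ?n" using True by simp
      then have "l ! length \<kappa> = 0" by (simp add: l_def nth_append)
      then show False using partition_nth(2)[OF assms(2) lt] lm by simp
    qed
    then show "\<kappa> = \<mu>" using lm by (simp add: l_def)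
  qed (simp add: l_def)
  have "lookup (vandermonde 1 ?n * schur ?n l) (monom_at 1 (delta_shift \<mu>)) = (if l = \<mu> then 1 else 0)"
    using vandermonde_schur[OF len dec] lookup_alternant[OF len dec refl partition_nth(1)[OF assms(2)]]
    by simp
  then show ?thesis unfolding eq by (simp add: l_def schur_append_zeros)
qed

theorem stage_sum_schur_expansion:
  assumes "expands_in (schur N) (partitions_upto N) g d" "\<mu> \<in> partitions_upto N"
  shows "stage_sum (rev \<mu>) [] (\<lambda>v. lookup g (monom_at 1 v)) = d \<mu>"
proof -
  let ?I = "{i. i \<in> partitions_upto N \<and> d i \<noteq> 0}" and ?n = "length \<mu>"
  have fin: "finite ?I" and g: "g = (\<Sum>i \<in> ?I. of_int (d i) * schur N i)"
    using assms(1) by (auto simp: expands_in_def)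
  have n: "?n \<le> N" and \<mu>: "\<mu> \<in> partitions" using assms(2) by (auto simp: partitions_upto_def)
  \<comment> \<open>Only monomials in the first \<open>length \<mu>\<close> variables are read off,
    so \<open>schur N\<close> may be replaced by \<open>schur ?n\<close>, to which the bialternant
    formula in exactly \<open>length \<mu>\<close> variables applies.\<close>
  define g' where "g' = (\<Sum>i \<in> ?I. of_int (d i) * schur ?n i)"
  have "stage_sum (rev \<mu>) [] (\<lambda>v. lookup g (monom_at 1 v)) = stage_sum (rev \<mu>) [] (\<lambda>v. lookup g' (0 + monom_at 1 v))"
  proof (rule stage_sum_cong)
    fix v :: "nat list" assume "length v = length (rev \<mu>) + length ([] :: nat list)"
    then have "length v = ?n" by simp
    then have "lookup (schur N i) (monom_at 1 v) = lookup (schur ?n i) (monom_at 1 v)" for i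
      using n by (rule lookup_schur_restrict)
    then show "lookup g (monom_at 1 v) = lookup g' (0 + monom_at 1 v)"
      by (simp add: g g'_def lookup_sum lookup_of_int_mult)
  qed
  also have "\<dots> = lookup (vandermonde 1 ?n * g') (monom_at 1 (delta_shift \<mu>))"
    using stage_sum_lookup[of 1 0 \<mu> g'] by simp
  also have "vandermonde 1 ?n * g' = (\<Sum>i \<in> ?I. of_int (d i) * (vandermonde 1 ?n * schur ?n i))"
    unfolding g'_def sum_distrib_left by (rule sum.cong) (simp_all add: mult.left_commute)
  also have "lookup \<dots> (monom_at 1 (delta_shift \<mu>)) = (\<Sum>i \<in> ?I. d i * (if i = \<mu> then 1 else 0))"
    unfolding lookup_sum lookup_of_int_mult
  proof (rule sum.cong[OF refl])
    fix i assume "i \<in> ?I"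
    then have "i \<in> partitions" by (simp add: partitions_upto_def)
    then show "d i * lookup (vandermonde 1 ?n * schur ?n i) (monom_at 1 (delta_shift \<mu>)) =
        d i * (if i = \<mu> then 1 else 0)"
      using \<mu> by (simp only: lookup_vandermonde_schur)
  qed
  also have "\<dots> = d \<mu>"
    using fin assms(2) by (auto simp: if_distrib sum.delta cong: if_cong)
  finally show ?thesis .
qed

section \<open>Quasisymmetric coefficients and the theorem\<close>

fun indexed_monom :: "nat list \<Rightarrow> nat list \<Rightarrow> nat \<Rightarrow>\<^sub>0 nat" where
  "indexed_monom (i # is) (a # as) = single i a + indexed_monom is as"
| "indexed_monom _ _ = 0"

fun support_from :: "nat \<Rightarrow> nat list \<Rightarrow> nat list" where
  "support_from k [] = []"
| "support_from k (v # vs) = (if v = 0 then support_from (Suc k) vs else k # support_from (Suc k) vs)"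

definition nonzero_parts :: "nat list \<Rightarrow> nat list" where
  "nonzero_parts v = filter (\<lambda>a. a \<noteq> 0) v"

lemma nonzero_parts_simps [simp]:
  "nonzero_parts [] = []"
  "nonzero_parts (a # v) = (if a = 0 then nonzero_parts v else a # nonzero_parts v)"
  by (simp_all add: nonzero_parts_def)

lemma nonzero_parts_composition: "nonzero_parts v \<in> compositions"
  by (auto simp: compositions_def nonzero_parts_def)

lemma nonzero_parts_length: "length (nonzero_parts v) \<le> length v"
  by (simp add: nonzero_parts_def)

lemma support_from_ge: "i \<in> set (support_from k vs) \<Longrightarrow> k \<le> i \<and> i < k + length vs"
  by (induction vs arbitrary: k) (fastforce split: if_splits)+

lemma support_from_sorted: "sorted_wrt (<) (support_from k vs)"
  by (induction vs arbitrary: k) (auto dest: support_from_ge)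

lemma length_support_from: "length (support_from k vs) = length (nonzero_parts vs)"
  by (induction vs arbitrary: k) auto

lemma prod_indexed_monom: "length is = length as \<Longrightarrow>
    (\<Prod>j<length as. var (is ! j) ^ (as ! j)) = single (indexed_monom is as) 1"
proof (induction "is" as rule: list_induct2)
  case (Cons i "is" a as)
  then show ?case unfolding length_Cons prod.lessThan_Suc_shift
    by (simp add: var_power mult_single)
qed simp

lemma lookup_indexed_monom_notin: "i \<notin> set is \<Longrightarrow> lookup (indexed_monom is as) i = 0"
  by (induction "is" as rule: indexed_monom.induct) (auto simp: lookup_add lookup_single when_def)

lemma lookup_indexed_monom_pos:
  "length is = length as \<Longrightarrow> i \<in> set is \<Longrightarrow> \<forall>a \<in> set as. a > 0 \<Longrightarrow> lookup (indexed_monom is as) i > 0"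
  by (induction "is" as rule: list_induct2) (auto simp: lookup_add lookup_single when_def)

text \<open>An exponent vector determines its support in increasing order and its nonzero entries,
  so exactly one index list of a monomial quasisymmetric polynomial can produce it. The induction
  compares exponents at \<open>k\<close>.\<close>

lemma indexed_monom_eq_monom_at:
  assumes "length is = length as" "sorted_wrt (<) is" "\<forall>i \<in> set is. k \<le> i" "\<forall>a \<in> set as. a > 0"
  shows "indexed_monom is as = monom_at k v \<longleftrightarrow> as = nonzero_parts v \<and> is = support_from k v"
  using assms
proof (induction v arbitrary: "is" as k)
  case Nil
  show ?case
  proof
    assume eq: "indexed_monom is as = monom_at k []"
    have "is = []"
    proof (rule ccontr)
      assume "is \<noteq> []"
      then have "hd is \<in> set is" by simp
      then have "lookup (indexed_monom is as) (hd is) > 0"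
        using lookup_indexed_monom_pos Nil.prems by blast
      then show False using eq by simp
    qed
    then show "as = nonzero_parts [] \<and> is = support_from k []" using Nil.prems by simp
  qed simp
next
  case (Cons x v)
  show ?case
  proof (cases "x = 0")
    case True
    have gt: "(\<forall>i \<in> set is. Suc k \<le> i)" if "k \<notin> set is"
      using Cons.prems(3) that by (metis Suc_leI le_neq_implies_less)
    show ?thesis
    proof (cases "k \<in> set is")
      case k: True
      then have "lookup (indexed_monom is as) k > 0" using lookup_indexed_monom_pos Cons.prems by blast
      moreover have "lookup (monom_at k (x # v)) k = 0" using lookup_monom_at[of k "x # v" k] True by simp
      ultimately have "indexed_monom is as \<noteq> monom_at k (x # v)" by auto
      moreover have "is \<noteq> support_from k (x # v)" using k support_from_ge[of k "Suc k" v] True by auto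
      ultimately show ?thesis by blast
    next
      case False
      then show ?thesis using Cons.IH[OF Cons.prems(1,2) gt[OF False] Cons.prems(4)] True by simp
    qed
  next
    case False
    show ?thesis
    proof (cases "is")
      case Nil
      then have "indexed_monom is as = 0" using Cons.prems by simp
      moreover have "lookup (monom_at k (x # v)) k = x" using lookup_monom_at[of k "x # v" k] by simp
      ultimately show ?thesis using False Nil by auto
    next
      case is_Cons: (Cons i is')
      then obtain a as' where as_Cons: "as = a # as'" using Cons.prems(1) by (cases as) auto
      have i: "k \<le> i" "\<forall>j \<in> set is'. i < j" using Cons.prems is_Cons by auto
      have IH: "indexed_monom is' as' = monom_at (Suc k) v \<longleftrightarrow>
          as' = nonzero_parts v \<and> is' = support_from (Suc k) v"
        by (rule Cons.IH) (use Cons.prems is_Cons as_Cons i in auto)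
      have l: "lookup (indexed_monom is as) k = (if i = k then a else 0)"
      proof -
        have "k \<notin> set is'" using i by auto
        then show ?thesis using is_Cons as_Cons
          by (simp add: lookup_add lookup_single lookup_indexed_monom_notin when_def)
      qed
      have r: "lookup (monom_at k (x # v)) k = x" using lookup_monom_at[of k "x # v" k] by simp
      show ?thesis
      proof (cases "i = k \<and> a = x")
        case True
        then show ?thesis using IH is_Cons as_Cons False by simp
      next
        case ne: False
        have "indexed_monom is as \<noteq> monom_at k (x # v)"
        proof
          assume "indexed_monom is as = monom_at k (x # v)"
          then have "(if i = k then a else 0) = x" using l r by simp
          then show False using ne False by (auto split: if_splits)
        qed
        moreover have "\<not> (as = nonzero_parts (x # v) \<and> is = support_from k (x # v))"
          using ne is_Cons as_Cons False by auto
        ultimately show ?thesis by blast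
      qed
    qed
  qed
qed

lemma lookup_monomial_qsym:
  assumes "\<alpha> \<in> compositions" "length v \<le> N"
  shows "lookup (monomial_qsym N \<alpha>) (monom_at 1 v) = (if nonzero_parts v = \<alpha> then 1 else 0)"
proof -
  let ?J = "{is. length is = length \<alpha> \<and> sorted_wrt (<) is \<and> set is \<subseteq> {1..N}}"
  have fin: "finite ?J"
    by (rule finite_subset[OF _ finite_lists_length_eq[of "{1..N}" "length \<alpha>"]]) auto
  have "lookup (monomial_qsym N \<alpha>) (monom_at 1 v) =
      (\<Sum>is \<in> ?J. if indexed_monom is \<alpha> = monom_at 1 v then 1 else 0)"
    unfolding monomial_qsym_def lookup_sum
    by (rule sum.cong[OF refl]) (auto simp: prod_indexed_monom lookup_single when_def)
  also have "\<dots> = (\<Sum>is \<in> ?J. if is = support_from 1 v then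
      (if nonzero_parts v = \<alpha> then 1 else 0) else 0)"
  proof (rule sum.cong[OF refl])
    fix "is" assume "is \<in> ?J"
    then have "indexed_monom is \<alpha> = monom_at 1 v \<longleftrightarrow> \<alpha> = nonzero_parts v \<and> is = support_from 1 v"
      using assms(1) by (intro indexed_monom_eq_monom_at) (auto simp: compositions_def)
    then show "(if indexed_monom is \<alpha> = monom_at 1 v then 1 else (0 :: int)) =
      (if is = support_from 1 v then (if nonzero_parts v = \<alpha> then 1 else 0) else 0)" by auto
  qed
  also have "\<dots> = (if support_from 1 v \<in> ?J then (if nonzero_parts v = \<alpha> then 1 else 0) else 0)"
    by (rule sum.delta[OF fin])
  also have "\<dots> = (if nonzero_parts v = \<alpha> then 1 else 0)"
  proof (cases "nonzero_parts v = \<alpha>")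
    case True
    have "set (support_from 1 v) \<subseteq> {1..N}" using assms(2) by (auto dest: support_from_ge)
    then have "support_from 1 v \<in> ?J" using True by (simp add: length_support_from support_from_sorted)
    then show ?thesis by simp
  qed simp
  finally show ?thesis .
qed

section \<open>Refinement of compositions\<close>

lemma comp_refines_sum: "comp_refines \<beta> \<alpha> \<Longrightarrow> sum_list \<beta> = sum_list \<alpha>"
proof -
  have "sum_list (concat bs) = sum_list (map sum_list bs)" for bs :: "nat list list"
    by (induction bs) auto
  then show "comp_refines \<beta> \<alpha> \<Longrightarrow> sum_list \<beta> = sum_list \<alpha>" by (auto simp: comp_refines_def)
qed

lemma comp_refines_length: "comp_refines \<beta> \<alpha> \<Longrightarrow> length \<alpha> \<le> length \<beta>"
proof -
  have "[] \<notin> set bs \<Longrightarrow> length bs \<le> length (concat bs)" for bs :: "nat list list"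
  proof (induction bs)
    case (Cons b bs)
    then have "1 \<le> length b" by (cases b) auto
    moreover have "length bs \<le> length (concat bs)" using Cons by simp
    ultimately have "1 + length bs \<le> length b + length (concat bs)" by (rule add_mono)
    then show ?case by simp
  qed simp
  then show "comp_refines \<beta> \<alpha> \<Longrightarrow> length \<alpha> \<le> length \<beta>" by (auto simp: comp_refines_def)
qed

lemma comp_refines_composition: "comp_refines \<beta> \<alpha> \<Longrightarrow> \<beta> \<in> compositions \<Longrightarrow> \<alpha> \<in> compositions"
proof -
  assume "comp_refines \<beta> \<alpha>" and \<beta>: "\<beta> \<in> compositions"
  then obtain bs where bs: "[] \<notin> set bs" "concat bs = \<beta>" "map sum_list bs = \<alpha>"
    by (auto simp: comp_refines_def)
  have "sum_list b > 0" if b: "b \<in> set bs" for b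
  proof (cases b)
    case Nil
    then show ?thesis using bs(1) b by simp
  next
    case (Cons x b')
    then have "x \<in> set \<beta>" using b bs(2) by force
    then show ?thesis using \<beta> Cons by (simp add: compositions_def)
  qed
  then show "\<alpha> \<in> compositions" using bs(3) by (auto simp: compositions_def)
qed

lemma composition_length_le: "\<beta> \<in> compositions \<Longrightarrow> length \<beta> \<le> sum_list \<beta>"
  by (induction \<beta>) (auto simp: compositions_def)

lemma finite_refinements: "finite {\<beta>. \<beta> \<in> compositions \<and> comp_refines \<beta> \<alpha>}"
proof (rule finite_subset)
  show "{\<beta>. \<beta> \<in> compositions \<and> comp_refines \<beta> \<alpha>} \<subseteq>
      {\<beta>. set \<beta> \<subseteq> {..sum_list \<alpha>} \<and> length \<beta> \<le> sum_list \<alpha>}"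
  proof
    fix \<beta> assume "\<beta> \<in> {\<beta>. \<beta> \<in> compositions \<and> comp_refines \<beta> \<alpha>}"
    then have "\<beta> \<in> compositions" "sum_list \<beta> = sum_list \<alpha>" by (auto dest: comp_refines_sum)
    then show "\<beta> \<in> {\<beta>. set \<beta> \<subseteq> {..sum_list \<alpha>} \<and> length \<beta> \<le> sum_list \<alpha>}"
      using composition_length_le[of \<beta>] member_le_sum_list[of _ \<beta>] by auto
  qed
  show "finite {\<beta>. set \<beta> \<subseteq> {..sum_list \<alpha>} \<and> length \<beta> \<le> sum_list \<alpha>}"
    by (rule finite_lists_length_le) simp
qed

lemma lookup_fundamental_qsym:
  assumes "length v \<le> N"
  shows "lookup (fundamental_qsym N \<alpha>) (monom_at 1 v) =
    (if comp_refines (nonzero_parts v) \<alpha> then 1 else 0)"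
proof -
  have "lookup (fundamental_qsym N \<alpha>) (monom_at 1 v) =
      (\<Sum>\<beta> \<in> {\<beta>. \<beta> \<in> compositions \<and> comp_refines \<beta> \<alpha>}. if \<beta> = nonzero_parts v then 1 else 0)"
    unfolding fundamental_qsym_def lookup_sum
  proof (rule sum.cong[OF refl])
    fix \<beta> assume "\<beta> \<in> {\<beta>. \<beta> \<in> compositions \<and> comp_refines \<beta> \<alpha>}"
    then show "lookup (monomial_qsym N \<beta>) (monom_at 1 v) = (if \<beta> = nonzero_parts v then 1 else 0)"
      using lookup_monomial_qsym[OF _ assms, of \<beta>] by auto
  qed
  also have "\<dots> = (if nonzero_parts v \<in> {\<beta>. \<beta> \<in> compositions \<and> comp_refines \<beta> \<alpha>} then 1 else 0)"
    by (rule sum.delta[OF finite_refinements])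
  finally show ?thesis using nonzero_parts_composition by simp
qed

lemma comp_refines_Nil: "comp_refines [] \<gamma> \<longleftrightarrow> \<gamma> = []"
proof
  assume "comp_refines [] \<gamma>"
  then have "length \<gamma> \<le> length ([] :: nat list)" by (rule comp_refines_length)
  then show "\<gamma> = []" by simp
next
  assume "\<gamma> = []"
  then show "comp_refines [] \<gamma>" by (simp add: comp_refines_def)
qed

lemma comp_refines_single: "comp_refines [x] \<gamma> \<longleftrightarrow> \<gamma> = [x]"
proof
  assume r: "comp_refines [x] \<gamma>"
  then obtain bs where bs: "[] \<notin> set bs" "concat bs = [x]" "map sum_list bs = \<gamma>"
    by (auto simp: comp_refines_def)
  then obtain b bs' where b: "bs = b # bs'" by (cases bs) auto
  moreover have "length bs \<le> 1" using comp_refines_length[OF r] bs(3) by auto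
  ultimately show "\<gamma> = [x]" using bs by auto
next
  assume "\<gamma> = [x]"
  then show "comp_refines [x] \<gamma>" unfolding comp_refines_def by (intro exI[of _ "[[x]]"]) simp
qed

text \<open>The boundary between the first two parts is either kept or erased; each bit of a
  coarsening records such a choice.\<close>

lemma comp_refines_Cons2:
  "comp_refines (x # y # ys) \<gamma> \<longleftrightarrow>
    (\<exists>\<beta>. \<gamma> = x # \<beta> \<and> comp_refines (y # ys) \<beta>) \<or> comp_refines ((x + y) # ys) \<gamma>"
proof
  assume "comp_refines (x # y # ys) \<gamma>"
  then obtain bs where bs: "[] \<notin> set bs" "concat bs = x # y # ys" "map sum_list bs = \<gamma>"
    by (auto simp: comp_refines_def)
  then obtain b bs' where b: "bs = b # bs'" by (cases bs) auto
  then obtain b' where b': "b = x # b'" using bs by (cases b) auto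
  show "(\<exists>\<beta>. \<gamma> = x # \<beta> \<and> comp_refines (y # ys) \<beta>) \<or> comp_refines ((x + y) # ys) \<gamma>"
  proof (cases b')
    case Nil
    then have "comp_refines (y # ys) (map sum_list bs')" "\<gamma> = x # map sum_list bs'"
      using bs b b' unfolding comp_refines_def by auto
    then show ?thesis by blast
  next
    case (Cons z b'')
    then have "comp_refines ((x + y) # ys) \<gamma>"
      using bs b b' unfolding comp_refines_def
      by (intro exI[of _ "((x + y) # b'') # bs'"]) auto
    then show ?thesis by blast
  qed
next
  assume "(\<exists>\<beta>. \<gamma> = x # \<beta> \<and> comp_refines (y # ys) \<beta>) \<or> comp_refines ((x + y) # ys) \<gamma>"
  then show "comp_refines (x # y # ys) \<gamma>"
  proof
    assume "\<exists>\<beta>. \<gamma> = x # \<beta> \<and> comp_refines (y # ys) \<beta>"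
    then obtain bs where "[] \<notin> set bs" "concat bs = y # ys" "\<gamma> = x # map sum_list bs"
      by (auto simp: comp_refines_def)
    then show ?thesis unfolding comp_refines_def by (intro exI[of _ "[x] # bs"]) auto
  next
    assume "comp_refines ((x + y) # ys) \<gamma>"
    then obtain bs where bs: "[] \<notin> set bs" "concat bs = (x + y) # ys" "map sum_list bs = \<gamma>"
      by (auto simp: comp_refines_def)
    then obtain b bs' where b: "bs = b # bs'" by (cases bs) auto
    then obtain b' where b': "b = (x + y) # b'" using bs by (cases b) auto
    show ?thesis unfolding comp_refines_def
      using bs b b' by (intro exI[of _ "(x # y # b') # bs'"]) auto
  qed
qed

text \<open>The accumulator \<open>a\<close> is the part still open, as in \<open>coarsenf\<close>.
  A part left open at the end yields nothing, in accordance with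
  \<open>closed_output\<close>.\<close>

fun coarsenings :: "nat \<Rightarrow> nat list \<Rightarrow> nat list set" where
  "coarsenings a [] = (if a = 0 then {[]} else {})"
| "coarsenings a (p # ps) = (#) (a + p) ` coarsenings 0 ps \<union> coarsenings (a + p) ps"

lemma finite_coarsenings: "finite (coarsenings a ps)"
  by (induction ps arbitrary: a) auto

text \<open>Separates the two alternatives of the recursion: closing a part makes the first entry
  equal to the accumulator, leaving it open makes it strictly larger, as parts are positive. Hence
  different bit strings give different coarsenings.\<close>

lemma coarsenings_hd: "\<beta> \<in> coarsenings a ps \<Longrightarrow> 0 < a \<Longrightarrow> ps \<in> compositions \<Longrightarrow> \<beta> \<noteq> [] \<and> a < hd \<beta>"
proof (induction ps arbitrary: a)
  case (Cons p ps)
  have p: "0 < p" "ps \<in> compositions" using Cons.prems(3) by (auto simp: compositions_def)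
  from Cons.prems(1) consider "\<beta> \<in> (#) (a + p) ` coarsenings 0 ps" | "\<beta> \<in> coarsenings (a + p) ps" by auto
  then show ?case
  proof cases
    case 1
    then show ?thesis using p by auto
  next
    case 2
    then have "\<beta> \<noteq> [] \<and> a + p < hd \<beta>" using p by (intro Cons.IH) auto
    then show ?thesis by simp
  qed
qed (simp split: if_splits)

lemma coarsenings_Cons_eq:
  "(p # ps) \<in> compositions \<Longrightarrow> coarsenings a (p # ps) = {\<beta>. comp_refines ((a + p) # ps) \<beta>}"
proof (induction ps arbitrary: a p)
  case Nil
  then show ?case by (auto simp: comp_refines_single compositions_def)
next
  case (Cons q qs)
  have qc: "q # qs \<in> compositions" using Cons.prems by (simp add: compositions_def)
  have "coarsenings a (p # q # qs) = (#) (a + p) ` {\<beta>. comp_refines (q # qs) \<beta>} \<union>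
      {\<beta>. comp_refines ((a + p + q) # qs) \<beta>}"
    using Cons.IH[OF qc, of 0] Cons.IH[OF qc, of "a + p"] coarsenings.simps(2)[of a p "q # qs"] by simp
  then show ?case by (auto simp: comp_refines_Cons2)
qed

lemma coarsenings_eq: "ps \<in> compositions \<Longrightarrow> coarsenings 0 ps = {\<beta>. comp_refines ps \<beta>}"
  by (cases ps) (auto simp: comp_refines_Nil coarsenings_Cons_eq simp del: coarsenings.simps(2))

lemma nonzero_parts_upto: "length v \<le> N \<Longrightarrow> nonzero_parts v \<in> compositions_upto N"
  using nonzero_parts_length[of v] nonzero_parts_composition[of v] by (simp add: compositions_upto_def)

text \<open>Merging never increases the number of parts, so coarsenings stay in the range where
  \<open>c\<close> is given by a GapP function.\<close>

lemma coarsenings_upto: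
  assumes "length v \<le> N"
  shows "coarsenings 0 (nonzero_parts v) \<subseteq> compositions_upto N"
  using nonzero_parts_upto[OF assms] comp_refines_length comp_refines_composition
  by (fastforce simp: coarsenings_eq nonzero_parts_composition compositions_upto_def)

lemma unary_snoc: "unary (\<alpha> @ [a]) = unary \<alpha> @ replicate a True @ [False]"
  by (simp add: unary_def)

lemma closed_output_rev_unary: "closed_output (rev (unary \<alpha>))"
  by (cases \<alpha> rule: rev_cases) (simp_all add: closed_output_def unary_snoc)

text \<open>On the reversed output, \<open>replicate a True\<close> is the open part and
  \<open>\<alpha>\<close> lists the closed ones. The sum over bits becomes a sum over a set because
  the two alternatives of each bit give disjoint sets.\<close>

lemma coarsen_sum_coarsenings:
  assumes "\<And>\<alpha>. K (unary \<alpha>) = H \<alpha>"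
  shows "coarsen_sum False vs (replicate a True @ rev (unary \<alpha>)) (\<lambda>z. if closed_output z then K (rev z) else 0) =
    (\<Sum>\<beta> \<in> coarsenings a (nonzero_parts vs). H (\<alpha> @ \<beta>))"
proof (induction vs arbitrary: a \<alpha>)
  case Nil
  show ?case
  proof (cases a)
    case 0
    then show ?thesis using assms by (simp add: closed_output_rev_unary)
  qed (simp add: closed_output_def)
next
  case (Cons v vs)
  let ?F = "\<lambda>z. if closed_output z then K (rev z) else 0"
  let ?ps = "nonzero_parts vs"
  show ?case
  proof (cases "v = 0")
    case True
    then show ?thesis using Cons by simp
  next
    case False
    have "False # replicate v True @ replicate a True @ rev (unary \<alpha>) =
        replicate 0 True @ rev (unary (\<alpha> @ [a + v]))"
      by (simp add: unary_snoc replicate_add[symmetric] add.commute)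
    then have 1: "coarsen_sum False vs (False # replicate v True @ replicate a True @ rev (unary \<alpha>)) ?F =
        (\<Sum>\<beta> \<in> coarsenings 0 ?ps. H ((\<alpha> @ [a + v]) @ \<beta>))"
      using Cons[of 0 "\<alpha> @ [a + v]"] by simp
    have eq: "replicate v True @ replicate a True @ rev (unary \<alpha>) = replicate (a + v) True @ rev (unary \<alpha>)"
      by (simp add: replicate_add add.commute[of a])
    have 2: "coarsen_sum False vs (replicate v True @ replicate a True @ rev (unary \<alpha>)) ?F =
        (\<Sum>\<beta> \<in> coarsenings (a + v) ?ps. H (\<alpha> @ \<beta>))"
      unfolding eq by (rule Cons)
    have disj: "(#) (a + v) ` coarsenings 0 ?ps \<inter> coarsenings (a + v) ?ps = {}"
      using coarsenings_hd[of _ "a + v" ?ps] False nonzero_parts_composition by force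
    have "(\<Sum>\<beta> \<in> coarsenings a (nonzero_parts (v # vs)). H (\<alpha> @ \<beta>)) =
        (\<Sum>\<beta> \<in> (#) (a + v) ` coarsenings 0 ?ps. H (\<alpha> @ \<beta>)) + (\<Sum>\<beta> \<in> coarsenings (a + v) ?ps. H (\<alpha> @ \<beta>))"
      using False disj by (simp add: sum.union_disjoint finite_coarsenings)
    also have "(\<Sum>\<beta> \<in> (#) (a + v) ` coarsenings 0 ?ps. H (\<alpha> @ \<beta>)) =
        (\<Sum>\<beta> \<in> coarsenings 0 ?ps. H ((\<alpha> @ [a + v]) @ \<beta>))"
      by (subst sum.reindex) auto
    finally show ?thesis using False 1 2 by simp
  qed
qed

text \<open>With merging forbidden only the bit string of ones survives, so a single term
  remains.\<close>

lemma coarsen_sum_strict: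
  "coarsen_sum True vs z F = F (rev (unary (nonzero_parts vs)) @ z)"
  by (induction vs arbitrary: z) simp_all

text \<open>\<open>F_\<alpha>\<close> contributes once whenever \<open>\<alpha>\<close> is coarser
  than the nonzero parts of \<open>v\<close>. Coarsenings with \<open>c \<alpha> = 0\<close> are
  absent from the index set of \<open>expands_in\<close> and are added back as zero terms.\<close>

lemma lookup_fundamental_expansion:
  assumes ex: "expands_in (fundamental_qsym N) (compositions_upto N) g c" and v: "length v \<le> N"
  shows "lookup g (monom_at 1 v) = (\<Sum>\<alpha> \<in> coarsenings 0 (nonzero_parts v). c \<alpha>)"
proof -
  let ?I = "{i. i \<in> compositions_upto N \<and> c i \<noteq> 0}" and ?f = "nonzero_parts v"
  have fin: "finite ?I" and g: "g = (\<Sum>i \<in> ?I. of_int (c i) * fundamental_qsym N i)"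
    using ex by (auto simp: expands_in_def)
  have C: "coarsenings 0 ?f = {\<beta>. comp_refines ?f \<beta>}"
    by (rule coarsenings_eq[OF nonzero_parts_composition])
  have "lookup g (monom_at 1 v) = (\<Sum>i \<in> ?I. if comp_refines ?f i then c i else 0)"
    unfolding g lookup_sum lookup_of_int_mult lookup_fundamental_qsym[OF v]
    by (rule sum.cong) auto
  also have "\<dots> = (\<Sum>i \<in> ?I \<inter> coarsenings 0 ?f. c i)"
    unfolding C using sum.inter_restrict[OF fin, of c "{\<beta>. comp_refines ?f \<beta>}"] by simp
  also have "\<dots> = (\<Sum>i \<in> coarsenings 0 ?f. c i)"
    by (rule sum.mono_neutral_left[OF finite_coarsenings]) (use coarsenings_upto[OF v] in auto)
  finally show ?thesis .
qed

lemma lookup_monomial_expansion: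
  assumes ex: "expands_in (monomial_qsym N) (compositions_upto N) g c" and v: "length v \<le> N"
  shows "lookup g (monom_at 1 v) = c (nonzero_parts v)"
proof -
  let ?I = "{i. i \<in> compositions_upto N \<and> c i \<noteq> 0}" and ?f = "nonzero_parts v"
  have fin: "finite ?I" and g: "g = (\<Sum>i \<in> ?I. of_int (c i) * monomial_qsym N i)"
    using ex by (auto simp: expands_in_def)
  have f: "?f \<in> compositions_upto N" using v by (rule nonzero_parts_upto)
  have "lookup g (monom_at 1 v) = (\<Sum>i \<in> ?I. if i = ?f then c ?f else 0)"
    unfolding g lookup_sum lookup_of_int_mult
  proof (rule sum.cong[OF refl])
    fix i assume "i \<in> ?I"
    then show "c i * lookup (monomial_qsym N i) (monom_at 1 v) = (if i = ?f then c ?f else 0)"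
      using lookup_monomial_qsym[OF _ v, of i] by (auto simp: compositions_upto_def)
  qed
  also have "\<dots> = (if ?f \<in> ?I then c ?f else 0)" by (rule sum.delta[OF fin])
  finally show ?thesis using f by simp
qed

theorem theorem8p1:
  fixes A :: "nat \<Rightarrow> bool list set"
    and G :: "bool list \<Rightarrow> mpoly"
    and c d :: "bool list \<Rightarrow> nat list \<Rightarrow> int"
  assumes size: "\<forall>n. \<forall>w \<in> A n. length w = n"
    and sym: "\<forall>n. \<forall>w \<in> A n. symmetric_poly n (G w)"
    and c_gapP: "gapP_on {(w, \<alpha>). \<exists>n. w \<in> A n \<and> \<alpha> \<in> compositions_upto n} encode (\<lambda>(w, \<alpha>). c w \<alpha>)"
    and d: "\<forall>n. \<forall>w \<in> A n. expands_in (schur n) (partitions_upto n) (G w) (d w)"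
  shows "((\<forall>n. \<forall>w \<in> A n. expands_in (fundamental_qsym n) (compositions_upto n) (G w) (c w)) \<longrightarrow>
            gapP_on {(w, \<mu>). \<exists>n. w \<in> A n \<and> \<mu> \<in> partitions_upto n} encode (\<lambda>(w, \<mu>). d w \<mu>))
       \<and> ((\<forall>n. \<forall>w \<in> A n. expands_in (monomial_qsym n) (compositions_upto n) (G w) (c w)) \<longrightarrow>
            gapP_on {(w, \<mu>). \<exists>n. w \<in> A n \<and> \<mu> \<in> partitions_upto n} encode (\<lambda>(w, \<mu>). d w \<mu>))"
proof -
  obtain h where h: "h \<in> GapP"
    "\<And>w \<alpha> n. w \<in> A n \<Longrightarrow> \<alpha> \<in> compositions_upto n \<Longrightarrow> c w \<alpha> = h (encode (w, \<alpha>))"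
    using c_gapP unfolding gapP_on_def by fastforce
  let ?F = "\<lambda>w z. if closed_output z then h (word_pair w (rev z)) else 0"
  \<comment> \<open>The two bases differ only in the flag \<open>strict\<close>; what remains for
    each is that the coarsening sum reproduces the coefficients of \<open>G w\<close>.\<close>
  have *: "gapP_on {(w, \<mu>). \<exists>n. w \<in> A n \<and> \<mu> \<in> partitions_upto n} encode (\<lambda>(w, \<mu>). d w \<mu>)"
    if coeff: "\<And>w n v. w \<in> A n \<Longrightarrow> length v \<le> n \<Longrightarrow>
      coarsen_sum strict v [] (?F w) = lookup (G w) (monom_at 1 v)" for strict
  proof -
    obtain h' where h': "h' \<in> GapP" "\<And>w \<mu>. h' (encode (w, \<mu>)) =
        stage_sum (rev \<mu>) [] (\<lambda>vs. coarsen_sum strict vs [] (?F w))"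
      using GapP_stage_sum[OF h(1), of strict] by auto
    have "d w \<mu> = h' (encode (w, \<mu>))" if w: "w \<in> A n" and \<mu>: "\<mu> \<in> partitions_upto n" for w \<mu> n
    proof -
      have "length \<mu> \<le> n" using \<mu> by (simp add: partitions_upto_def)
      then have "stage_sum (rev \<mu>) [] (\<lambda>vs. coarsen_sum strict vs [] (?F w)) =
          stage_sum (rev \<mu>) [] (\<lambda>v. lookup (G w) (monom_at 1 v))"
        by (intro stage_sum_cong coeff[OF w]) simp
      also have "\<dots> = d w \<mu>"
        using d w by (intro stage_sum_schur_expansion[OF _ \<mu>]) blast
      finally show ?thesis using h'(2) by simp
    qed
    then show ?thesis unfolding gapP_on_def using h'(1) by (intro bexI[of _ h']) auto
  qed
  show ?thesis
  proof (intro conjI impI)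
    assume F: "\<forall>n. \<forall>w \<in> A n. expands_in (fundamental_qsym n) (compositions_upto n) (G w) (c w)"
    show "gapP_on {(w, \<mu>). \<exists>n. w \<in> A n \<and> \<mu> \<in> partitions_upto n} encode (\<lambda>(w, \<mu>). d w \<mu>)"
    proof (rule *[of False])
      fix w n and v :: "nat list" assume w: "w \<in> A n" and v: "length v \<le> n"
      let ?f = "nonzero_parts v"
      have "coarsen_sum False v [] (?F w) = (\<Sum>\<beta> \<in> coarsenings 0 ?f. h (encode (w, \<beta>)))"
        using coarsen_sum_coarsenings[of "\<lambda>z. h (word_pair w z)" "\<lambda>\<alpha>. h (encode (w, \<alpha>))" v 0 "[]"]
        by (simp add: encode_def)
      also have "\<dots> = (\<Sum>\<beta> \<in> coarsenings 0 ?f. c w \<beta>)"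
        using coarsenings_upto[OF v] h(2)[OF w] by (intro sum.cong) auto
      also have "\<dots> = lookup (G w) (monom_at 1 v)"
        by (rule lookup_fundamental_expansion[OF F[rule_format, OF w] v, symmetric])
      finally show "coarsen_sum False v [] (?F w) = lookup (G w) (monom_at 1 v)" .
    qed
  next
    assume M: "\<forall>n. \<forall>w \<in> A n. expands_in (monomial_qsym n) (compositions_upto n) (G w) (c w)"
    show "gapP_on {(w, \<mu>). \<exists>n. w \<in> A n \<and> \<mu> \<in> partitions_upto n} encode (\<lambda>(w, \<mu>). d w \<mu>)"
    proof (rule *[of True])
      fix w n and v :: "nat list" assume w: "w \<in> A n" and v: "length v \<le> n"
      let ?f = "nonzero_parts v"
      have f: "?f \<in> compositions_upto n" using v by (rule nonzero_parts_upto)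
      have "coarsen_sum True v [] (?F w) = h (encode (w, ?f))"
        by (simp add: coarsen_sum_strict closed_output_rev_unary encode_def)
      also have "\<dots> = c w ?f" using h(2)[OF w f] by simp
      also have "\<dots> = lookup (G w) (monom_at 1 v)"
        by (rule lookup_monomial_expansion[OF M[rule_format, OF w] v, symmetric])
      finally show "coarsen_sum True v [] (?F w) = lookup (G w) (monom_at 1 v)" .
    qed
  qed
qed

end
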